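(* Consider the full qubit model at $\theta=(0,0,r)$ with $0\le r<1$, and let $G=\begin{pmatrix}\tilde G&g\\ g^T&s\end{pmatrix}$ be a real symmetric positive definite $3\times3$ matrix ($\tilde G$ $2\times2$, $g\in\mathbb{R}^2$, $s\in\mathbb{R}$). Then the quantum Cramér–Rao bound equals the RLD bound: $$C_{(0,0,r)}(G)=C^R_{(0,0,r)}(G)=\mathrm{tr}\,G-r^2s+2r\sqrt{\det\tilde G}.$$ That is, every sequence of estimators $M^n$ on $(\mathbb{C}^2)^{\otimes n}$ asymptotically unbiased at $(0,0,r)$ satisfies $\liminf_n n\,\mathrm{tr}\,GV_{(0,0,r)}(M^n)\ge\mathrm{tr}\,G-r^2s+2r\sqrt{\det\tilde G}$, and there exists an asymptotically unbiased sequence with $\lim_n n\,\mathrm{tr}\,GV_{(0,0,r)}(M^n)=\mathrm{tr}\,G-r^2s+2r\sqrt{\det\tilde G}$.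
   Context: Full qubit model: $\rho_\theta=\frac12I+\sum_{i=1}^3\theta^i\sigma_i$ on $\mathbb{C}^2$, $\|\theta\|<1$, with $\sigma_1=\frac12\begin{pmatrix}0&1\\1&0\end{pmatrix}$, $\sigma_2=\frac12\begin{pmatrix}0&-i\\i&0\end{pmatrix}$, $\sigma_3=\frac12\begin{pmatrix}1&0\\0&-1\end{pmatrix}$. RLD Fisher matrix $\tilde J_\theta$ and RLD bound $C^R_\theta(G)=\mathrm{tr}\sqrt G\,\mathrm{Re}(\tilde J_\theta^{-1})\sqrt G+\mathrm{tr}|\sqrt G\,\mathrm{Im}(\tilde J_\theta^{-1})\sqrt G|$, where $\partial_j\rho_\theta=\rho_\theta\tilde L_{\theta;j}$, $\tilde J_{\theta;j,k}=\mathrm{Tr}\,\rho_\theta\tilde L_{\theta;k}\tilde L_{\theta;j}^*$, $\mathrm{Re}W=(W+\bar W)/2$, $\mathrm{Im}W=(W-\bar W)/(2i)$, $|A|=(A^*A)^{1/2}$. An estimator for $n$ copies is a POVM $M^n$ on $(\mathbb{C}^2)^{\otimes n}$ with outcomes $\hat\theta\in\mathbb{R}^3$; $E^j_\theta(M^n)=\int\hat\theta^j\mathrm{Tr}\,M^n(d\hat\theta)\rho_\theta^{\otimes n}$, $A^j_{\theta;k}(M^n)=\partial_kE^j_\theta(M^n)$, $V^{k,j}_\theta(M^n)=\int(\hat\theta^k-\theta^k)(\hat\theta^j-\theta^j)\mathrm{Tr}\,M^n(d\hat\theta)\rho_\theta^{\otimes n}$. The sequence is asymptotically unbiased at $\theta$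 if $E_\theta(M^n)\to\theta$ and $A_\theta(M^n)\to I$. The quantum Cramér–Rao bound $C_\theta(G)$ is the infimum over asymptotically unbiased sequences of $\liminf_n n\,\mathrm{tr}\,GV_\theta(M^n)$. *)

theory Defs
  imports "HOL-Analysis.Analysis"
begin

text \<open>Single-qubit matrices are complex^2^2; index 1 of type 2 is the first basis
vector, index 2 the second. Parameters live in real^3 with components 1,2,3.\<close>

definition sig :: "3 \<Rightarrow> complex^2^2" where
  "sig i = (if i = 1 then (\<chi> a b. if a = b then 0 else 1/2)
            else if i = 2 then (\<chi> a b. if a = b then 0 else if a = 1 then - \<i>/2 else \<i>/2)
            else (\<chi> a b. if a \<noteq> b then 0 else if a = 1 then 1/2 else - 1/2))"

definition rho :: "real^3 \<Rightarrow> complex^2^2" where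
  "rho \<theta> = (\<chi> a b. (if a = b then 1/2 else 0) + (\<Sum>i\<in>UNIV. complex_of_real (\<theta>$i) * (sig i)$a$b))"

definition Theta :: "(real^3) set" where
  "Theta = {\<theta>. norm \<theta> < 1}"

definition cadj :: "complex^'n^'n \<Rightarrow> complex^'n^'n" where
  "cadj M = (\<chi> a b. cnj (M$b$a))"

definition drho :: "real^3 \<Rightarrow> 3 \<Rightarrow> complex^2^2" where
  "drho \<theta> j = vector_derivative (\<lambda>t::real. rho (\<theta> + t *\<^sub>R axis j 1)) (at 0)"

definition RLD_L :: "real^3 \<Rightarrow> 3 \<Rightarrow> complex^2^2" where
  "RLD_L \<theta> j = (THE L. drho \<theta> j = rho \<theta> ** L)"

definition RLD_J :: "real^3 \<Rightarrow> complex^3^3" where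
  "RLD_J \<theta> = (\<chi> j k. trace (rho \<theta> ** RLD_L \<theta> k ** cadj (RLD_L \<theta> j)))"

definition psd_real :: "real^'n^'n \<Rightarrow> bool" where
  "psd_real S \<longleftrightarrow> transpose S = S \<and> (\<forall>x. 0 \<le> x \<bullet> (S *v x))"

definition msqrt :: "real^'n^'n \<Rightarrow> real^'n^'n" where
  "msqrt A = (THE S. psd_real S \<and> S ** S = A)"

definition trace_abs :: "real^'n^'n \<Rightarrow> real" where
  "trace_abs A = trace (msqrt (transpose A ** A))"

definition RLD_bound :: "real^3 \<Rightarrow> real^3^3 \<Rightarrow> real" where
  "RLD_bound \<theta> G =
     (let W = matrix_inv (RLD_J \<theta>);
          ReW = (\<chi> j k. Re (W$j$k));
          ImW = (\<chi> j k. Im (W$j$k));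
          sG = msqrt G
      in trace (sG ** ReW ** sG) + trace_abs (sG ** ImW ** sG))"

text \<open>Operators on (C^2)^{\<otimes>n} are 2^n x 2^n matrices, represented as nat \<Rightarrow> nat \<Rightarrow> complex
with indices < 2^n; index i corresponds to the basis vector whose k-th tensor factor is
bit k of i.\<close>

definition idx2 :: "nat \<Rightarrow> 2" where
  "idx2 b = (if b = 0 then 1 else 2)"

definition tpow :: "nat \<Rightarrow> complex^2^2 \<Rightarrow> nat \<Rightarrow> nat \<Rightarrow> complex" where
  "tpow n \<rho> i j = (\<Prod>k<n. \<rho> $ idx2 (i div 2^k mod 2) $ idx2 (j div 2^k mod 2))"

definition is_povm :: "nat \<Rightarrow> ((real^3) set \<Rightarrow> nat \<Rightarrow> nat \<Rightarrow> complex) \<Rightarrow> bool" where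
  "is_povm d M \<longleftrightarrow>
     (\<forall>A\<in>sets borel. \<forall>v::nat \<Rightarrow> complex.
        (\<Sum>i<d. \<Sum>j<d. cnj (v i) * M A i j * v j) \<in> \<real> \<and>
        0 \<le> Re (\<Sum>i<d. \<Sum>j<d. cnj (v i) * M A i j * v j)) \<and>
     (\<forall>i<d. \<forall>j<d. M UNIV i j = (if i = j then 1 else 0)) \<and>
     (\<forall>A. range A \<subseteq> sets borel \<longrightarrow> disjoint_family A \<longrightarrow>
        (\<forall>i<d. \<forall>j<d. (\<lambda>k. M (A k) i j) sums M (\<Union>k. A k) i j))"

definition outcome_dist :: "nat \<Rightarrow> ((real^3) set \<Rightarrow> nat \<Rightarrow> nat \<Rightarrow> complex)
                             \<Rightarrow> (nat \<Rightarrow> nat \<Rightarrow> complex) \<Rightarrow> (real^3) measure" where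
  "outcome_dist d M \<rho> = measure_of UNIV (sets borel)
      (\<lambda>A. ennreal (Re (\<Sum>i<d. \<Sum>j<d. M A i j * \<rho> j i)))"

definition Pn :: "nat \<Rightarrow> ((real^3) set \<Rightarrow> nat \<Rightarrow> nat \<Rightarrow> complex) \<Rightarrow> real^3 \<Rightarrow> (real^3) measure" where
  "Pn n M \<theta> = outcome_dist (2^n) M (tpow n (rho \<theta>))"

definition Emean :: "nat \<Rightarrow> ((real^3) set \<Rightarrow> nat \<Rightarrow> nat \<Rightarrow> complex) \<Rightarrow> real^3 \<Rightarrow> real^3" where
  "Emean n M \<theta> = (\<chi> j. \<integral>x. x$j \<partial>Pn n M \<theta>)"

definition Amat :: "nat \<Rightarrow> ((real^3) set \<Rightarrow> nat \<Rightarrow> nat \<Rightarrow> complex) \<Rightarrow> real^3 \<Rightarrow> real^3^3" where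
  "Amat n M \<theta> = (\<chi> j k. vector_derivative (\<lambda>t::real. Emean n M (\<theta> + t *\<^sub>R axis k 1) $ j) (at 0))"

definition Vmat :: "nat \<Rightarrow> ((real^3) set \<Rightarrow> nat \<Rightarrow> nat \<Rightarrow> complex) \<Rightarrow> real^3 \<Rightarrow> real^3^3" where
  "Vmat n M \<theta> = (\<chi> k j. \<integral>x. (x$k - \<theta>$k) * (x$j - \<theta>$j) \<partial>Pn n M \<theta>)"

definition nTrGV :: "nat \<Rightarrow> real^3^3 \<Rightarrow> ((real^3) set \<Rightarrow> nat \<Rightarrow> nat \<Rightarrow> complex) \<Rightarrow> real^3 \<Rightarrow> ereal" where
  "nTrGV n G M \<theta> =
     (if (\<forall>j. integrable (Pn n M \<theta>) (\<lambda>x. (x$j - \<theta>$j)^2))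
      then ereal (real n * trace (G ** Vmat n M \<theta>)) else \<infinity>)"

definition asym_unbiased :: "real^3 \<Rightarrow> (nat \<Rightarrow> (real^3) set \<Rightarrow> nat \<Rightarrow> nat \<Rightarrow> complex) \<Rightarrow> bool" where
  "asym_unbiased \<theta> Ms \<longleftrightarrow>
     (\<forall>n. is_povm (2^n) (Ms n)) \<and>
     (\<forall>\<^sub>F n in sequentially.
        (\<exists>U. open U \<and> \<theta> \<in> U \<and> U \<subseteq> Theta \<and>
             (\<forall>\<theta>'\<in>U. \<forall>j. integrable (Pn n (Ms n) \<theta>') (\<lambda>x. x$j))) \<and>
        (\<forall>j k. (\<lambda>t::real. Emean n (Ms n) (\<theta> + t *\<^sub>R axis k 1) $ j) differentiable (at 0))) \<and>
     (\<lambda>n. Emean n (Ms n) \<theta>) \<longlonglongrightarrow> \<theta> \<and>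
     (\<lambda>n. Amat n (Ms n) \<theta>) \<longlonglongrightarrow> mat 1"

definition QCR_bound :: "real^3 \<Rightarrow> real^3^3 \<Rightarrow> ereal" where
  "QCR_bound \<theta> G = (INF Ms \<in> {Ms. asym_unbiased \<theta> Ms}. liminf (\<lambda>n. nTrGV n G (Ms n) \<theta>))"

end

theory Submission
  imports Defs "HOL-Real_Asymp.Real_Asymp"
begin

text \<open>Lower bound. Write \<open>G\<close> as the real part of a rank-two positive Hermitian matrix, so that
\<open>tr G V\<close> is the expectation of \<open>|f|^2 + |g|^2\<close> with \<open>f\<close> complex linear and \<open>g\<close> real linear in the
error. Expanding the positive expression \<open>Tr M(dx) (f - Y) \<rho> (f - Y)^*\<close> bounds each expectation from
below in terms of \<open>\<rho> Y\<close>, for which we take a complex combination of the derivatives of \<open>\<rho>^{\<otimes>n}\<close>;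
its information term is additive over the copies.

Achievability. Measure the collective spins one after the other: first \<open>J_3\<close> weakly, with pointer
noise of variance \<open>o(n)\<close>; then weakly the component \<open>J_a\<close> along an eigenvector of the upper
\<open>2 \<times> 2\<close> block of \<open>G\<close>, with pointer noise proportional to \<open>n\<close>; finally \<open>J_e\<close>, for the orthogonal
eigenvector, projectively. The second pointer turns the spin about the axis \<open>a\<close> and
thereby adds a multiple of \<open>J_3^2\<close> to the second moment of \<open>J_e\<close>. The product of the two noises is
minimal for Gaussian pointers; the amplitudes \<open>C(m,k) / sqrt C(2m,m)\<close> attain it asymptotically
and have, by Vandermonde's identity, rational overlaps and variance.\<close>


subsection \<open>Collective operators on tensor powers of the qubit\<close>

text \<open>Real linear functionals alone would bound tr G V by the term with the real part of the
  inverse RLD matrix; a complex functional also picks up its imaginary part, the source of 2 r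
  sqrt(det). Unbiasedness holds only asymptotically, so the inequality is proved for each n with the
  actual derivative matrix of the mean, and the limit is taken last. In the measurement the same
  term is a trade-off. A pointer of size m = q n on J_a costs A q / 2 in noise and 2 r^2 E / q in
  back action, where A and E are the eigenvalues of the upper block of G. The minimum 2 r sqrt(A E)
  is reached at q = 2 r sqrt(E / A). The pointer on J_3 is asymptotically free: the state at (0,0,r)
  commutes with J_3, so second moments at that state are not disturbed and the transverse means
  shrink by a factor tending to 1. All moments are closed expressions for each n, which leaves only
  limits of scalars.\<close>

type_synonym cmat = "nat \<Rightarrow> nat \<Rightarrow> complex"

definition tens :: "complex^2^2 \<Rightarrow> cmat \<Rightarrow> cmat" where
  "tens A B i j = A $ idx2 (i mod 2) $ idx2 (j mod 2) * B (i div 2) (j div 2)"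

definition mm :: "nat \<Rightarrow> cmat \<Rightarrow> cmat \<Rightarrow> cmat" where
  "mm d A B i j = (\<Sum>k<d. A i k * B k j)"

definition tr :: "nat \<Rightarrow> cmat \<Rightarrow> complex" where
  "tr d A = (\<Sum>i<d. A i i)"

definition adj :: "cmat \<Rightarrow> cmat" where
  "adj A i j = cnj (A j i)"

text \<open>Matrices are total functions; those built from \<^term>\<open>tens\<close> are \<open>2^n\<close>-periodic in both
indices, so that the identities below need no bounds on the indices.\<close>

definition one_n :: "nat \<Rightarrow> cmat" where
  "one_n n = tpow n (mat 1)"

fun Spin :: "nat \<Rightarrow> complex^2^2 \<Rightarrow> cmat" where
  "Spin 0 s = (\<lambda>i j. 0)"
| "Spin (Suc n) s = (\<lambda>i j. tens s (one_n n) i j + tens (mat 1) (Spin n s) i j)"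

fun wt :: "nat \<Rightarrow> nat \<Rightarrow> nat" where
  "wt 0 i = 0"
| "wt (Suc n) i = i mod 2 + wt n (i div 2)"

lemma idx2_simps [simp]: "idx2 0 = 1" "idx2 (Suc 0) = 2" "idx2 1 = 2"
  by (auto simp: idx2_def)

text \<open>The lowest bit carries the factor that \<open>tens\<close> puts first, so splitting into
  even and odd indices is the induction step over the number of copies.\<close>

lemma sum_pow2_Suc:
  fixes f :: "nat \<Rightarrow> 'a::comm_monoid_add"
  shows "(\<Sum>k<2^Suc n. f k) = (\<Sum>k<2^n. f (2*k) + f (2*k+1))"
proof -
  have "(\<Sum>k<2*m. f k) = (\<Sum>k<m. f (2*k) + f (2*k+1))" for m
    by (induction m) (auto simp: algebra_simps)
  then show ?thesis by simp
qed

lemma Suc_mult_two_mod_div [simp]: "Suc (k * 2) mod 2 = Suc 0" "Suc (k * 2) div 2 = k"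
  by presburger+

lemma tpow_0: "tpow 0 A = (\<lambda>i j. 1)"
  by (simp add: tpow_def fun_eq_iff)

lemma tpow_Suc: "tpow (Suc n) A = tens A (tpow n A)"
  by (auto simp: tpow_def tens_def fun_eq_iff prod.lessThan_Suc_shift div_mult2_eq
           simp del: prod.lessThan_Suc)

lemma mm_tens:
  "mm (2^Suc n) (tens A B) (tens A' B') = tens (A ** A') (mm (2^n) B B')"
proof (intro ext)
  fix i j
  have "mm (2^Suc n) (tens A B) (tens A' B') i j =
    (\<Sum>k<2^n. (A $ idx2 (i mod 2) $ 1 * A' $ 1 $ idx2 (j mod 2) + A $ idx2 (i mod 2) $ 2 * A' $ 2 $ idx2 (j mod 2))
       * (B (i div 2) k * B' k (j div 2)))"
    unfolding mm_def sum_pow2_Suc by (simp add: tens_def algebra_simps)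
  also have "\<dots> = tens (A ** A') (mm (2^n) B B') i j"
    by (simp add: tens_def mm_def matrix_matrix_mult_def UNIV_2 sum_distrib_left)
  finally show "mm (2^Suc n) (tens A B) (tens A' B') i j = tens (A ** A') (mm (2^n) B B') i j" .
qed

lemma tr_tens: "tr (2^Suc n) (tens A B) = trace A * tr (2^n) B"
  unfolding tr_def sum_pow2_Suc
  by (simp add: tens_def trace_def UNIV_2 sum_distrib_left algebra_simps sum.distrib)

lemma mm_add_left: "mm d (\<lambda>i j. A i j + B i j) C = (\<lambda>i j. mm d A C i j + mm d B C i j)"
  by (simp add: mm_def fun_eq_iff algebra_simps sum.distrib)

lemma mm_add_right: "mm d C (\<lambda>i j. A i j + B i j) = (\<lambda>i j. mm d C A i j + mm d C B i j)"
  by (simp add: mm_def fun_eq_iff algebra_simps sum.distrib)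

lemma mm_scale_left: "mm d (\<lambda>i j. c * A i j) C = (\<lambda>i j. c * mm d A C i j)"
  by (simp add: mm_def fun_eq_iff algebra_simps sum_distrib_left)

lemma mm_scale_right: "mm d C (\<lambda>i j. c * A i j) = (\<lambda>i j. c * mm d C A i j)"
  by (simp add: mm_def fun_eq_iff algebra_simps sum_distrib_left)

lemma mm_zero [simp]: "mm d (\<lambda>i j. 0) C = (\<lambda>i j. 0)" "mm d C (\<lambda>i j. 0) = (\<lambda>i j. 0)"
  by (simp_all add: mm_def fun_eq_iff)

lemma mm_assoc: "mm d (mm d A B) C = mm d A (mm d B C)"
proof (intro ext)
  fix i j
  have "mm d (mm d A B) C i j = (\<Sum>k<d. \<Sum>l<d. A i l * B l k * C k j)"
    by (simp add: mm_def sum_distrib_right)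
  also have "\<dots> = (\<Sum>l<d. \<Sum>k<d. A i l * B l k * C k j)"
    by (rule sum.swap)
  also have "\<dots> = mm d A (mm d B C) i j"
    by (simp add: mm_def sum_distrib_left mult.assoc)
  finally show "mm d (mm d A B) C i j = mm d A (mm d B C) i j" .
qed

lemma tr_add: "tr d (\<lambda>i j. A i j + B i j) = tr d A + tr d B"
  by (simp add: tr_def sum.distrib)

lemma tr_scale: "tr d (\<lambda>i j. c * A i j) = c * tr d A"
  by (simp add: tr_def sum_distrib_left)

lemma mm_tpow: "mm (2^n) (tpow n A) (tpow n B) = tpow n (A ** B)"
proof (induction n)
  case 0
  then show ?case by (simp add: tpow_0 mm_def fun_eq_iff)
next
  case (Suc n)
  then show ?case unfolding tpow_Suc by (subst mm_tens) simp
qed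

lemma one_n_Suc: "one_n (Suc n) = tens (mat 1) (one_n n)"
  by (simp add: one_n_def tpow_Suc)

lemma one_n_0: "one_n 0 = (\<lambda>i j. 1)"
  by (simp add: one_n_def tpow_0)

lemma mm_one_n [simp]: "mm (2^n) (one_n n) (tpow n A) = tpow n A" "mm (2^n) (tpow n A) (one_n n) = tpow n A"
  by (simp_all add: one_n_def mm_tpow)

lemma mm_one_n_self [simp]: "mm (2^n) (one_n n) (one_n n) = one_n n"
  by (simp add: one_n_def mm_tpow)

lemma mm_one_n_Spin [simp]: "mm (2^n) (one_n n) (Spin n s) = Spin n s" "mm (2^n) (Spin n s) (one_n n) = Spin n s"
proof (induction n)
  case 0
  { case 1 then show ?case by simp }
  { case 2 then show ?case by simp }
next
  case (Suc n)
  { case 1 then show ?case using Suc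
      unfolding Spin.simps one_n_Suc by (simp only: mm_add_right mm_tens) simp }
  { case 2 then show ?case using Suc
      unfolding Spin.simps one_n_Suc by (simp only: mm_add_left mm_tens) simp }
qed

lemma mod_double_eq_iff:
  fixes i j m :: nat
  shows "i mod (2*m) = j mod (2*m) \<longleftrightarrow> i mod 2 = j mod 2 \<and> (i div 2) mod m = (j div 2) mod m"
proof -
  have "2*x + a = 2*y + b \<longleftrightarrow> a = b \<and> x = y" if "a < 2" "b < 2" for x y a b :: nat
    using that by presburger
  then show ?thesis unfolding mod_mult2_eq by simp
qed

lemma one_n_eq: "one_n n i j = (if i mod 2^n = j mod 2^n then 1 else 0)"
proof (induction n arbitrary: i j)
  case 0
  then show ?case by (simp add: one_n_0)
next
  case (Suc n)
  have *: "i mod (2*2^n) = j mod (2*2^n) \<longleftrightarrow> i mod 2 = j mod 2 \<and> (i div 2) mod 2^n = (j div 2) mod 2^n"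
    by (rule mod_double_eq_iff)
  show ?case
    by (auto simp: one_n_Suc tens_def Suc * mat_def idx2_def)
qed

text \<open>Only the factor carrying \<open>s\<close> changes: in every other factor
  \<open>U\<close> meets \<open>U'\<close> and cancels.\<close>

lemma Spin_conj:
  assumes "U ** U' = mat 1"
  shows "mm (2^n) (tpow n U) (mm (2^n) (Spin n s) (tpow n U')) = Spin n (U ** s ** U')"
proof (induction n)
  case 0
  then show ?case by simp
next
  case (Suc n)
  have "mm (2^n) (tpow n U) (tpow n U') = one_n n"
    by (simp add: mm_tpow assms one_n_def)
  then show ?case
    using Suc assms unfolding Spin.simps tpow_Suc
    by (simp only: mm_add_left mm_add_right mm_tens) (simp add: matrix_mul_assoc)
qed

lemma Spin_add: "Spin n (s + t) = (\<lambda>i j. Spin n s i j + Spin n t i j)"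
  by (induction n) (auto simp: tens_def fun_eq_iff algebra_simps)

lemma Spin_scale: "Spin n (\<chi> a b. c * s$a$b) = (\<lambda>i j. c * Spin n s i j)"
  by (induction n) (auto simp: tens_def fun_eq_iff algebra_simps)

lemma tr_tpow: "tr (2^n) (tpow n A) = trace A ^ n"
proof (induction n)
  case 0
  then show ?case by (simp add: tpow_0 tr_def)
next
  case (Suc n)
  then show ?case unfolding tpow_Suc by (subst tr_tens) simp
qed

lemma tr_Spin_tpow:
  assumes "trace \<rho> = 1"
  shows "tr (2^n) (mm (2^n) (Spin n s) (tpow n \<rho>)) = of_nat n * trace (s ** \<rho>)"
proof (induction n)
  case 0
  then show ?case by (simp add: tr_def)
next
  case (Suc n)
  then show ?case unfolding Spin.simps tpow_Suc
    by (simp only: mm_add_left mm_add_right mm_tens tr_add tr_tens)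
       (simp add: tr_tpow assms algebra_simps)
qed

text \<open>The n pairs of equal copies contribute \<open>s ** s\<close>, and the n (n - 1) pairs of
  distinct copies factorize. For J_3 this grows like n^2, which is why a back action of order 1/n is
  visible at the scale of the variance.\<close>

lemma tr_Spin_Spin_tpow:
  assumes "trace \<rho> = 1"
  shows "tr (2^n) (mm (2^n) (mm (2^n) (Spin n s) (Spin n s)) (tpow n \<rho>)) =
     of_nat n * trace (s ** s ** \<rho>) + of_nat n * (of_nat n - 1) * (trace (s ** \<rho>))^2"
proof (induction n)
  case 0
  then show ?case by (simp add: tr_def)
next
  case (Suc n)
  then show ?case unfolding Spin.simps tpow_Suc
    by (simp only: mm_add_left mm_add_right mm_tens tr_add tr_tens)
       (simp add: tr_tpow tr_Spin_tpow[OF assms] assms algebra_simps power2_eq_square)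
qed

section \<open>The grading of collective spins by Hamming weight\<close>

lemma Spin_diag: "Spin n (sig 3) i j = (of_nat n / 2 - of_nat (wt n i)) * one_n n i j"
proof (induction n arbitrary: i j)
  case 0
  then show ?case by simp
next
  case (Suc n)
  have s: "sig 3 $ 1 $ 1 = 1/2" "sig 3 $ 2 $ 2 = -1/2" "sig 3 $ 1 $ 2 = 0" "sig 3 $ 2 $ 1 = 0"
    by (simp_all add: sig_def)
  show ?case
    by (cases "i mod 2 = 0"; cases "j mod 2 = 0")
       (auto simp: tens_def one_n_Suc Suc mat_def idx2_def s field_simps)
qed

lemma wt_le: "wt n i \<le> n"
proof (induction n arbitrary: i)
  case (Suc n)
  have "i mod 2 \<le> 1" by simp
  with Suc[of "i div 2"] show ?case by simp
qed simp

lemma wt_cong: "i mod 2^n = j mod 2^n \<Longrightarrow> wt n i = wt n j"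
proof (induction n arbitrary: i j)
  case (Suc n)
  then have "i mod 2 = j mod 2" "(i div 2) mod 2^n = (j div 2) mod 2^n"
    using mod_double_eq_iff[of i "2^n" j] by simp_all
  then show ?case using Suc.IH[of "i div 2" "j div 2"] by simp
qed simp

lemma one_n_wt: "one_n n i j \<noteq> 0 \<Longrightarrow> wt n i = wt n j"
  using wt_cong[of i n j] by (simp add: one_n_eq split: if_splits)

text \<open>Unlike \<open>sig 1\<close> and \<open>sig 2\<close>, the two matrix units change the
  weight by a definite amount, so a pointer coupled to the weight acts on their collective sums as a
  scalar.\<close>

definition E12 :: "complex^2^2" where "E12 = (\<chi> a b. if a = 1 \<and> b = 2 then 1 else 0)"
definition E21 :: "complex^2^2" where "E21 = (\<chi> a b. if a = 2 \<and> b = 1 then 1 else 0)"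

lemma Spin_E12_wt: "Spin n E12 i j \<noteq> 0 \<Longrightarrow> wt n j = wt n i + 1"
proof (induction n arbitrary: i j)
  case 0
  then show ?case by simp
next
  case (Suc n)
  have h: "one_n n (i div 2) (j div 2) \<noteq> 0 \<Longrightarrow> wt n (i div 2) = wt n (j div 2)"
    by (rule one_n_wt)
  have "Spin (Suc n) E12 i j = (if i mod 2 = 0 \<and> j mod 2 = 1 then one_n n (i div 2) (j div 2) else 0)
      + (if i mod 2 = j mod 2 then Spin n E12 (i div 2) (j div 2) else 0)"
    by (cases "i mod 2 = 0"; cases "j mod 2 = 0")
       (auto simp: tens_def mat_def idx2_def E12_def)
  then consider "i mod 2 = 0 \<and> j mod 2 = 1" "one_n n (i div 2) (j div 2) \<noteq> 0"
    | "i mod 2 = j mod 2" "Spin n E12 (i div 2) (j div 2) \<noteq> 0"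
    using Suc.prems by (auto split: if_splits)
  then show ?case
  proof cases
    case 1
    then show ?thesis using h[OF 1(2)] by simp
  next
    case 2
    then show ?thesis using Suc.IH[OF 2(2)] by simp
  qed
qed

lemma Spin_E21: "Spin n E21 i j = Spin n E12 j i"
proof (induction n arbitrary: i j)
  case (Suc n)
  have e: "E21 $ a $ b = E12 $ b $ a" for a b by (simp add: E12_def E21_def conj_commute)
  have o: "one_n n (i div 2) (j div 2) = one_n n (j div 2) (i div 2)" by (auto simp: one_n_eq)
  have m: "(mat 1 :: complex^2^2) $ a $ b = mat 1 $ b $ a" for a b by (auto simp: mat_def)
  show ?case
    unfolding Spin.simps tens_def e Suc o m[of "idx2 (i mod 2)"] by (rule refl)
qed simp

lemma Spin_E21_wt: "Spin n E21 i j \<noteq> 0 \<Longrightarrow> wt n i = wt n j + 1"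
  unfolding Spin_E21 by (rule Spin_E12_wt)

lemma adj_tpow: "adj (tpow n A) = tpow n (cadj A)"
  by (simp add: adj_def tpow_def cadj_def fun_eq_iff)

subsection \<open>A binomial pointer\<close>

text \<open>Here \<open>x\<close> is the pointer reading and \<open>a\<close> the weight by which
  the pointer was shifted. The sum of the squared binomial coefficients is
  \<open>2*m choose m\<close>, whence the normalization; the test \<open>a \<le> x\<close> guards
  the truncated subtraction.\<close>

definition amp :: "nat \<Rightarrow> nat \<Rightarrow> nat \<Rightarrow> real" where
  "amp m x a = (if a \<le> x then real (m choose (x - a)) else 0) / sqrt (real (2*m choose m))"

text \<open>Weights are at most n, so the window of readings from a to a + m always lies inside the
  range; the sum is taken over y = x - a.\<close>

lemma amp_sum_shift:
  assumes "a + j \<le> n"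
  shows "(\<Sum>x\<le>n+m. g x * (amp m x a * amp m x (a+j))) =
     (\<Sum>y\<le>m. g (a+y) * (real (m choose y) * (if j \<le> y then real (m choose (y-j)) else 0))) / real (2*m choose m)"
proof -
  let ?C = "real (2*m choose m)"
  let ?h = "\<lambda>x. g x * (amp m x a * amp m x (a+j))"
  have C: "?C > 0" by simp
  have "(\<Sum>x\<le>n+m. ?h x) = (\<Sum>x\<in>(\<lambda>y. a+y) ` {..m}. ?h x)"
  proof (rule sum.mono_neutral_right)
    show "(+) a ` {..m} \<subseteq> {..n + m}" using assms by auto
    show "\<forall>x\<in>{..n+m} - (+) a ` {..m}. ?h x = 0"
    proof
      fix x assume x: "x \<in> {..n+m} - (+) a ` {..m}"
      then have "x < a \<or> x > a + m"
        by (metis DiffD2 atMost_iff image_eqI le_add_diff_inverse not_le le_diff_conv add.commute)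
      then show "?h x = 0"
        by (auto simp: amp_def)
    qed
  qed simp
  also have "\<dots> = (\<Sum>y\<le>m. ?h (a+y))"
    by (subst sum.reindex) auto
  also have "\<dots> = (\<Sum>y\<le>m. g (a+y) * (real (m choose y) * (if j \<le> y then real (m choose (y-j)) else 0)) / ?C)"
    by (intro sum.cong refl) (auto simp: amp_def field_simps)
  finally show ?thesis by (simp add: sum_divide_distrib)
qed

lemma binomial_corr:
  assumes "j \<le> m"
  shows "(\<Sum>y\<le>m. real (m choose y) * (if j \<le> y then real (m choose (y-j)) else 0)) = real (2*m choose (m-j))"
proof -
  have "(\<Sum>y\<le>m. real (m choose y) * (if j \<le> y then real (m choose (y-j)) else 0))
     = (\<Sum>y\<in>(\<lambda>k. j+k) ` {..m-j}. real (m choose y) * (if j \<le> y then real (m choose (y-j)) else 0))"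
  proof (rule sum.mono_neutral_right)
    show "\<forall>i\<in>{..m} - (+) j ` {..m - j}. real (m choose i) * (if j \<le> i then real (m choose (i - j)) else 0) = 0"
      by (auto simp: image_iff) (metis atMost_iff diff_le_mono le_add_diff_inverse)
  qed (use assms in auto)
  also have "\<dots> = (\<Sum>k\<le>m-j. real (m choose (j+k)) * real (m choose k))"
    by (subst sum.reindex) auto
  \<comment> \<open>Symmetry turns \<open>m choose (j+k)\<close> into
    \<open>m choose (m-j-k)\<close>, the form of Vandermonde's identity.\<close>
  also have "\<dots> = (\<Sum>k\<le>m-j. real (m choose k) * real (m choose (m-j-k)))"
    using assms by (intro sum.cong refl) (auto simp: binomial_symmetric[of "j+_" m] intro!: arg_cong[where f=real] )
  also have "\<dots> = real (m + m choose (m-j))"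
    by (simp only: of_nat_mult[symmetric] of_nat_sum[symmetric] vandermonde)
  finally show ?thesis by (simp add: mult_2)
qed

lemma binomial_step: "real (Suc k) * real (n choose Suc k) = real (n - k) * real (n choose k)"
  by (metis binomial_absorb_comp binomial_absorption of_nat_mult)

lemma central_binomial_step:
  assumes "m > 0"
  shows "real (2*m choose (m-1)) / real (2*m choose m) = real m / (real m + 1)"
proof -
  obtain k where k: "m = Suc k" using assms gr0_implies_Suc by blast
  have "real (2*m choose m) > 0" by simp
  moreover have "real m * real (2*m choose m) = (real m + 1) * real (2*m choose (m-1))"
    using binomial_step[of k "2*m"] k by (simp add: algebra_simps del: binomial_Suc_Suc)
  ultimately show ?thesis by (simp add: field_simps)
qed

lemma central_binomial_step2:
  assumes "m > 1"
  shows "real (2*m choose (m-2)) / real (2*m choose m) = real m * (real m - 1) / ((real m + 1) * (real m + 2))"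
proof -
  obtain k where k: "m = Suc (Suc k)" using assms by (metis less_imp_Suc_add One_nat_def add_Suc plus_1_eq_Suc)
  have "(real m - 1) * real (2*m choose (m-1)) = (real m + 2) * real (2*m choose (m-2))"
    using binomial_step[of k "2*m"] k by (simp add: algebra_simps del: binomial_Suc_Suc)
  then have "real (2*m choose (m-2)) = (real m - 1) * real (2*m choose (m-1)) / (real m + 2)"
    by (simp add: field_simps)
  then have "real (2*m choose (m-2)) / real (2*m choose m)
     = (real m - 1) / (real m + 2) * (real (2*m choose (m-1)) / real (2*m choose m))"
    by simp
  also have "\<dots> = (real m - 1) / (real m + 2) * (real m / (real m + 1))"
    using assms by (simp only: central_binomial_step)
  finally show ?thesis by (simp add: mult.commute)
qed

text \<open>Inner products of the amplitude with its translates by one and by two, and the variance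
  of the squared amplitude. For large m they behave like 1 - 1/m, 1 - 4/m and m/8, as for a Gaussian
  amplitude of variance m/8.\<close>

definition overlap1 :: "nat \<Rightarrow> real" where "overlap1 m = real m / (real m + 1)"
definition overlap2 :: "nat \<Rightarrow> real" where "overlap2 m = real m * (real m - 1) / ((real m + 1) * (real m + 2))"
definition ptr_var :: "nat \<Rightarrow> real" where "ptr_var m = (real m)^2 / (4 * (2 * real m - 1))"

lemma amp_corr0:
  assumes "a \<le> n" shows "(\<Sum>x\<le>n+m. amp m x a * amp m x a) = 1"
  using amp_sum_shift[of a 0 n "\<lambda>_. 1" m] binomial_corr[of 0 m] assms by simp

lemma amp_corr1:
  assumes "a + 1 \<le> n" shows "(\<Sum>x\<le>n+m. amp m x a * amp m x (a+1)) = overlap1 m"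
proof (cases "m = 0")
  case True
  then show ?thesis using amp_sum_shift[of a 1 n "\<lambda>_. 1" m] assms by (simp add: overlap1_def)
next
  case False
  then show ?thesis using amp_sum_shift[of a 1 n "\<lambda>_. 1" m] binomial_corr[of 1 m] assms central_binomial_step[of m]
    by (simp add: overlap1_def)
qed

lemma amp_corr2:
  assumes "a + 2 \<le> n" shows "(\<Sum>x\<le>n+m. amp m x a * amp m x (a+2)) = overlap2 m"
proof (cases "m \<le> 1")
  \<comment> \<open>Here m - 2 would be truncated. The two windows are disjoint, and
    \<open>overlap2\<close> vanishes through its factor m (m - 1).\<close>
  case True
  then have "m = 0 \<or> m = 1" by auto
  then show ?thesis using amp_sum_shift[of a 2 n "\<lambda>_. 1" m] assms by (auto simp: overlap2_def)
next
  case False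
  then show ?thesis using amp_sum_shift[of a 2 n "\<lambda>_. 1" m] binomial_corr[of 2 m] assms central_binomial_step2[of m]
    by (simp add: overlap2_def)
qed

abbreviation bsq :: "nat \<Rightarrow> nat \<Rightarrow> real" where "bsq m y \<equiv> real (m choose y) * real (m choose y)"

lemma binomial_sq_moment0: "(\<Sum>y\<le>m. bsq m y) = real (2*m choose m)"
  using binomial_corr[of 0 m] by simp

text \<open>The weights are symmetric under y -> m - y, so their mean is the midpoint m / 2.\<close>

lemma binomial_sq_moment1:
  "(\<Sum>y\<le>m. real y * bsq m y) = real m / 2 * real (2*m choose m)"
proof -
  let ?S = "\<Sum>y\<le>m. real y * bsq m y"
  have "?S = (\<Sum>y\<le>m. real (m - y) * (real (m choose (m-y)) * real (m choose (m-y))))"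
    by (rule sum.reindex_bij_witness[of _ "\<lambda>y. m - y" "\<lambda>y. m - y"]) auto
  also have "\<dots> = (\<Sum>y\<le>m. (real m - real y) * bsq m y)"
    by (intro sum.cong refl) (auto simp: binomial_symmetric[symmetric])
  also have "\<dots> = real m * (\<Sum>y\<le>m. real (m choose y) * real (m choose y)) - ?S"
    by (simp add: algebra_simps sum_subtractf sum_distrib_left)
  finally show ?thesis unfolding binomial_sq_moment0 by simp
qed

text \<open>Absorption of the factor y into the binomial coefficient reduces the sum to the zeroth
  moment for m - 1. What remains is the ratio of two neighbouring central binomial
  coefficients.\<close>

lemma binomial_sq_moment2:
  "(\<Sum>y\<le>m. (real y)^2 * bsq m y) =
    ((real m / 2)^2 + ptr_var m) * real (2*m choose m)"
proof (cases m)
  case 0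
  then show ?thesis by (simp add: ptr_var_def)
next
  case (Suc p)
  have "(\<Sum>y\<le>m. (real y)^2 * bsq m y) =
      (\<Sum>y\<le>p. (real (Suc y) * real (Suc p choose Suc y))^2)"
    unfolding Suc by (subst sum.atMost_Suc_shift) (simp add: power2_eq_square algebra_simps del: binomial_Suc_Suc)
  also have "\<dots> = (\<Sum>y\<le>p. (real m)^2 * (real (p choose y) * real (p choose y)))"
  proof (intro sum.cong refl)
    fix y
    have "real (Suc y) * real (Suc p choose Suc y) = real m * real (p choose y)"
      using Suc by (metis Suc_times_binomial of_nat_mult)
    then show "(real (Suc y) * real (Suc p choose Suc y))^2 = (real m)^2 * (real (p choose y) * real (p choose y))"
      by (simp only: power_mult_distrib) (simp add: power2_eq_square)
  qed
  also have "\<dots> = (real m)^2 * real (2*p choose p)"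
    by (simp only: sum_distrib_left[symmetric] binomial_sq_moment0)
  finally have 1: "(\<Sum>y\<le>m. (real y)^2 * bsq m y) = (real m)^2 * real (2*p choose p)" .
  have "real m * real (2*m choose m) = real (2*m) * real (2*p+1 choose p)"
    using Suc_times_binomial[of p "2*p+1"] Suc
    by (metis (no_types, lifting) Suc_eq_plus1 add_Suc_right add_Suc mult_2 of_nat_mult)
  moreover have "real m * real (2*p+1 choose p) = real (2*p+1) * real (2*p choose p)"
    using binomial_absorb_comp[of "2*p+1" p] Suc
    by (metis Suc_diff_le Suc_eq_plus1 add_diff_cancel_left' diff_add_inverse2 le_add2 mult_2 of_nat_mult)
  ultimately have "real m * (real m * real (2*m choose m)) = 2 * real m * (real (2*p+1) * real (2*p choose p))"
    by (metis (no_types, lifting) mult.assoc mult.commute of_nat_mult of_nat_numeral)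
  then have "real m * (real m * real (2*m choose m)) = real m * (2 * real (2*p+1) * real (2*p choose p))"
    by (simp only: mult_ac)
  then have "real m * real (2*m choose m) = 2 * real (2*p+1) * real (2*p choose p)"
    using Suc by (simp only: mult_cancel_left) auto
  then have 2: "real (2*p choose p) = real m * real (2*m choose m) / (2 * (2 * real m - 1))"
    using Suc by (simp add: field_simps)
  have "(real m)^2 * real m / (2 * (2 * real m - 1)) = (real m / 2)^2 + ptr_var m"
  proof -
    have "2 * real m - 1 > 0" using Suc by simp
    then show ?thesis by (simp add: ptr_var_def field_simps power2_eq_square power3_eq_cube)
  qed
  then show ?thesis unfolding 1 2 by (metis mult.assoc times_divide_eq_left times_divide_eq_right)
qed

text \<open>Centred so that the mean is the eigenvalue \<open>n/2 - wt\<close> of the measured spin component.\<close>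

definition ptr_val :: "nat \<Rightarrow> nat \<Rightarrow> nat \<Rightarrow> real" where
  "ptr_val n m x = real n / 2 + real m / 2 - real x"

lemma amp_mean:
  assumes "a \<le> n"
  shows "(\<Sum>x\<le>n+m. ptr_val n m x * (amp m x a * amp m x a)) = real n / 2 - real a"
proof -
  let ?c = "real n / 2 + real m / 2 - real a"
  have "(\<Sum>y\<le>m. ptr_val n m (a+y) * bsq m y) =
     (\<Sum>y\<le>m. ?c * bsq m y - real y * bsq m y)"
    by (intro sum.cong refl) (simp add: ptr_val_def algebra_simps)
  also have "\<dots> = ?c * real (2*m choose m) - real m / 2 * real (2*m choose m)"
    by (simp only: sum_subtractf sum_distrib_left[symmetric] binomial_sq_moment0 binomial_sq_moment1)
  also have "\<dots> = (real n / 2 - real a) * real (2*m choose m)"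
    by (simp add: algebra_simps)
  finally show ?thesis using amp_sum_shift[of a 0 n "ptr_val n m" m] assms
    by simp
qed

lemma amp_second_moment:
  assumes "a \<le> n"
  shows "(\<Sum>x\<le>n+m. (ptr_val n m x)^2 * (amp m x a * amp m x a)) = (real n / 2 - real a)^2 + ptr_var m"
proof -
  let ?c = "real n / 2 + real m / 2 - real a"
  have "(\<Sum>y\<le>m. (ptr_val n m (a+y))^2 * bsq m y) =
     (\<Sum>y\<le>m. ?c^2 * bsq m y 
        - 2 * ?c * (real y * bsq m y)
        + (real y)^2 * bsq m y)"
    by (intro sum.cong refl) (simp add: ptr_val_def power2_eq_square algebra_simps)
  also have "\<dots> = ?c^2 * real (2*m choose m) - 2 * ?c * (real m / 2 * real (2*m choose m))
       + ((real m / 2)^2 + ptr_var m) * real (2*m choose m)"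
    by (simp only: sum.distrib sum_subtractf sum_distrib_left[symmetric]
         binomial_sq_moment0 binomial_sq_moment1 binomial_sq_moment2)
  also have "\<dots> = ((real n / 2 - real a)^2 + ptr_var m) * real (2*m choose m)"
    by (simp add: power2_eq_square field_simps)
  finally show ?thesis using amp_sum_shift[of a 0 n "\<lambda>x. (ptr_val n m x)^2" m] assms
    by simp
qed

text \<open>Entrywise multiplication of an operator A by \<open>corr\<close> is the action of the
  pointer: the sum over the readings x of g(x) D A D, where D is the diagonal matrix with entries
  \<open>amp m x (wt n i)\<close>.\<close>

definition corr :: "nat \<Rightarrow> nat \<Rightarrow> (nat \<Rightarrow> real) \<Rightarrow> cmat" where
  "corr n m g i j = of_real (\<Sum>x\<le>n+m. g x * (amp m x (wt n i) * amp m x (wt n j)))"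

abbreviation const1 :: "nat \<Rightarrow> real" where "const1 \<equiv> \<lambda>_. 1"

lemma corr_diag: "wt n i = wt n j \<Longrightarrow> corr n m const1 i j = 1"
  by (simp add: corr_def amp_corr0 wt_le)

lemma corr_shift1:
  assumes "wt n j = wt n i + 1 \<or> wt n i = wt n j + 1"
  shows "corr n m const1 i j = of_real (overlap1 m)"
proof -
  have "(\<Sum>x\<le>n+m. amp m x (wt n i) * amp m x (wt n j)) = overlap1 m"
    using assms amp_corr1[of "wt n i" n m] amp_corr1[of "wt n j" n m] wt_le[of n i] wt_le[of n j]
    by (auto simp: mult.commute)
  then show ?thesis by (simp add: corr_def del: of_real_sum)
qed

lemma corr_shift2:
  assumes "wt n j = wt n i + 2 \<or> wt n i = wt n j + 2"
  shows "corr n m const1 i j = of_real (overlap2 m)"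
proof -
  have "(\<Sum>x\<le>n+m. amp m x (wt n i) * amp m x (wt n j)) = overlap2 m"
    using assms amp_corr2[of "wt n i" n m] amp_corr2[of "wt n j" n m] wt_le[of n i] wt_le[of n j]
    by (auto simp: mult.commute)
  then show ?thesis by (simp add: corr_def del: of_real_sum)
qed

lemma corr_one: "corr n m const1 i j * one_n n i j = one_n n i j"
  using one_n_wt[of n i j] corr_diag by (cases "one_n n i j = 0") auto

lemma corr_E12: "corr n m const1 i j * Spin n E12 i j = of_real (overlap1 m) * Spin n E12 i j"
  using Spin_E12_wt[of n i j] corr_shift1 by (cases "Spin n E12 i j = 0") auto

lemma corr_E21: "corr n m const1 i j * Spin n E21 i j = of_real (overlap1 m) * Spin n E21 i j"
  using Spin_E21_wt[of n i j] corr_shift1 by (cases "Spin n E21 i j = 0") auto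

definition Spin2 :: "nat \<Rightarrow> complex^2^2 \<Rightarrow> complex^2^2 \<Rightarrow> cmat" where
  "Spin2 n s t = mm (2^n) (Spin n s) (Spin n t)"

lemma corr_Spin2_eq:
  assumes "\<And>k. Spin n s i k \<noteq> 0 \<Longrightarrow> Spin n t k j \<noteq> 0 \<Longrightarrow> corr n m const1 i j = c"
  shows "corr n m const1 i j * Spin2 n s t i j = c * Spin2 n s t i j"
  unfolding Spin2_def mm_def sum_distrib_left
proof (intro sum.cong refl)
  fix k
  show "corr n m const1 i j * (Spin n s i k * Spin n t k j) = c * (Spin n s i k * Spin n t k j)"
    using assms[of k] by (cases "Spin n s i k = 0 \<or> Spin n t k j = 0") auto
qed

text \<open>Two ladder steps in the same direction change the weight by two, opposite steps restore
  it; hence the multipliers \<open>overlap2\<close> and 1.\<close>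

lemma corr_Spin2:
  "corr n m const1 i j * Spin2 n E12 E12 i j = of_real (overlap2 m) * Spin2 n E12 E12 i j"
  "corr n m const1 i j * Spin2 n E21 E21 i j = of_real (overlap2 m) * Spin2 n E21 E21 i j"
  "corr n m const1 i j * Spin2 n E12 E21 i j = 1 * Spin2 n E12 E21 i j"
  "corr n m const1 i j * Spin2 n E21 E12 i j = 1 * Spin2 n E21 E12 i j"
  using Spin_E12_wt[of n i] Spin_E21_wt[of n i] Spin_E12_wt[of n _ j] Spin_E21_wt[of n _ j]
  by (intro corr_Spin2_eq corr_shift2 corr_diag; fastforce)+

lemma sig1_E: "sig 1 = (\<chi> a b. (1/2) * E12$a$b) + (\<chi> a b. (1/2) * E21$a$b)"
  by (simp add: sig_def E12_def E21_def vec_eq_iff forall_2)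

lemma sig2_E: "sig 2 = (\<chi> a b. (-\<i>/2) * E12$a$b) + (\<chi> a b. (\<i>/2) * E21$a$b)"
  by (simp add: sig_def E12_def E21_def vec_eq_iff forall_2)

lemma Spin_sig1: "Spin n (sig 1) i j = 1/2 * Spin n E12 i j + 1/2 * Spin n E21 i j"
  unfolding sig1_E Spin_add Spin_scale by simp

lemma Spin_sig2: "Spin n (sig 2) i j = -\<i>/2 * Spin n E12 i j + \<i>/2 * Spin n E21 i j"
  unfolding sig2_E Spin_add Spin_scale by simp

lemma mult_comb2: "p * a = c * a \<Longrightarrow> p * b = c * b \<Longrightarrow> p * (u * a + v * b) = c * (u * a + v * b)"
  for p a b c u v :: "'a::comm_ring"
proof -
  assume h: "p * a = c * a" "p * b = c * b"
  have "p * (u * a + v * b) = u * (p * a) + v * (p * b)" by (simp add: algebra_simps)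
  then show ?thesis unfolding h by (simp add: algebra_simps)
qed

lemma corr_Spin_sig1: "corr n m const1 i j * Spin n (sig 1) i j = of_real (overlap1 m) * Spin n (sig 1) i j"
  unfolding Spin_sig1 by (rule mult_comb2[OF corr_E12 corr_E21])

lemma corr_Spin_sig2: "corr n m const1 i j * Spin n (sig 2) i j = of_real (overlap1 m) * Spin n (sig 2) i j"
  unfolding Spin_sig2 by (rule mult_comb2[OF corr_E12 corr_E21])

lemma Spin2_sig1: "Spin2 n (sig 1) (sig 1) i j =
    1/4 * (Spin2 n E12 E12 i j + Spin2 n E21 E21 i j + Spin2 n E12 E21 i j + Spin2 n E21 E12 i j)"
  unfolding Spin2_def mm_def Spin_sig1
  by (simp add: sum.distrib[symmetric] sum_distrib_left algebra_simps)

lemma Spin2_sig2: "Spin2 n (sig 2) (sig 2) i j =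
    1/4 * (- Spin2 n E12 E12 i j - Spin2 n E21 E21 i j + Spin2 n E12 E21 i j + Spin2 n E21 E12 i j)"
  unfolding Spin2_def mm_def Spin_sig2
  by (simp add: sum.distrib[symmetric] sum_distrib_left sum_negf[symmetric] algebra_simps)

text \<open>The weight-preserving part of J_2^2 is (J_1^2 + J_2^2)/2, and the remainder is
  multiplied by \<open>overlap2\<close>. The pointer thus turns the spin at random about its own
  axis and leaks J_1^2 into J_2^2.\<close>

lemma corr_Spin2_sig2: "corr n m const1 i j * Spin2 n (sig 2) (sig 2) i j =
   of_real ((1 + overlap2 m)/2) * Spin2 n (sig 2) (sig 2) i j + of_real ((1 - overlap2 m)/2) * Spin2 n (sig 1) (sig 1) i j"
proof -
  have *: "p * (1/4 * (-a - b + d + e)) = (1 + c)/2 * (1/4 * (-a - b + d + e)) + (1 - c)/2 * (1/4 * (a + b + d + e))"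
    if h: "p * a = c * a" "p * b = c * b" "p * d = 1 * d" "p * e = 1 * e" for p a b c d e :: complex
  proof -
    have "p * (1/4 * (-a - b + d + e)) = 1/4 * (-(p*a) - p*b + p*d + p*e)"
      by (simp add: field_simps)
    also have "\<dots> = 1/4 * (-(c*a) - c*b + d + e)"
      by (simp only: h mult_1)
    finally have "p * (1/4 * (-a - b + d + e)) = 1/4 * (-(c*a) - c*b + d + e)" .
    then show ?thesis by (simp only:) (simp add: field_simps)
  qed
  have r: "of_real ((1 + overlap2 m)/2) = (1 + of_real (overlap2 m))/(2::complex)"
     "of_real ((1 - overlap2 m)/2) = (1 - of_real (overlap2 m))/(2::complex)" by simp_all
  show ?thesis unfolding Spin2_sig1 Spin2_sig2 r by (rule *[OF corr_Spin2])
qed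

lemma corr_ptr_val_one: "corr n m (ptr_val n m) i j * one_n n i j = Spin n (sig 3) i j"
proof (cases "one_n n i j = 0")
  case False
  then have "wt n j = wt n i" using one_n_wt by metis
  then have "corr n m (ptr_val n m) i j = of_real (real n / 2 - real (wt n i))"
    using amp_mean[OF wt_le[of n i], of m] by (simp add: corr_def del: of_real_sum)
  then show ?thesis by (simp add: Spin_diag)
qed (simp add: Spin_diag)

lemma Spin2_sig3: "Spin2 n (sig 3) (sig 3) i j = (of_nat n / 2 - of_nat (wt n i))^2 * one_n n i j"
proof -
  have "Spin2 n (sig 3) (sig 3) i j = (\<Sum>k<2^n. (of_nat n / 2 - of_nat (wt n i))^2 * (one_n n i k * one_n n k j))"
    unfolding Spin2_def mm_def
  proof (intro sum.cong refl)
    fix k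
    show "Spin n (sig 3) i k * Spin n (sig 3) k j = (of_nat n / 2 - of_nat (wt n i))^2 * (one_n n i k * one_n n k j)"
      using one_n_wt[of n i k] by (cases "one_n n i k = 0") (auto simp: Spin_diag power2_eq_square)
  qed
  also have "\<dots> = (of_nat n / 2 - of_nat (wt n i))^2 * mm (2^n) (one_n n) (one_n n) i j"
    by (simp only: mm_def sum_distrib_left)
  finally show ?thesis by simp
qed

lemma corr_xi2_one: "corr n m (\<lambda>x. (ptr_val n m x)^2) i j * one_n n i j = Spin2 n (sig 3) (sig 3) i j + of_real (ptr_var m) * one_n n i j"
proof (cases "one_n n i j = 0")
  case False
  then have "wt n j = wt n i" using one_n_wt by metis
  then have "corr n m (\<lambda>x. (ptr_val n m x)^2) i j = of_real ((real n / 2 - real (wt n i))^2 + ptr_var m)"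
    using amp_second_moment[OF wt_le[of n i], of m] by (simp add: corr_def del: of_real_sum)
  then show ?thesis by (simp add: Spin2_sig3 algebra_simps)
qed (simp add: Spin2_sig3)

subsection \<open>Second moments of positive operator valued measures\<close>

definition mtr :: "nat \<Rightarrow> ((real^3) set \<Rightarrow> cmat) \<Rightarrow> cmat \<Rightarrow> (real^3) set \<Rightarrow> real" where
  "mtr d M Z A = Re (\<Sum>i<d. \<Sum>j<d. M A i j * Z j i)"

definition quad :: "nat \<Rightarrow> cmat \<Rightarrow> (nat \<Rightarrow> complex) \<Rightarrow> complex" where
  "quad d A v = (\<Sum>i<d. \<Sum>j<d. cnj (v i) * A i j * v j)"

text \<open>Positivity in the form in which it is used: the trace of a POVM element against such a Z
  is a sum of quadratic forms of that element.\<close>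

definition gram :: "nat \<Rightarrow> cmat \<Rightarrow> bool" where
  "gram d Z \<longleftrightarrow> (\<exists>(K::nat) u. \<forall>i<d. \<forall>j<d. Z i j = (\<Sum>l<K. u l i * cnj (u l j)))"

definition idmat :: "cmat" where
  "idmat i j = (if i = j then 1 else 0)"

text \<open>The rank-one matrix of the vector e_i + c e_j. Once the diagonal terms are removed, c =
  1 and c = - i yield twice the real and twice the imaginary part of an off-diagonal entry of a
  Hermitian matrix.\<close>

definition pair_proj :: "nat \<Rightarrow> nat \<Rightarrow> complex \<Rightarrow> cmat" where
  "pair_proj i j c a b = ((if a = i then 1 else 0) + (if a = j then c else 0)) *
     cnj ((if b = i then 1 else 0) + (if b = j then c else 0))"

definition unit_proj :: "nat \<Rightarrow> cmat" where
  "unit_proj i a b = (if a = i then 1 else 0) * (if b = i then 1 else 0)"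

lemma gram_pair_proj: "gram d (pair_proj i j c)"
  unfolding gram_def pair_proj_def
  by (rule exI[of _ 1], rule exI[of _ "\<lambda>_ a. (if a = i then 1 else 0) + (if a = j then c else 0)"]) simp

lemma gram_unit_proj: "gram d (unit_proj i)"
  unfolding gram_def unit_proj_def
  by (rule exI[of _ 1], rule exI[of _ "\<lambda>_ a. if a = i then 1 else 0"]) simp

lemma gram_diag:
  assumes "\<And>i j. i < d \<Longrightarrow> j < d \<Longrightarrow> Z i j = (if i = j then of_real (p i) else 0)" "\<And>i. i < d \<Longrightarrow> 0 \<le> p i"
  shows "gram d Z"
  unfolding gram_def
proof (rule exI[of _ d], rule exI[of _ "\<lambda>l i. if i = l then of_real (sqrt (p l)) else 0"], intro allI impI)
  fix i j assume ij: "i < d" "j < d"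
  have "(\<Sum>l<d. (if i = l then complex_of_real (sqrt (p l)) else 0) * cnj (if j = l then of_real (sqrt (p l)) else 0))
    = (\<Sum>l<d. if i = l then (if i = j then of_real (p i) else 0) else 0)"
    using assms(2) ij by (intro sum.cong refl) (auto simp: of_real_mult[symmetric] simp del: of_real_mult)
  then show "Z i j = (\<Sum>l<d. (if i = l then complex_of_real (sqrt (p l)) else 0) * cnj (if j = l then of_real (sqrt (p l)) else 0))"
    using assms(1) ij by simp
qed

lemma gram_idmat: "gram d idmat"
  by (rule gram_diag[of d _ "\<lambda>_. 1"]) (auto simp: idmat_def)

lemma sets_outcome [simp]: "sets (outcome_dist d M Z) = sets borel"
  by (simp add: outcome_dist_def) (metis sets.sigma_sets_eq space_borel)

lemma space_outcome [simp]: "space (outcome_dist d M Z) = UNIV"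
  by (simp add: outcome_dist_def)

lemma mtr_gram:
  assumes "\<And>i j. i < d \<Longrightarrow> j < d \<Longrightarrow> Z i j = (\<Sum>l<K. u l i * cnj (u l j))"
  shows "mtr d M Z A = (\<Sum>l<(K::nat). Re (quad d (M A) (u l)))"
proof -
  have "(\<Sum>i<d. \<Sum>j<d. M A i j * Z j i) = (\<Sum>i<d. \<Sum>j<d. \<Sum>l<K. cnj (u l i) * M A i j * u l j)"
    using assms by (intro sum.cong refl) (auto simp: sum_distrib_left mult_ac)
  also have "\<dots> = (\<Sum>i<d. \<Sum>l<K. \<Sum>j<d. cnj (u l i) * M A i j * u l j)"
    by (intro sum.cong refl sum.swap)
  also have "\<dots> = (\<Sum>l<K. \<Sum>i<d. \<Sum>j<d. cnj (u l i) * M A i j * u l j)"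
    by (rule sum.swap)
  finally show ?thesis by (simp add: mtr_def quad_def)
qed

lemma quad_pair_proj:
  assumes "i < d" "j < d"
  shows "quad d (M A) (\<lambda>a. (if a = i then 1 else 0) + (if a = j then c else 0)) =
     M A i i + c * M A i j + cnj c * M A j i + c * cnj c * M A j j"
proof -
  have "quad d (M A) (\<lambda>a. (if a = i then 1 else 0) + (if a = j then c else 0)) =
     (\<Sum>a<d. \<Sum>b<d. (if b = i then (if a = i then M A i i else 0) else 0)
        + (if b = j then (if a = i then c * M A i j else 0) else 0)
        + (if b = i then (if a = j then cnj c * M A j i else 0) else 0)
        + (if b = j then (if a = j then c * cnj c * M A j j else 0) else 0))"
    unfolding quad_def by (intro sum.cong refl) (auto simp: algebra_simps)
  also have "\<dots> = M A i i + c * M A i j + cnj c * M A j i + c * cnj c * M A j j"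
    using assms by (simp add: sum.distrib)
  finally show ?thesis .
qed

lemma mtr_pair_proj:
  assumes "i < d" "j < d"
  shows "mtr d M (pair_proj i j c) A = Re (M A i i + c * M A i j + cnj c * M A j i + c * cnj c * M A j j)"
  using mtr_gram[where d=d and Z="pair_proj i j c" and K=1 and u="\<lambda>_ a. (if a = i then 1 else 0) + (if a = j then c else 0)" and M=M and A=A]
  by (simp add: pair_proj_def quad_pair_proj[OF assms])

lemma mtr_unit_proj:
  assumes "i < d"
  shows "mtr d M (unit_proj i) A = Re (M A i i)"
proof -
  have "(\<Sum>a<d. \<Sum>b<d. M A a b * unit_proj i b a) = (\<Sum>a<d. \<Sum>b<d. (if b = i then (if a = i then M A i i else 0) else 0))"
    by (intro sum.cong refl) (auto simp: unit_proj_def)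
  then show ?thesis using assms by (simp add: mtr_def)
qed

lemma integrable_dominated_measure:
  fixes f :: "'a \<Rightarrow> 'b::{banach, second_countable_topology}"
  assumes "sets N = sets M" "\<And>A. A \<in> sets M \<Longrightarrow> emeasure N A \<le> ennreal C * emeasure M A" "integrable M f"
  shows "integrable N f"
proof -
  have le: "N \<le> scale_measure (ennreal C) M"
    unfolding le_measure_iff le_fun_def
    using assms(1,2) sets_eq_imp_space_eq[OF assms(1)]
    by (auto simp: space_scale_measure) (metis emeasure_notin_sets zero_le)
  have "(\<integral>\<^sup>+x. norm (f x) \<partial>N) \<le> (\<integral>\<^sup>+x. norm (f x) \<partial>scale_measure (ennreal C) M)"
    using le assms(1) by (intro nn_integral_mono_measure) auto
  also have "\<dots> = ennreal C * (\<integral>\<^sup>+x. norm (f x) \<partial>M)"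
    using assms(3) by (intro nn_integral_scale_measure) auto
  also have "\<dots> < \<infinity>"
    using assms(3) by (auto simp: integrable_iff_bounded ennreal_mult_less_top)
  finally show ?thesis
    using assms(1,3) by (auto simp: integrable_iff_bounded measurable_cong_sets[OF assms(1) refl])
qed

text \<open>Polarization: the entries of the operator \<open>\<integral> f dM\<close>, without integrating against a complex
measure.\<close>

definition Xmat :: "nat \<Rightarrow> ((real^3) set \<Rightarrow> cmat) \<Rightarrow> (real^3 \<Rightarrow> real) \<Rightarrow> cmat" where
  "Xmat d M f i j = Complex
     ((integral\<^sup>L (outcome_dist d M (pair_proj i j 1)) f - integral\<^sup>L (outcome_dist d M (unit_proj i)) f
        - integral\<^sup>L (outcome_dist d M (unit_proj j)) f) / 2)
     ((integral\<^sup>L (outcome_dist d M (pair_proj i j (-\<i>))) f - integral\<^sup>L (outcome_dist d M (unit_proj i)) f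
        - integral\<^sup>L (outcome_dist d M (unit_proj j)) f) / 2)"

text \<open>The trace of the POVM. It dominates the outcome distribution of every state, so
  integrability is checked against this one measure.\<close>

abbreviation tau :: "nat \<Rightarrow> ((real^3) set \<Rightarrow> cmat) \<Rightarrow> (real^3) measure" where
  "tau d M \<equiv> outcome_dist d M idmat"

context
  fixes d :: nat and M :: "(real^3) set \<Rightarrow> cmat"
  assumes povm: "is_povm d M"
begin

lemma quad_nonneg:
  assumes "A \<in> sets borel"
  shows "Im (quad d (M A) v) = 0" "0 \<le> Re (quad d (M A) v)"
  using povm assms unfolding is_povm_def quad_def by (auto simp: complex_is_Real_iff)

lemma mtr_nonneg:
  assumes "gram d Z" "A \<in> sets borel"
  shows "0 \<le> mtr d M Z A"
proof -
  obtain K u where "\<And>i j. i < d \<Longrightarrow> j < d \<Longrightarrow> Z i j = (\<Sum>l<(K::nat). u l i * cnj (u l j))"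
    using assms(1) unfolding gram_def by blast
  from mtr_gram[OF this] show ?thesis using quad_nonneg(2)[OF assms(2)] by (simp add: sum_nonneg)
qed

lemma povm_sums:
  assumes "range A \<subseteq> sets borel" "disjoint_family A" "i < d" "j < d"
  shows "(\<lambda>k. M (A k) i j) sums M (\<Union>k. A k) i j"
  using povm assms unfolding is_povm_def by blast

lemma mtr_sums:
  assumes "range A \<subseteq> sets borel" "disjoint_family A"
  shows "(\<lambda>k. mtr d M Z (A k)) sums mtr d M Z (\<Union>k. A k)"
  unfolding mtr_def
  by (intro bounded_linear.sums[OF bounded_linear_Re] sums_sum bounded_linear.sums[OF bounded_linear_mult_left] povm_sums assms) auto

lemma povm_empty: "i < d \<Longrightarrow> j < d \<Longrightarrow> M {} i j = 0"
proof -
  assume ij: "i < d" "j < d"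
  have "(\<lambda>k::nat. M {} i j) sums M {} i j"
    using povm_sums[of "\<lambda>_. {}" i j] ij by (simp add: disjoint_family_on_def)
  then have "summable (\<lambda>k::nat. M {} i j)" by (rule sums_summable)
  then show "M {} i j = 0" by (simp add: summable_const_iff)
qed

lemma mtr_empty: "mtr d M Z {} = 0"
  by (simp add: mtr_def povm_empty)

lemma emeasure_outcome:
  assumes "gram d Z" "A \<in> sets borel"
  shows "emeasure (outcome_dist d M Z) A = ennreal (mtr d M Z A)"
proof (rule emeasure_measure_of[OF outcome_dist_def[unfolded mtr_def[symmetric]]])
  show "sets borel \<subseteq> Pow (UNIV :: (real^3) set)" by simp
  show "A \<in> sets (outcome_dist d M Z)" using assms by simp
  show "positive (sets (outcome_dist d M Z)) (\<lambda>A. ennreal (mtr d M Z A))"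
    by (simp add: positive_def mtr_empty)
  show "countably_additive (sets (outcome_dist d M Z)) (\<lambda>A. ennreal (mtr d M Z A))"
  proof (rule countably_additiveI)
    fix A :: "nat \<Rightarrow> (real^3) set"
    assume A: "range A \<subseteq> sets (outcome_dist d M Z)" "disjoint_family A"
    have s: "(\<lambda>k. mtr d M Z (A k)) sums mtr d M Z (\<Union>k. A k)"
      using A by (intro mtr_sums) auto
    have "(\<Sum>k. ennreal (mtr d M Z (A k))) = ennreal (\<Sum>k. mtr d M Z (A k))"
      using A s by (intro suminf_ennreal2 mtr_nonneg assms) (auto simp: sums_iff)
    then show "(\<Sum>i. ennreal (mtr d M Z (A i))) = ennreal (mtr d M Z (\<Union> (range A)))"
      using s by (simp add: sums_iff)
  qed
qed

lemma finite_measure_outcome: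
  assumes "gram d Z" shows "finite_measure (outcome_dist d M Z)"
  by (rule finite_measureI) (simp add: emeasure_outcome assms)

lemma measure_outcome:
  assumes "gram d Z" "A \<in> sets borel"
  shows "measure (outcome_dist d M Z) A = mtr d M Z A"
  by (simp add: measure_def emeasure_outcome assms mtr_nonneg)

lemma povm_diag:
  assumes "A \<in> sets borel" "i < d"
  shows "Im (M A i i) = 0" "0 \<le> Re (M A i i)"
  using quad_nonneg[OF assms(1), of "\<lambda>a. (if a = i then 1 else 0) + (if a = i then 0 else 0)"]
   quad_pair_proj[OF assms(2) assms(2), of M A 0] by simp_all

lemma povm_herm:
  assumes "A \<in> sets borel" "i < d" "j < d"
  shows "M A j i = cnj (M A i j)"
proof -
  have "Im (M A i i + 1 * M A i j + cnj 1 * M A j i + 1 * cnj 1 * M A j j) = 0"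
    unfolding quad_pair_proj[OF assms(2,3), of M A 1, symmetric] by (rule quad_nonneg(1)[OF assms(1)])
  moreover have "Im (M A i i + \<i> * M A i j + cnj \<i> * M A j i + \<i> * cnj \<i> * M A j j) = 0"
    unfolding quad_pair_proj[OF assms(2,3), of M A "\<i>", symmetric] by (rule quad_nonneg(1)[OF assms(1)])
  ultimately show ?thesis using povm_diag(1)[OF assms(1,2)] povm_diag(1)[OF assms(1,3)]
    by (simp add: complex_eq_iff)
qed

text \<open>Test the positive matrix \<open>M A\<close> on e_i + c e_j, with the phase c that turns
  \<open>M A i j\<close> into minus its modulus: twice the modulus is at most the sum of the two
  diagonal entries.\<close>

lemma povm_entry_bound:
  assumes "A \<in> sets borel" "i < d" "j < d"
  shows "norm (M A i j) \<le> mtr d M idmat A"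
proof -
  have tr: "mtr d M idmat A = (\<Sum>k<d. Re (M A k k))"
    by (simp add: mtr_def idmat_def if_distrib[of "(*) _"] cong: if_cong)
  have ge: "Re (M A k k) \<le> mtr d M idmat A" if "k < d" for k
    unfolding tr using that povm_diag(2)[OF assms(1)]
    by (intro member_le_sum) auto
  obtain c :: complex where c: "norm c = 1" "c * M A i j = - of_real (norm (M A i j))"
  proof (cases "M A i j = 0")
    case True then show ?thesis using that[of 1] by simp
  next
    case False
    have "cnj (M A i j) * M A i j = of_real (norm (M A i j)) * of_real (norm (M A i j))"
      using complex_norm_square[of "M A i j"] by (simp add: power2_eq_square mult.commute)
    then show ?thesis using False
      by (intro that[of "- cnj (M A i j) / of_real (norm (M A i j))"]) (auto simp: norm_divide field_simps)
  qed
  have "cnj c * M A j i = - of_real (norm (M A i j))"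
    using arg_cong[OF c(2), of cnj] povm_herm[OF assms] by simp
  moreover have "c * cnj c = 1"
    using complex_norm_square[of c] c(1) by simp
  ultimately have "0 \<le> Re (M A i i - of_real (norm (M A i j)) - of_real (norm (M A i j)) + M A j j)"
    using quad_nonneg(2)[OF assms(1), of "\<lambda>a. (if a = i then 1 else 0) + (if a = j then c else 0)"]
     quad_pair_proj[OF assms(2,3), of M A c] c(2) by (simp add: algebra_simps)
  then show ?thesis using ge[OF assms(2)] ge[OF assms(3)] by simp
qed

lemma mtr_le_trace:
  assumes "A \<in> sets borel"
  shows "mtr d M Z A \<le> (\<Sum>i<d. \<Sum>j<d. norm (Z j i)) * mtr d M idmat A"
proof -
  have "mtr d M Z A \<le> norm (\<Sum>i<d. \<Sum>j<d. M A i j * Z j i)"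
    unfolding mtr_def by (rule complex_Re_le_cmod)
  also have "\<dots> \<le> (\<Sum>i<d. \<Sum>j<d. norm (M A i j * Z j i))"
    by (intro order.trans[OF norm_sum] sum_mono norm_sum)
  also have "\<dots> \<le> (\<Sum>i<d. \<Sum>j<d. norm (Z j i) * mtr d M idmat A)"
    by (intro sum_mono) (auto simp: norm_mult mult.commute[of "cmod (Z _ _)"] intro!: mult_right_mono povm_entry_bound assms)
  finally show ?thesis by (simp add: sum_distrib_right)
qed

lemma integrable_tau:
  fixes f :: "real^3 \<Rightarrow> real"
  assumes "gram d Z" "integrable (tau d M) f"
  shows "integrable (outcome_dist d M Z) f"
proof (rule integrable_dominated_measure[OF _ _ assms(2)])
  fix A assume "A \<in> sets (tau d M)"
  then have A: "A \<in> sets borel" by (simp add: sets_outcome)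
  show "emeasure (outcome_dist d M Z) A \<le> ennreal (\<Sum>i<d. \<Sum>j<d. norm (Z j i)) * emeasure (tau d M) A"
    using mtr_le_trace[OF A, of Z] A
    by (simp add: emeasure_outcome assms gram_idmat ennreal_mult'[symmetric] mtr_nonneg sum_nonneg ennreal_leI)
qed (simp add: sets_outcome)

text \<open>A converse of \<open>integrable_tau\<close> for a faithful diagonal state: the sum of
  all \<open>1 / p i\<close> bounds each of them, hence the density of \<open>tau\<close>. Finite
  variance at the single point \<open>thz r\<close> thereby gives integrability at every
  state.\<close>

lemma integrable_tau_of_diag:
  fixes f :: "real^3 \<Rightarrow> real"
  assumes p: "\<And>i. i < d \<Longrightarrow> 0 < p i"
    and Z: "\<And>i j. i < d \<Longrightarrow> j < d \<Longrightarrow> Z i j = (if i = j then of_real (p i) else 0)"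
    and f: "integrable (outcome_dist d M Z) f"
  shows "integrable (tau d M) f"
proof (rule integrable_dominated_measure[OF _ _ f])
  have grZ: "gram d Z" using Z p by (intro gram_diag[of d Z p]) (auto simp: less_imp_le)
  fix A assume "A \<in> sets (outcome_dist d M Z)"
  then have A: "A \<in> sets borel" by simp
  let ?C = "\<Sum>i<d. 1 / p i"
  have C0: "0 \<le> ?C" using p by (intro sum_nonneg) (auto simp: less_imp_le)
  have "mtr d M Z A = (\<Sum>i<d. p i * Re (M A i i))"
  proof -
    have "(\<Sum>i<d. \<Sum>j<d. M A i j * Z j i) = (\<Sum>i<d. \<Sum>j<d. if j = i then of_real (p i) * M A i i else 0)"
      using Z by (intro sum.cong refl) auto
    then show ?thesis by (simp add: mtr_def)
  qed
  moreover have "mtr d M idmat A = (\<Sum>i<d. Re (M A i i))"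
    by (simp add: mtr_def idmat_def if_distrib[of "(*) _"] cong: if_cong)
  moreover have "(\<Sum>i<d. Re (M A i i)) \<le> (\<Sum>i<d. ?C * (p i * Re (M A i i)))"
  proof (intro sum_mono)
    fix i assume i: "i \<in> {..<d}"
    have "1 / p i \<le> ?C" using i p by (intro member_le_sum) (auto simp: less_imp_le)
    then have "1 \<le> ?C * p i" using p[of i] i by (simp add: field_simps)
    then show "Re (M A i i) \<le> ?C * (p i * Re (M A i i))"
      using mult_right_mono[of 1 "?C * p i" "Re (M A i i)"] povm_diag(2)[OF A, of i] i by (simp add: mult.assoc)
  qed
  ultimately have "mtr d M idmat A \<le> ?C * mtr d M Z A" by (simp add: sum_distrib_left)
  then show "emeasure (tau d M) A \<le> ennreal ?C * emeasure (outcome_dist d M Z) A"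
    using C0 by (simp add: emeasure_outcome grZ gram_idmat A ennreal_mult'[symmetric] mtr_nonneg ennreal_leI)
qed simp

section \<open>The operator-valued integral of a function against a POVM\<close>

lemma Xmat_indicator:
  assumes "A \<in> sets borel" "i < d" "j < d"
  shows "Xmat d M (\<lambda>x. indicator A x *\<^sub>R c) i j = of_real c * M A i j"
proof -
  have I: "integral\<^sup>L (outcome_dist d M Z) (\<lambda>x. indicator A x *\<^sub>R c) = mtr d M Z A * c" if "gram d Z" for Z
    using assms(1) by (simp add: measure_outcome[OF that assms(1)] space_outcome)
  show ?thesis
    unfolding Xmat_def I[OF gram_pair_proj] I[OF gram_unit_proj]
    using povm_herm[OF assms]
    by (simp add: mtr_pair_proj[OF assms(2,3)] mtr_unit_proj[OF assms(2)] mtr_unit_proj[OF assms(3)]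
      complex_eq_iff field_simps)
qed

lemma Xmat_add:
  assumes "integrable (tau d M) f" "integrable (tau d M) g"
  shows "Xmat d M (\<lambda>x. f x + g x) i j = Xmat d M f i j + Xmat d M g i j"
  using assms by (simp add: Xmat_def complex_eq_iff integrable_tau gram_pair_proj gram_unit_proj field_simps)

lemma Xmat_lim:
  assumes "\<And>k. s k \<in> borel_measurable borel" "\<And>x. (\<lambda>k. s k x) \<longlonglongrightarrow> f x"
    "\<And>k x. \<bar>s k x\<bar> \<le> w x" "integrable (tau d M) w"
  shows "(\<lambda>k. Xmat d M (s k) i j) \<longlonglongrightarrow> Xmat d M f i j"
proof -
  have f: "f \<in> borel_measurable borel"
    using assms(1,2) by (rule borel_measurable_LIMSEQ_real[rotated])
  have "(\<lambda>k. integral\<^sup>L (outcome_dist d M Z) (s k)) \<longlonglongrightarrow> integral\<^sup>L (outcome_dist d M Z) f" if "gram d Z" for Z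
    using assms f integrable_tau[OF that assms(4)]
    by (intro integral_dominated_convergence[where w=w])
       (auto simp: measurable_cong_sets[OF sets_outcome refl])
  then show ?thesis unfolding Xmat_def
    by (intro tendsto_Complex tendsto_intros) (auto simp: gram_pair_proj gram_unit_proj)
qed

text \<open>The trace with the integral operator is written as \<open>mtr\<close> of a constant set
  function, hence the argument \<open>{}\<close>. The identity separates the function from the
  state, so that means can later be differentiated in the state alone.\<close>

lemma integral_outcome_Xmat:
  assumes "gram d Z" "integrable (tau d M) f"
  shows "integral\<^sup>L (outcome_dist d M Z) f = mtr d (\<lambda>_. Xmat d M f) Z {}"
  using assms(2)
proof (induction rule: integrable_induct)
  case (base A c)
  then have A: "A \<in> sets borel" by (simp add: sets_outcome)
  have "integral\<^sup>L (outcome_dist d M Z) (\<lambda>x. indicator A x *\<^sub>R c) = mtr d M Z A * c"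
    using A by (simp add: measure_outcome[OF assms(1) A] space_outcome)
  also have "\<dots> = mtr d (\<lambda>_. Xmat d M (\<lambda>x. indicator A x *\<^sub>R c)) Z {}"
  proof -
    have "(\<Sum>i<d. \<Sum>j<d. Xmat d M (\<lambda>x. indicator A x *\<^sub>R c) i j * Z j i)
       = (\<Sum>i<d. \<Sum>j<d. of_real c * (M A i j * Z j i))"
      by (intro sum.cong refl) (simp only: Xmat_indicator[OF A] lessThan_iff mult.assoc)
    then show ?thesis
      by (simp add: mtr_def sum_distrib_left[symmetric] mult.commute)
  qed
  finally show ?case .
next
  case (add f g)
  then show ?case
    using integrable_tau[OF assms(1)] by (simp add: mtr_def Xmat_add algebra_simps sum.distrib)
next
  case (lim f s)
  have m: "s k \<in> borel_measurable borel" for k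
    using lim.hyps(1)[of k] by (auto simp: measurable_cong_sets[OF sets_outcome refl] dest: borel_measurable_integrable)
  have f: "f \<in> borel_measurable borel"
    using lim.hyps(4) by (auto simp: measurable_cong_sets[OF sets_outcome refl] dest: borel_measurable_integrable)
  have w: "integrable (tau d M) (\<lambda>x. 2 * norm (f x))" using lim.hyps(4) by simp
  have "(\<lambda>k. integral\<^sup>L (outcome_dist d M Z) (s k)) \<longlonglongrightarrow> integral\<^sup>L (outcome_dist d M Z) f"
    using lim.hyps m f integrable_tau[OF assms(1) w]
    by (intro integral_dominated_convergence[where w="\<lambda>x. 2 * norm (f x)"])
       (auto simp: measurable_cong_sets[OF sets_outcome refl] space_outcome)
  moreover have "(\<lambda>k. mtr d (\<lambda>_. Xmat d M (s k)) Z {}) \<longlonglongrightarrow> mtr d (\<lambda>_. Xmat d M f) Z {}"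
    unfolding mtr_def using lim.hyps m w
    by (intro tendsto_intros Xmat_lim[where w="\<lambda>x. 2 * norm (f x)"]) (auto simp: space_outcome)
  ultimately show ?case
    unfolding lim.IH by (rule LIMSEQ_unique)
qed

lemma Xmat_herm:
  assumes "integrable (tau d M) f" "i < d" "j < d"
  shows "Xmat d M f j i = cnj (Xmat d M f i j)"
proof -
  let ?I = "\<lambda>Z. integral\<^sup>L (outcome_dist d M Z) f"
  let ?X = "Xmat d M f"
  have e: "?I (unit_proj i) = Re (?X i i)" "?I (unit_proj j) = Re (?X j j)"
    using integral_outcome_Xmat[OF gram_unit_proj assms(1)] mtr_unit_proj[OF assms(2)] mtr_unit_proj[OF assms(3)] by simp_all
  have p: "?I (pair_proj i j c) = Re (?X i i + c * ?X i j + cnj c * ?X j i + c * cnj c * ?X j j)" for c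
    using integral_outcome_Xmat[OF gram_pair_proj assms(1)] mtr_pair_proj[OF assms(2,3)] by simp
  have "Re (?X i j) = (?I (pair_proj i j 1) - ?I (unit_proj i) - ?I (unit_proj j)) / 2"
    "Im (?X i j) = (?I (pair_proj i j (-\<i>)) - ?I (unit_proj i) - ?I (unit_proj j)) / 2"
    by (simp_all add: Xmat_def)
  then show ?thesis unfolding e p by (simp add: complex_eq_iff)
qed

lemma Xmat_scale:
  assumes "integrable (tau d M) f"
  shows "Xmat d M (\<lambda>x. c * f x) i j = of_real c * Xmat d M f i j"
  using assms by (simp add: Xmat_def complex_eq_iff field_simps)

lemma Xmat_sum:
  assumes "finite I" "\<And>c. c \<in> I \<Longrightarrow> integrable (tau d M) (f c)"
  shows "Xmat d M (\<lambda>x. \<Sum>c\<in>I. f c x) i j = (\<Sum>c\<in>I. Xmat d M (f c) i j)"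
  using assms
proof (induction I rule: finite_induct)
  case empty
  then show ?case by (simp add: Xmat_def complex_eq_iff)
next
  case (insert c I)
  then show ?case by (simp add: Xmat_add)
qed

lemma Xmat_simple:
  fixes s :: "real^3 \<Rightarrow> complex" and w :: "complex \<Rightarrow> real"
  assumes s: "simple_function borel s" and ij: "i < d" "j < d"
  shows "Xmat d M (\<lambda>x. w (s x)) i j = (\<Sum>c\<in>range s. of_real (w c) * M (s -` {c}) i j)"
proof -
  have fin: "finite (range s)" and meas: "\<And>c. s -` {c} \<in> sets borel"
    using s by (auto simp: simple_function_def space_borel) (metis Int_UNIV_right rangeI vimage_singleton_eq sets.empty_sets emptyE equals0I image_eqI)
  interpret finite_measure "tau d M"
    by (rule finite_measure_outcome[OF gram_idmat])
  have ind: "integrable (tau d M) (\<lambda>x. indicator (s -` {c}) x *\<^sub>R w c)" for c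
    using meas[of c] by (intro integrable_scaleR_left integrable_real_indicator) (auto simp: emeasure_eq_measure)
  have "(\<lambda>x. w (s x)) = (\<lambda>x. \<Sum>c\<in>range s. indicator (s -` {c}) x *\<^sub>R w c)"
  proof
    fix x
    have "(\<Sum>c\<in>range s. indicator (s -` {c}) x *\<^sub>R w c) = (\<Sum>c\<in>range s. if c = s x then w c else 0)"
      by (intro sum.cong refl) (auto simp: indicator_def)
    also have "\<dots> = w (s x)" using fin by simp
    finally show "w (s x) = (\<Sum>c\<in>range s. indicator (s -` {c}) x *\<^sub>R w c)" by simp
  qed
  then have "Xmat d M (\<lambda>x. w (s x)) i j = (\<Sum>c\<in>range s. Xmat d M (\<lambda>x. indicator (s -` {c}) x *\<^sub>R w c) i j)"
    using Xmat_sum[OF fin, of "\<lambda>c x. indicator (s -` {c}) x *\<^sub>R w c"] ind by simp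
  also have "\<dots> = (\<Sum>c\<in>range s. of_real (w c) * M (s -` {c}) i j)"
    by (intro sum.cong refl Xmat_indicator meas ij)
  finally show ?thesis .
qed

definition Xc :: "(real^3 \<Rightarrow> complex) \<Rightarrow> cmat" where
  "Xc g i j = Xmat d M (\<lambda>x. Re (g x)) i j + \<i> * Xmat d M (\<lambda>x. Im (g x)) i j"

lemma Xmat_one: "i < d \<Longrightarrow> j < d \<Longrightarrow> Xmat d M (\<lambda>x. 1) i j = (if i = j then 1 else 0)"
proof -
  assume ij: "i < d" "j < d"
  have "Xmat d M (\<lambda>x. indicator UNIV x *\<^sub>R 1) i j = of_real 1 * M UNIV i j"
    using ij by (intro Xmat_indicator) auto
  then show ?thesis using povm ij by (simp add: is_povm_def)
qed

text \<open>The integral over x of the quadratic form of M(dx) at the vector cnj (g x) e_a - y. The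
  last term is the squared norm of y because M has total mass the identity.\<close>

definition qform :: "(real^3 \<Rightarrow> complex) \<Rightarrow> nat \<Rightarrow> (nat \<Rightarrow> complex) \<Rightarrow> real" where
  "qform g a y = Re (Xmat d M (\<lambda>x. (norm (g x))^2) a a) - 2 * Re (\<Sum>j<d. Xc g a j * y j) + (\<Sum>j<d. (norm (y j))^2)"

lemma quad_shift:
  assumes a: "a < d" and A: "A \<in> sets borel"
  shows "Re (quad d (M A) (\<lambda>i. (if i = a then cnj c else 0) - y i)) =
    (norm c)^2 * Re (M A a a) - 2 * Re (\<Sum>j<d. c * M A a j * y j) + Re (quad d (M A) y)"
proof -
  have "quad d (M A) (\<lambda>i. (if i = a then cnj c else 0) - y i) =
     (\<Sum>i<d. \<Sum>j<d. (if j = a then (if i = a then c * cnj c * M A a a else 0) else 0)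
        - (if i = a then c * M A a j * y j else 0) - (if j = a then cnj (y i) * M A i a * cnj c else 0)
        + cnj (y i) * M A i j * y j)"
    unfolding quad_def by (intro sum.cong refl) (auto simp: algebra_simps)
  also have "\<dots> = c * cnj c * M A a a - (\<Sum>i<d. \<Sum>j<d. if i = a then c * M A a j * y j else 0)
       - (\<Sum>i<d. cnj (y i) * M A i a * cnj c) + quad d (M A) y"
    using a by (simp add: sum.distrib sum_subtractf quad_def)
  also have "(\<Sum>i<d. \<Sum>j<d. if i = a then c * M A a j * y j else 0) = (\<Sum>j<d. c * M A a j * y j)"
    using a by (subst sum.swap) simp
  also have "(\<Sum>i<d. cnj (y i) * M A i a * cnj c) = cnj (\<Sum>j<d. c * M A a j * y j)"
    unfolding cnj_sum
  proof (intro sum.cong refl)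
    fix i assume "i \<in> {..<d}"
    then show "cnj (y i) * M A i a * cnj c = cnj (c * M A a i * y i)"
      using povm_herm[OF A a, of i] by simp
  qed
  finally have e: "quad d (M A) (\<lambda>i. (if i = a then cnj c else 0) - y i) = c * cnj c * M A a a - (\<Sum>j<d. c * M A a j * y j)
     - cnj (\<Sum>j<d. c * M A a j * y j) + quad d (M A) y" .
  have "c * cnj c = of_real ((norm c)^2)"
    by (metis complex_norm_square)
  then have "Re (c * cnj c * M A a a) = (norm c)^2 * Re (M A a a)"
    by (metis Re_complex_of_real Im_complex_of_real diff_0_right mult_zero_left times_complex.sel(1))
  moreover define S where "S = (\<Sum>j<d. c * M A a j * y j)"
  ultimately show ?thesis unfolding e S_def[symmetric] by simp
qed

text \<open>On each of the finitely many level sets of \<open>s\<close> the vector cnj (s x) e_a - y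
  is constant and \<open>M\<close> is positive; \<open>quad_shift\<close> expands the resulting
  nonnegative sum.\<close>

lemma qform_simple:
  assumes s: "simple_function borel s" and a: "a < d"
  shows "0 \<le> qform s a y"
proof -
  have meas: "\<And>c. s -` {c} \<in> sets borel"
    using s by (auto simp: simple_function_def space_borel) (metis Int_UNIV_right rangeI vimage_singleton_eq sets.empty_sets emptyE equals0I image_eqI)
  let ?A = "\<lambda>c. s -` {c}"
  have "0 \<le> (\<Sum>c\<in>range s. Re (quad d (M (?A c)) (\<lambda>i. (if i = a then cnj c else 0) - y i)))"
    by (intro sum_nonneg quad_nonneg(2) meas)
  also have "\<dots> = (\<Sum>c\<in>range s. (norm c)^2 * Re (M (?A c) a a))
      - 2 * Re (\<Sum>c\<in>range s. \<Sum>j<d. c * M (?A c) a j * y j) + Re (\<Sum>c\<in>range s. quad d (M (?A c)) y)"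
    by (simp only: quad_shift[OF a meas] sum.distrib sum_subtractf Re_sum sum_distrib_left)
  also have "(\<Sum>c\<in>range s. (norm c)^2 * Re (M (?A c) a a)) = Re (Xmat d M (\<lambda>x. (norm (s x))^2) a a)"
    using Xmat_simple[OF s a a, of "\<lambda>c. (norm c)^2"] by simp
  also have "(\<Sum>c\<in>range s. \<Sum>j<d. c * M (?A c) a j * y j) = (\<Sum>j<d. Xc s a j * y j)"
  proof (subst sum.swap, intro sum.cong refl)
    fix j assume "j \<in> {..<d}"
    then have "Xc s a j = (\<Sum>c\<in>range s. of_real (Re c) * M (?A c) a j) + \<i> * (\<Sum>c\<in>range s. of_real (Im c) * M (?A c) a j)"
      unfolding Xc_def using Xmat_simple[OF s a, of j] by simp
    also have "\<dots> = (\<Sum>c\<in>range s. (of_real (Re c) + \<i> * of_real (Im c)) * M (?A c) a j)"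
      by (simp add: sum.distrib sum_distrib_left algebra_simps)
    also have "\<dots> = (\<Sum>c\<in>range s. c * M (?A c) a j)"
      by (simp add: complex_eq[symmetric])
    finally show "(\<Sum>c\<in>range s. c * M (?A c) a j * y j) = Xc s a j * y j"
      by (simp add: sum_distrib_right)
  qed
  also have "(\<Sum>c\<in>range s. quad d (M (?A c)) y) = (\<Sum>i<d. \<Sum>j<d. cnj (y i) * (\<Sum>c\<in>range s. M (?A c) i j) * y j)"
    unfolding quad_def
    by (subst sum.swap, intro sum.cong refl, subst sum.swap) (simp add: sum_distrib_left sum_distrib_right)
  also have "\<dots> = (\<Sum>i<d. \<Sum>j<d. cnj (y i) * (if i = j then 1 else 0) * y j)"
  proof (intro sum.cong refl)
    fix i j assume "i \<in> {..<d}" "j \<in> {..<d}"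
    then have "(\<Sum>c\<in>range s. M (?A c) i j) = (if i = j then 1 else 0)"
      using Xmat_simple[OF s, of i j "\<lambda>_. 1"] Xmat_one[of i j] by simp
    then show "cnj (y i) * (\<Sum>c\<in>range s. M (?A c) i j) * y j = cnj (y i) * (if i = j then 1 else 0) * y j" by simp
  qed
  also have "\<dots> = (\<Sum>i<d. of_real ((norm (y i))^2))"
  proof (intro sum.cong refl)
    fix i assume i: "i \<in> {..<d}"
    have "(\<Sum>j<d. cnj (y i) * (if i = j then 1 else 0) * y j) = (\<Sum>j<d. if i = j then cnj (y i) * y i else 0)"
      by (intro sum.cong refl) auto
    also have "\<dots> = cnj (y i) * y i" using i by simp
    also have "\<dots> = of_real ((norm (y i))^2)" by (metis complex_norm_square mult.commute)
    finally show "(\<Sum>j<d. cnj (y i) * (if i = j then 1 else 0) * y j) = of_real ((norm (y i))^2)" .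
  qed
  finally show ?thesis by (simp add: qform_def)
qed

lemma qform_nonneg:
  assumes g: "g \<in> borel_measurable borel" and i2: "integrable (tau d M) (\<lambda>x. (norm (g x))^2)" and a: "a < d"
  shows "0 \<le> qform g a y"
proof -
  interpret finite_measure "tau d M"
    by (rule finite_measure_outcome[OF gram_idmat])
  obtain s where s: "\<And>k. simple_function borel (s k)" "\<And>x. (\<lambda>k. s k x) \<longlonglongrightarrow> g x"
     "\<And>k x. norm (s k x) \<le> 2 * norm (g x)"
    using borel_measurable_implies_sequence_metric[OF g, of 0] by (auto simp: space_borel)
  have m[measurable]: "s k \<in> borel_measurable borel" for k
    using s(1) by (rule borel_measurable_simple_function)
  \<comment> \<open>Dominated convergence in the linear terms needs an integrable bound for the
    modulus of g; since \<open>tau\<close> is finite, 1 plus its square serves.\<close>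
  have b: "norm (g x) \<le> 1 + (norm (g x))^2" for x
  proof -
    have "2 * norm (g x) \<le> 1 + (norm (g x))^2"
      using zero_le_power2[of "norm (g x) - 1"] by (simp add: power2_eq_square algebra_simps)
    then show ?thesis using norm_ge_zero[of "g x"] by linarith
  qed
  have w1: "integrable (tau d M) (\<lambda>x. 2 * (1 + (norm (g x))^2))" using i2 by simp
  have w2: "integrable (tau d M) (\<lambda>x. 4 * (norm (g x))^2)" using i2 by simp
  have n: "norm (s k x) \<le> 2 * (1 + (norm (g x))^2)" for k x
    using s(3)[of k x] b[of x] by simp
  have n2: "(norm (s k x))^2 \<le> 4 * (norm (g x))^2" for k x
    using power_mono[OF s(3)[of k x], of 2] by (simp add: power_mult_distrib)
  have "(\<lambda>k. qform (s k) a y) \<longlonglongrightarrow> qform g a y"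
    unfolding qform_def Xc_def
    by (intro tendsto_intros Xmat_lim[where w="\<lambda>x. 4 * (norm (g x))^2"] Xmat_lim[where w="\<lambda>x. 2 * (1 + (norm (g x))^2)"] w1 w2 s)
       (use n n2 in \<open>auto intro: order.trans[OF abs_Re_le_cmod] order.trans[OF abs_Im_le_cmod]\<close>)
  then show ?thesis
    by (rule LIMSEQ_le_const) (auto intro: qform_simple[OF s(1) a])
qed

text \<open>Sum the nonnegative \<open>qform\<close> over a with weights \<open>p a\<close>, the
  test vector at a being column a of B divided by \<open>p a\<close>. With Z = diag p this is the
  choice Y = B Z^-1, and the subtracted term is Tr B Z^-1 B^*, the right logarithmic quadratic
  form.\<close>

theorem povm_second_moment_ge:
  assumes g: "g \<in> borel_measurable borel" and i2: "integrable (outcome_dist d M Z) (\<lambda>x. (norm (g x))^2)"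
    and p: "\<And>i. i < d \<Longrightarrow> 0 < p i"
    and Z: "\<And>i j. i < d \<Longrightarrow> j < d \<Longrightarrow> Z i j = (if i = j then of_real (p i) else 0)"
  shows "integral\<^sup>L (outcome_dist d M Z) (\<lambda>x. (norm (g x))^2) \<ge>
     2 * Re (\<Sum>i<d. \<Sum>j<d. Xc g i j * B j i) - (\<Sum>i<d. \<Sum>j<d. (norm (B j i))^2 / p i)"
proof -
  have grZ: "gram d Z" using Z p by (intro gram_diag[of d Z p]) (auto simp: less_imp_le)
  have t2: "integrable (tau d M) (\<lambda>x. (norm (g x))^2)"
    by (rule integrable_tau_of_diag[OF p Z i2])
  have "0 \<le> (\<Sum>a<d. p a * qform g a (\<lambda>j. B j a / of_real (p a)))"
    using p by (intro sum_nonneg mult_nonneg_nonneg qform_nonneg g t2) (auto simp: less_imp_le)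
  also have "\<dots> = (\<Sum>a<d. p a * Re (Xmat d M (\<lambda>x. (norm (g x))^2) a a)
       - 2 * Re (\<Sum>j<d. Xc g a j * B j a) + (\<Sum>j<d. (norm (B j a))^2 / p a))"
  proof (intro sum.cong refl)
    fix a assume "a \<in> {..<d}"
    then have pa: "p a > 0" using p by simp
    have 1: "Re (\<Sum>j<d. Xc g a j * (B j a / of_real (p a))) = Re (\<Sum>j<d. Xc g a j * B j a) / p a"
      by (simp add: sum_divide_distrib)
    have 2: "(\<Sum>j<d. (norm (B j a / of_real (p a)))^2) = (\<Sum>j<d. (norm (B j a))^2 / p a) / p a"
      using pa by (simp add: sum_divide_distrib norm_divide power_divide power2_eq_square)
    show "p a * qform g a (\<lambda>j. B j a / of_real (p a)) = p a * Re (Xmat d M (\<lambda>x. (norm (g x))^2) a a)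
       - 2 * Re (\<Sum>j<d. Xc g a j * B j a) + (\<Sum>j<d. (norm (B j a))^2 / p a)"
      unfolding qform_def 1 2 using pa by (simp add: algebra_simps)
  qed
  also have "\<dots> = (\<Sum>a<d. p a * Re (Xmat d M (\<lambda>x. (norm (g x))^2) a a))
       - 2 * Re (\<Sum>a<d. \<Sum>j<d. Xc g a j * B j a) + (\<Sum>a<d. \<Sum>j<d. (norm (B j a))^2 / p a)"
    by (simp only: sum.distrib sum_subtractf Re_sum sum_distrib_left)
  also have "(\<Sum>a<d. p a * Re (Xmat d M (\<lambda>x. (norm (g x))^2) a a)) = integral\<^sup>L (outcome_dist d M Z) (\<lambda>x. (norm (g x))^2)"
  proof -
    have "(\<Sum>i<d. \<Sum>j<d. Xmat d M (\<lambda>x. (norm (g x))^2) i j * Z j i) =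
       (\<Sum>i<d. \<Sum>j<d. if j = i then of_real (p i) * Xmat d M (\<lambda>x. (norm (g x))^2) i i else 0)"
      using Z by (intro sum.cong refl) auto
    also have "\<dots> = (\<Sum>i<d. of_real (p i) * Xmat d M (\<lambda>x. (norm (g x))^2) i i)"
      by simp
    finally show ?thesis
      unfolding integral_outcome_Xmat[OF grZ t2] mtr_def by simp
  qed
  finally show ?thesis by simp
qed

end

subsection \<open>Square roots of matrices and the RLD bound\<close>

lemma sym_inner:
  fixes A :: "real^'n^'n"
  assumes "transpose A = A"
  shows "x \<bullet> (A *v y) = (A *v x) \<bullet> y"
  by (metis assms dot_lmul_matrix transpose_matrix_vector)

text \<open>Let v maximize x . A x on the unit sphere of S, with maximum l. Then l |x|^2 - x . A x
  is nonnegative on S and zero at v, and a small move from v along the residual A v - l v would make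
  it negative unless the residual vanishes.\<close>

lemma symmetric_max_eigenvector:
  fixes A :: "real^'n^'n"
  assumes sym: "transpose A = A" and S: "subspace S" "\<And>x. x \<in> S \<Longrightarrow> A *v x \<in> S" "S \<noteq> {0}"
  obtains v l where "v \<in> S" "norm v = 1" "A *v v = l *\<^sub>R v"
proof -
  let ?K = "S \<inter> sphere 0 1"
  have "compact ?K" using closed_subspace[OF S(1)] by (simp add: closed_Int_compact)
  moreover have "?K \<noteq> {}"
  proof -
    obtain x where "x \<in> S" "x \<noteq> 0" using S(1,3) subspace_0 by blast
    then have "inverse (norm x) *\<^sub>R x \<in> ?K" using S(1) by (simp add: subspace_scale)
    then show ?thesis by blast
  qed
  moreover have "continuous_on ?K (\<lambda>x. x \<bullet> (A *v x))"
    by (intro continuous_intros linear_continuous_on matrix_vector_mul_bounded_linear)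
  ultimately have "\<exists>v\<in>?K. \<forall>x\<in>?K. x \<bullet> (A *v x) \<le> v \<bullet> (A *v v)"
    by (rule continuous_attains_sup)
  then obtain v where v: "v \<in> ?K" and max: "\<And>x. x \<in> ?K \<Longrightarrow> x \<bullet> (A *v x) \<le> v \<bullet> (A *v v)"
    by blast
  define l where "l = v \<bullet> (A *v v)"
  define f where "f x = l * (x \<bullet> x) - x \<bullet> (A *v x)" for x
  have nv: "v \<bullet> v = 1" using v by (simp add: dot_square_norm)
  have f0: "0 \<le> f x" if "x \<in> S" for x
  proof (cases "x = 0")
    case True then show ?thesis by (simp add: f_def)
  next
    case False
    let ?y = "inverse (norm x) *\<^sub>R x"
    have "?y \<in> ?K" using S(1) that False by (simp add: subspace_scale)
    from max[OF this] have "(inverse (norm x))^2 * (x \<bullet> (A *v x)) \<le> l"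
      by (simp add: l_def matrix_vector_mult_scaleR power2_eq_square mult.assoc)
    then have "x \<bullet> (A *v x) \<le> l * (norm x)^2"
      using False by (simp add: field_simps power2_eq_square)
    then show ?thesis by (simp add: f_def dot_square_norm)
  qed
  define w where "w = A *v v - l *\<^sub>R v"
  have w: "w \<in> S" using S v by (auto simp: w_def subspace_diff subspace_scale)
  have exp: "f (v + t *\<^sub>R w) = t * (t * f w - 2 * (w \<bullet> w))" for t
  proof -
    have "v \<bullet> (A *v w) = w \<bullet> (A *v v)" using sym_inner[OF sym, of v w] by (simp add: inner_commute)
    moreover have "w \<bullet> (A *v v) = w \<bullet> w + l * (w \<bullet> v)"
    proof -
      have "A *v v = w + l *\<^sub>R v" by (simp add: w_def)
      then show ?thesis by (simp add: inner_add_right)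
    qed
    moreover have "f v = 0" by (simp add: f_def l_def nv)
    ultimately show ?thesis
      using nv unfolding f_def
      by (simp add: matrix_vector_right_distrib matrix_vector_mult_scaleR inner_add_left inner_add_right inner_commute[of v w] algebra_simps l_def[symmetric])
  qed
  have "w = 0"
  proof (rule ccontr)
    assume "w \<noteq> 0"
    then have W: "w \<bullet> w > 0" by simp
    have fw: "f w \<ge> 0" using f0[OF w] .
    \<comment> \<open>Small enough for t f(w) <= w . w; the summand 1 keeps the denominator
      positive.\<close>
    define t where "t = (w \<bullet> w) / (f w + 1)"
    have t: "t > 0" using W fw by (simp add: t_def)
    have "t * f w \<le> w \<bullet> w"
      using W fw by (simp add: t_def field_simps)
    then have "t * f w - 2 * (w \<bullet> w) < 0" using W by linarith
    then have "f (v + t *\<^sub>R w) < 0" unfolding exp using t by (simp add: mult_pos_neg)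
    moreover have "v + t *\<^sub>R w \<in> S" using S(1) v w by (auto intro: subspace_add subspace_scale)
    ultimately show False using f0 by force
  qed
  then show ?thesis using v that[of v l] by (simp add: w_def)
qed

text \<open>Split off one eigenvector and continue in its orthogonal complement within S, which is
  invariant because A is symmetric.\<close>

lemma symmetric_eigenbasis_subspace:
  fixes A :: "real^'n^'n"
  assumes sym: "transpose A = A"
  shows "subspace S \<Longrightarrow> (\<And>x. x \<in> S \<Longrightarrow> A *v x \<in> S) \<Longrightarrow>
     \<exists>B l. B \<subseteq> S \<and> finite B \<and> S \<subseteq> span B \<and> (\<forall>b\<in>B. \<forall>c\<in>B. b \<bullet> c = (if b = c then 1 else 0)) \<and> (\<forall>b\<in>B. A *v b = l b *\<^sub>R b)"
proof (induction "dim S" arbitrary: S rule: less_induct)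
  case less
  show ?case
  proof (cases "S = {0}")
    case True
    then show ?thesis by (intro exI[of _ "{}"]) auto
  next
    case False
    obtain v m where v: "v \<in> S" "norm v = 1" "A *v v = m *\<^sub>R v"
      using symmetric_max_eigenvector[OF sym less.prems False] by blast
    have vv: "v \<bullet> v = 1" using v(2) by (simp add: dot_square_norm)
    let ?T = "S \<inter> {x. v \<bullet> x = 0}"
    have T: "subspace ?T" using less.prems(1) by (intro subspace_inter subspace_hyperplane)
    have "v \<notin> ?T" using vv by simp
    then have "?T \<subset> S" using v(1) by blast
    then have "dim ?T < dim S" using T less.prems(1) by (intro dim_psubset) (simp add: span_eq_iff[THEN iffD2])
    moreover have "A *v x \<in> ?T" if "x \<in> ?T" for x
      using that less.prems(2) sym_inner[OF sym, of v x] v(3) by simp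
    ultimately obtain B l where B: "B \<subseteq> ?T" "finite B" "?T \<subseteq> span B"
      "\<forall>b\<in>B. \<forall>c\<in>B. b \<bullet> c = (if b = c then 1 else 0)" "\<forall>b\<in>B. A *v b = l b *\<^sub>R b"
      using less.hyps[OF _ T] by blast
    have vB: "v \<notin> B" using B(1) vv by auto
    have "S \<subseteq> span (insert v B)"
    proof
      fix x assume "x \<in> S"
      then have "x - (v \<bullet> x) *\<^sub>R v \<in> ?T"
        using v(1) vv less.prems(1) by (simp add: subspace_diff subspace_scale inner_diff_right)
      then have "x - (v \<bullet> x) *\<^sub>R v \<in> span (insert v B)"
        using B(3) span_mono[of B "insert v B"] by blast
      moreover have "(v \<bullet> x) *\<^sub>R v \<in> span (insert v B)" by (simp add: span_base span_scale)
      ultimately show "x \<in> span (insert v B)" using span_add by fastforce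
    qed
    moreover have "\<forall>b\<in>insert v B. \<forall>c\<in>insert v B. b \<bullet> c = (if b = c then 1 else 0)"
      using B(1,4) vB vv by (auto simp: inner_commute)
    moreover have "\<forall>b\<in>insert v B. A *v b = (l(v := m)) b *\<^sub>R b"
      using B(5) vB v(3) by auto
    ultimately show ?thesis
      using B(1,2) v(1) by (intro exI[of _ "insert v B"] exI[of _ "l(v := m)"]) auto
  qed
qed

lemma symmetric_eigenbasis:
  fixes A :: "real^'n^'n"
  assumes "transpose A = A"
  obtains B l where "finite B" "span B = UNIV" "\<And>b c. b \<in> B \<Longrightarrow> c \<in> B \<Longrightarrow> b \<bullet> c = (if b = c then 1 else 0)"
    "\<And>b. b \<in> B \<Longrightarrow> A *v b = l b *\<^sub>R b"
proof -
  obtain B l where "finite B" "UNIV \<subseteq> span B" "\<forall>b\<in>B. \<forall>c\<in>B. b \<bullet> c = (if b = c then 1 else 0)"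
    "\<forall>b\<in>B. A *v b = l b *\<^sub>R b"
    using symmetric_eigenbasis_subspace[OF assms, of UNIV] by auto
  then show thesis by (intro that[of B l]) (auto simp: top.extremum_unique)
qed

lemma psd_sqrt_eigen:
  fixes S :: "real^'n^'n"
  assumes S: "psd_real S" and e: "(S ** S) *v b = l *\<^sub>R b" and b: "b \<bullet> b = 1"
  shows "S *v b = sqrt l *\<^sub>R b"
proof -
  have sym: "transpose S = S" and pos: "\<And>x. 0 \<le> x \<bullet> (S *v x)" using S by (auto simp: psd_real_def)
  have SS: "S *v (S *v b) = l *\<^sub>R b" using e by (simp add: matrix_vector_mul_assoc)
  have "(S *v b) \<bullet> (S *v b) = l"
    using sym_inner[OF sym, of b "S *v b"] SS b by simp
  then have l: "0 \<le> l" by (metis inner_ge_zero)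
  show ?thesis
  proof (cases "l = 0")
    case True
    then show ?thesis using \<open>(S *v b) \<bullet> (S *v b) = l\<close> by simp
  next
    case False
    \<comment> \<open>Since (S + sqrt l)(S - sqrt l) b = 0, this z satisfies S z = - sqrt l z, which
      positivity of S allows only for z = 0.\<close>
    define z where "z = S *v b - sqrt l *\<^sub>R b"
    have "S *v z = - sqrt l *\<^sub>R z"
      using l by (simp add: z_def matrix_vector_mult_diff_distrib matrix_vector_mult_scaleR SS scaleR_diff_right)
    then have "0 \<le> - sqrt l * (z \<bullet> z)" using pos[of z] by simp
    moreover have "sqrt l > 0" using l False by simp
    ultimately have "z \<bullet> z \<le> 0" by (simp add: mult_le_0_iff)
    then have "z = 0" by (metis inner_ge_zero inner_eq_zero_iff order_antisym)
    then show ?thesis by (simp add: z_def)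
  qed
qed

text \<open>This gives the definite description in \<open>msqrt\<close> its meaning. Both roots act
  as multiplication by sqrt l on each eigenvector of the common square.\<close>

lemma psd_sqrt_unique:
  fixes S T :: "real^'n^'n"
  assumes "psd_real S" "psd_real T" "S ** S = T ** T"
  shows "S = T"
proof -
  have "transpose (S ** S) = S ** S" using assms(1) by (simp add: psd_real_def matrix_transpose_mul)
  then obtain B l where B: "span B = UNIV" "\<And>b c. b \<in> B \<Longrightarrow> c \<in> B \<Longrightarrow> b \<bullet> c = (if b = c then 1 else 0)"
    "\<And>b. b \<in> B \<Longrightarrow> (S ** S) *v b = l b *\<^sub>R b"
    by (rule symmetric_eigenbasis) blast
  have "S *v b = T *v b" if "b \<in> B" for b
    using psd_sqrt_eigen[OF assms(1) B(3)[OF that]] psd_sqrt_eigen[OF assms(2), of b "l b"] B(2,3)[OF that] that assms(3)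
    by simp
  then have "S *v x = T *v x" for x
    using B(1) by (intro linear_eq_on[of "(*v) S" "(*v) T" x B]) auto
  then show ?thesis by (simp add: matrix_eq)
qed

lemma msqrt_eqI: "psd_real S \<Longrightarrow> S ** S = A \<Longrightarrow> msqrt A = S"
  unfolding msqrt_def using psd_sqrt_unique by (intro the_equality) auto

lemma psd_sqrt_exists:
  fixes A :: "real^'n^'n"
  assumes "psd_real A"
  shows "\<exists>S. psd_real S \<and> S ** S = A"
proof -
  have sym: "transpose A = A" and pos: "\<And>x. 0 \<le> x \<bullet> (A *v x)" using assms by (auto simp: psd_real_def)
  obtain B l where B: "finite B" "span B = UNIV" "\<And>b c. b \<in> B \<Longrightarrow> c \<in> B \<Longrightarrow> b \<bullet> c = (if b = c then 1 else 0)"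
    "\<And>b. b \<in> B \<Longrightarrow> A *v b = l b *\<^sub>R b"
    by (rule symmetric_eigenbasis[OF sym]) blast
  have l: "0 \<le> l b" if "b \<in> B" for b
    using pos[of b] B(3)[OF that that] B(4)[OF that] by simp
  define f where "f x = (\<Sum>b\<in>B. (sqrt (l b) * (b \<bullet> x)) *\<^sub>R b)" for x
  have lin: "linear f"
    by (rule linearI) (auto simp: f_def inner_add_right algebra_simps sum.distrib scaleR_sum_right scaleR_add_left)
  define S where "S = matrix f"
  have S: "S *v x = f x" for x using lin by (simp add: S_def)
  have fb: "f b = sqrt (l b) *\<^sub>R b" if "b \<in> B" for b
  proof -
    have "f b = (\<Sum>c\<in>B. if c = b then sqrt (l b) *\<^sub>R b else 0)"
      unfolding f_def using B(3) that by (intro sum.cong refl) auto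
    then show ?thesis using B(1) that by simp
  qed
  have "(S ** S) *v b = A *v b" if "b \<in> B" for b
    using fb[OF that] B(4)[OF that] l[OF that] linear_scale[OF lin]
    by (simp add: matrix_vector_mul_assoc[symmetric] S)
  then have "(S ** S) *v x = A *v x" for x
    using B(2) by (intro linear_eq_on[of "(*v) (S ** S)" "(*v) A" x B]) auto
  then have SS: "S ** S = A" by (simp add: matrix_eq)
  have ip: "x \<bullet> f y = (\<Sum>b\<in>B. sqrt (l b) * (b \<bullet> x) * (b \<bullet> y))" for x y
    by (simp add: f_def inner_sum_right inner_commute mult_ac)
  have "x \<bullet> (transpose S *v y) = x \<bullet> (S *v y)" for x y
  proof -
    have "x \<bullet> (transpose S *v y) = y \<bullet> (S *v x)"
      by (metis dot_lmul_matrix inner_commute transpose_matrix_vector)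
    then show ?thesis by (simp add: S ip mult_ac)
  qed
  then have "transpose S *v y = S *v y" for y using vector_eq_ldot by blast
  then have "transpose S = S" unfolding matrix_eq by blast
  moreover have "0 \<le> x \<bullet> (S *v x)" for x
    unfolding S ip using l by (intro sum_nonneg) (simp add: mult.assoc)
  ultimately show ?thesis using SS by (auto simp: psd_real_def)
qed

lemma psd_msqrt:
  assumes "psd_real A"
  shows "psd_real (msqrt A)" "msqrt A ** msqrt A = A"
  using psd_sqrt_exists[OF assms] msqrt_eqI by metis+

section \<open>The RLD Fisher matrix and the RLD bound at (0,0,r)\<close>

definition thz :: "real \<Rightarrow> real^3" where "thz r = (\<chi> i. if i = 3 then r else 0)"

definition eigval :: "real \<Rightarrow> 2 \<Rightarrow> real" where "eigval r a = (if a = 1 then (1 + r)/2 else (1 - r)/2)"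

lemma sig_entries:
  "sig 1 $ 1 $ 1 = 0" "sig 1 $ 1 $ 2 = 1/2" "sig 1 $ 2 $ 1 = 1/2" "sig 1 $ 2 $ 2 = 0"
  "sig 2 $ 1 $ 1 = 0" "sig 2 $ 1 $ 2 = -\<i>/2" "sig 2 $ 2 $ 1 = \<i>/2" "sig 2 $ 2 $ 2 = 0"
  "sig 3 $ 1 $ 1 = 1/2" "sig 3 $ 1 $ 2 = 0" "sig 3 $ 2 $ 1 = 0" "sig 3 $ 2 $ 2 = -1/2"
  by (simp_all add: sig_def)

lemma rho_thz: "rho (thz r) $ a $ b = (if a = b then of_real (eigval r a) else 0)"
  using exhaust_2[of a] exhaust_2[of b]
  by (elim disjE) (simp_all add: rho_def thz_def sum_3 sig_entries eigval_def field_simps)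

lemma rho_line: "rho (\<theta> + t *\<^sub>R axis j 1) = rho \<theta> + t *\<^sub>R sig j"
proof -
  have h: "(\<Sum>i\<in>UNIV. complex_of_real ((\<theta> + t *\<^sub>R axis j 1)$i) * (sig i)$a$b)
     = (\<Sum>i\<in>UNIV. complex_of_real (\<theta>$i) * (sig i)$a$b) + of_real t * sig j $ a $ b" for a b
  proof -
    have "(\<Sum>i\<in>UNIV. complex_of_real ((\<theta> + t *\<^sub>R axis j 1)$i) * (sig i)$a$b)
     = (\<Sum>i\<in>UNIV. complex_of_real (\<theta>$i) * (sig i)$a$b + (if i = j then of_real t * sig j $ a $ b else 0))"
      by (intro sum.cong refl) (auto simp: axis_def algebra_simps)
    then show ?thesis by (simp add: sum.distrib)
  qed
  have "rho (\<theta> + t *\<^sub>R axis j 1) $ a $ b = (rho \<theta> + t *\<^sub>R sig j) $ a $ b" for a b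
  proof -
    have "(t *\<^sub>R sig j) $ a $ b = of_real t * sig j $ a $ b"
      unfolding vector_scaleR_component by (rule scaleR_conv_of_real)
    then show ?thesis
      by (simp only: rho_def vec_lambda_beta h) (simp only: vector_add_component vec_lambda_beta add.assoc)
  qed
  then show ?thesis by (simp add: vec_eq_iff)
qed

lemma drho_eq: "drho \<theta> j = sig j"
  unfolding drho_def rho_line
  by (rule vector_derivative_at) (auto intro!: derivative_eq_intros)

lemma RLD_L_thz:
  assumes "0 \<le> r" "r < 1"
  shows "RLD_L (thz r) j = (\<chi> a b. sig j $ a $ b / of_real (eigval r a))"
proof -
  have p: "eigval r a \<noteq> 0" for a using assms by (auto simp: eigval_def)
  have m: "(rho (thz r) ** L) $ a $ b = of_real (eigval r a) * L $ a $ b" for L a b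
    using exhaust_2[of a] by (auto simp: rho_thz matrix_matrix_mult_def sum_2)
  show ?thesis unfolding RLD_L_def drho_eq
  proof (rule the_equality)
    show "sig j = rho (thz r) ** (\<chi> a b. sig j $ a $ b / of_real (eigval r a))"
      using p by (simp add: vec_eq_iff m)
  next
    fix L assume "sig j = rho (thz r) ** L"
    then have "sig j $ a $ b = of_real (eigval r a) * L $ a $ b" for a b by (simp add: m)
    then show "L = (\<chi> a b. sig j $ a $ b / of_real (eigval r a))" using p by (simp add: vec_eq_iff)
  qed
qed

lemma RLD_J_entry:
  assumes "0 \<le> r" "r < 1"
  shows "RLD_J (thz r) $ j $ k = (\<Sum>a\<in>UNIV. \<Sum>b\<in>UNIV. sig k $ a $ b * cnj (sig j $ a $ b) / of_real (eigval r a))"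
proof -
  have p: "eigval r a \<noteq> 0" for a using assms by (auto simp: eigval_def)
  show ?thesis
    unfolding RLD_J_def RLD_L_thz[OF assms] trace_def matrix_matrix_mult_def cadj_def
    using p[of 1] p[of 2] by (simp add: sum_2 rho_thz)
qed

lemma RLD_J_thz:
  assumes r: "0 \<le> r" "r < 1"
  shows "RLD_J (thz r) = (\<chi> j k. (if j = k then 1 else if j = 1 \<and> k = 2 then \<i> * of_real r
     else if j = 2 \<and> k = 1 then - \<i> * of_real r else 0) / of_real (1 - r^2))"
proof -
  \<comment> \<open>With this E the reciprocal eigenvalues are 2 E (1 - r) and 2 E (1 + r), so all
    entries become polynomials in E and r.\<close>
  define E where "E = inverse (1 - r^2)"
  have "r^2 < 1" using r by (simp add: abs_square_less_1)
  then have h: "inverse (eigval r 1) = 2 * E - 2 * r * E" "inverse (eigval r 2) = 2 * E + 2 * r * E"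
    using r by (auto simp: eigval_def E_def divide_simps) (auto simp: algebra_simps power2_eq_square)
  have u: "inverse (of_real (eigval r 1)) = (2 * of_real E - 2 * of_real r * of_real E :: complex)"
    "inverse (of_real (eigval r 2)) = (2 * of_real E + 2 * of_real r * of_real E :: complex)"
    unfolding of_real_inverse[symmetric] h by simp_all
  have dv: "x / of_real (eigval r 1) = x * (2 * of_real E - 2 * of_real r * of_real E)"
    "x / of_real (eigval r 2) = x * (2 * of_real E + 2 * of_real r * of_real E)" for x :: complex
    unfolding divide_inverse u by (rule refl)+
  have e: "x / of_real (1 - r^2) = x * of_real E" for x :: complex
    by (simp add: E_def divide_inverse)
  show ?thesis
    unfolding vec_eq_iff RLD_J_entry[OF r] e sum_2
    by (simp add: dv forall_3 sig_entries) (simp add: field_simps)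
qed

lemma matrix_inv_eqI:
  fixes A B :: "'a::field^'n^'n"
  assumes "A ** B = mat 1" shows "matrix_inv A = B"
proof -
  have BA: "B ** A = mat 1" using assms by (simp add: matrix_left_right_inverse)
  have "A ** matrix_inv A = mat 1 \<and> matrix_inv A ** A = mat 1"
    unfolding matrix_inv_def by (rule someI[of _ B]) (use assms BA in auto)
  then show ?thesis by (metis BA matrix_mul_assoc matrix_mul_lid matrix_mul_rid)
qed

lemma RLD_inv:
  assumes r: "0 \<le> r" "r < 1"
  shows "matrix_inv (RLD_J (thz r)) = (\<chi> j k. if j = k then (if j = 3 then of_real (1 - r^2) else 1)
     else if j = 1 \<and> k = 2 then - \<i> * of_real r
     else if j = 2 \<and> k = 1 then \<i> * of_real r else 0)" (is "_ = ?W")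
proof (rule matrix_inv_eqI)
  define E where "E = inverse (1 - r^2)"
  have "r^2 < 1" using r by (simp add: abs_square_less_1)
  then have "E * (r * r) = E - 1"
    by (simp add: E_def field_simps power2_eq_square)
  then have c: "complex_of_real E * (of_real r * of_real r) = of_real E - 1"
    by (metis of_real_1 of_real_diff of_real_mult)
  have e: "x / of_real (1 - r^2) = x * of_real E" for x :: complex
    by (simp add: E_def divide_inverse)
  have d: "of_real E * (1 - (of_real r)^2) = (1::complex)"
    using c by (simp add: power2_eq_square algebra_simps)
  show "RLD_J (thz r) ** ?W = mat 1"
    unfolding RLD_J_thz[OF r] e
    by (simp add: vec_eq_iff forall_3 matrix_matrix_mult_def sum_3 mat_def) (simp add: c d mult_ac)
qed

text \<open>A real antisymmetric 3 x 3 matrix is the cross product with a vector, here of length k.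
  So N = B^T B is k^2 times the projection onto the orthogonal plane, N N = k^2 N, and N / k is the
  square root of N, with trace 2 k.\<close>

lemma trace_abs_antisym3:
  fixes B :: "real^3^3"
  assumes anti: "transpose B = - B" and k: "0 \<le> k" "trace (transpose B ** B) = 2 * k^2"
  shows "trace_abs B = 2 * k"
proof -
  have b: "B$i$j = - B$j$i" for i j
    using arg_cong[OF anti, of "\<lambda>M. M$j$i"] by (simp add: transpose_def)
  have z: "B$1$1 = 0" "B$2$2 = 0" "B$3$3 = 0" using b[of 1 1] b[of 2 2] b[of 3 3] by auto
  have e: "B$2$1 = - B$1$2" "B$3$1 = - B$1$3" "B$3$2 = - B$2$3" using b by blast+
  let ?N = "transpose B ** B"
  have "trace ?N = (\<Sum>i\<in>UNIV. \<Sum>j\<in>UNIV. (B$j$i)^2)"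
    by (simp add: trace_def matrix_matrix_mult_def transpose_def power2_eq_square)
  also have "\<dots> = 2 * ((B$1$2)^2 + (B$1$3)^2 + (B$2$3)^2)"
    unfolding sum_3 by (simp add: z e)
  finally have kk: "k^2 = (B$1$2)^2 + (B$1$3)^2 + (B$2$3)^2"
    using k(2) by simp
  show ?thesis
  proof (cases "k = 0")
    case True
    then have "B$1$2 = 0 \<and> B$1$3 = 0 \<and> B$2$3 = 0" using kk
      by (metis add_nonneg_eq_0_iff power2_eq_iff_nonneg sum_power2_eq_zero_iff zero_le_power2 zero_power2 add_nonneg_nonneg power_eq_0_iff)
    then have "?N = 0" using z e by (simp add: vec_eq_iff forall_3 matrix_matrix_mult_def sum_3 transpose_def)
    moreover have "msqrt (0::real^3^3) = 0"
      by (rule msqrt_eqI) (auto simp: psd_real_def transpose_def vec_eq_iff matrix_matrix_mult_def)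
    ultimately show ?thesis using True by (simp add: trace_abs_def trace_def)
  next
    case False
    let ?S = "(1/k) *\<^sub>R ?N"
    have "psd_real ?S"
      unfolding psd_real_def
    proof
      show "transpose ?S = ?S"
        by (simp add: vec_eq_iff transpose_def matrix_matrix_mult_def mult.commute)
      show "\<forall>x. 0 \<le> x \<bullet> (?S *v x)"
      proof
        fix x
        have "x \<bullet> (?N *v x) = (B *v x) \<bullet> (B *v x)"
          by (metis dot_lmul_matrix inner_commute matrix_vector_mul_assoc transpose_matrix_vector)
        then show "0 \<le> x \<bullet> (?S *v x)" using k(1) by (simp add: scaleR_matrix_vector_assoc[symmetric])
      qed
    qed
    moreover have "?N ** ?N = k^2 *\<^sub>R ?N"
      unfolding kk
      by (simp add: vec_eq_iff forall_3 matrix_matrix_mult_def sum_3 transpose_def z e power2_eq_square algebra_simps)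
    then have "?S ** ?S = ?N"
      using False by (simp add: scalar_matrix_assoc[symmetric] matrix_scalar_ac power2_eq_square)
    ultimately have "msqrt ?N = ?S" by (rule msqrt_eqI)
    then have "trace_abs B = (1/k) * trace ?N"
      by (simp add: trace_abs_def trace_def sum_distrib_left)
    then show ?thesis using False by (simp add: k(2) power2_eq_square)
  qed
qed

lemma posdef_minors:
  fixes G :: "real^3^3"
  assumes sym: "transpose G = G" and pos: "\<forall>x. x \<noteq> 0 \<longrightarrow> 0 < x \<bullet> (G *v x)"
  shows "0 < G$1$1" "G$2$1 = G$1$2" "G$3$1 = G$1$3" "G$3$2 = G$2$3" "0 < G$1$1 * G$2$2 - (G$1$2)^2"
proof -
  have s: "G$i$j = G$j$i" for i j using arg_cong[OF sym, of "\<lambda>M. M$j$i"] by (simp add: transpose_def)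
  show "G$2$1 = G$1$2" "G$3$1 = G$1$3" "G$3$2 = G$2$3" using s by blast+
  have "0 < axis 1 1 \<bullet> (G *v axis 1 1)" using pos by (simp add: axis_eq_0_iff)
  then show g: "0 < G$1$1"
    by (simp add: inner_axis' matrix_vector_mult_basis column_def)
  \<comment> \<open>Orthogonal to the first row of G, so the quadratic form collapses to
    \<open>G$1$1\<close> times the minor.\<close>
  let ?x = "vector [- G$1$2, G$1$1, 0] :: real^3"
  have "?x \<noteq> 0" using g by (auto simp: vec_eq_iff forall_3)
  then have "0 < ?x \<bullet> (G *v ?x)" using pos by blast
  also have "?x \<bullet> (G *v ?x) = G$1$1 * (G$1$1 * G$2$2 - (G$1$2)^2)"
    using s[of 2 1] by (simp add: inner_vec_def matrix_vector_mult_def sum_3 power2_eq_square algebra_simps)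
  finally show "0 < G$1$1 * G$2$2 - (G$1$2)^2" using g by (simp add: zero_less_mult_iff)
qed

definition RLD_value :: "real \<Rightarrow> real^3^3 \<Rightarrow> real" where
  "RLD_value r G = trace G - r^2 * G$3$3 + 2 * r * sqrt (G$1$1 * G$2$2 - G$1$2 * G$2$1)"

theorem RLD_bound_thz:
  fixes G :: "real^3^3"
  assumes r: "0 \<le> r" "r < 1" and sym: "transpose G = G" and pos: "\<forall>x. x \<noteq> 0 \<longrightarrow> 0 < x \<bullet> (G *v x)"
  shows "RLD_bound (thz r) G = RLD_value r G"
proof -
  note g = posdef_minors[OF sym pos]
  have "psd_real G"
    unfolding psd_real_def using sym pos by (metis inner_zero_left less_imp_le order_refl)
  note S = psd_msqrt[OF this]
  define S where "S = msqrt G"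
  have Ss: "transpose S = S" and SS: "S ** S = G" using S by (auto simp: S_def psd_real_def)
  define R :: "real^3^3" where "R = (\<chi> j k. if j = k then (if j = 3 then 1 - r^2 else 1) else 0)"
  define K :: "real^3^3" where "K = (\<chi> j k. if j = 1 \<and> k = 2 then - r else if j = 2 \<and> k = 1 then r else 0)"
  have RW: "(\<chi> j k. Re (matrix_inv (RLD_J (thz r)) $ j $ k)) = R"
    unfolding RLD_inv[OF r] R_def by (auto simp: vec_eq_iff)
  have KW: "(\<chi> j k. Im (matrix_inv (RLD_J (thz r)) $ j $ k)) = K"
    unfolding RLD_inv[OF r] K_def by (auto simp: vec_eq_iff)
  have "trace (S ** R ** S) = trace (R ** G)"
    by (metis SS matrix_mul_assoc trace_mul_sym)
  also have "\<dots> = trace G - r^2 * G$3$3"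
    by (simp add: trace_def sum_3 matrix_matrix_mult_def R_def algebra_simps)
  finally have 1: "trace (S ** R ** S) = trace G - r^2 * G$3$3" .
  define B where "B = S ** K ** S"
  define k where "k = r * sqrt (G$1$1 * G$2$2 - G$1$2 * G$2$1)"
  have mn: "A ** (- C) = - (A ** C)" "(- A) ** C = - (A ** C)" for A C :: "real^3^3"
    by (simp_all add: matrix_matrix_mult_def vec_eq_iff sum_negf)
  have Kt: "transpose K = - K"
    by (simp add: K_def vec_eq_iff forall_3 transpose_def)
  have Bt: "transpose B = - B"
    by (simp add: B_def matrix_transpose_mul Ss Kt matrix_mul_assoc mn)
  have tn: "trace (- A) = - trace A" for A :: "real^3^3"
    by (simp add: trace_def sum_negf)
  \<comment> \<open>Cyclicity of the trace recombines the square roots into G, and K then selects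
    the upper block.\<close>
  have "trace (B ** B) = trace (K ** G ** K ** G)"
  proof -
    have "B ** B = S ** (K ** S ** S ** K ** S)" by (simp add: B_def matrix_mul_assoc)
    then have "trace (B ** B) = trace ((K ** S ** S ** K ** S) ** S)" by (simp only: trace_mul_sym[of S])
    also have "(K ** S ** S ** K ** S) ** S = K ** (S ** S) ** K ** (S ** S)" by (simp only: matrix_mul_assoc)
    finally show ?thesis by (simp only: SS)
  qed
  also have "\<dots> = - 2 * r^2 * (G$1$1 * G$2$2 - G$1$2 * G$2$1)"
    by (simp add: trace_def sum_3 matrix_matrix_mult_def K_def power2_eq_square g(2) algebra_simps)
  finally have "trace (transpose B ** B) = 2 * k^2"
    using g(5) by (simp add: Bt mn tn k_def power_mult_distrib g(2) power2_eq_square)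
  moreover have "0 \<le> k" using r g(5) by (simp add: k_def g(2) power2_eq_square)
  ultimately have "trace_abs B = 2 * k" using trace_abs_antisym3[OF Bt] by blast
  then show ?thesis
    unfolding RLD_value_def RLD_bound_def Let_def RW KW using 1
    by (simp add: S_def[symmetric] B_def[symmetric] k_def)
qed

subsection \<open>The RLD inequality for n copies\<close>

fun eigprod :: "nat \<Rightarrow> real \<Rightarrow> nat \<Rightarrow> real" where
  "eigprod 0 r i = 1"
| "eigprod (Suc n) r i = eigval r (idx2 (i mod 2)) * eigprod n r (i div 2)"

lemma eigval_pos: "\<bar>r\<bar> < 1 \<Longrightarrow> 0 < eigval r a"
  by (auto simp: eigval_def)

lemma eigprod_pos: "\<bar>r\<bar> < 1 \<Longrightarrow> 0 < eigprod n r i"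
  by (induction n arbitrary: i) (auto simp: eigval_pos)

lemma idx2_eq_iff: "idx2 (i mod 2) = idx2 (j mod 2) \<longleftrightarrow> i mod 2 = j mod 2"
  by (auto simp: idx2_def)

lemma tpow_thz: "tpow n (rho (thz r)) i j = of_real (eigprod n r i) * one_n n i j"
proof (induction n arbitrary: i j)
  case 0
  then show ?case by (simp add: tpow_0 one_n_0)
next
  case (Suc n)
  then show ?case by (simp add: tpow_Suc one_n_Suc tens_def rho_thz mat_def idx2_eq_iff)
qed

lemma one_n_less: "i < 2^n \<Longrightarrow> j < 2^n \<Longrightarrow> one_n n i j = (if i = j then 1 else 0)"
  by (simp add: one_n_eq)

lemma tpow_thz_diag:
  "i < 2^n \<Longrightarrow> j < 2^n \<Longrightarrow> tpow n (rho (thz r)) i j = (if i = j then of_real (eigprod n r i) else 0)"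
  by (simp add: tpow_thz one_n_less)

lemma sum_eigprod: "(\<Sum>i<2^n. eigprod n r i) = 1"
proof (induction n)
  case (Suc n)
  have "(\<Sum>i<2^Suc n. eigprod (Suc n) r i) = (\<Sum>k<2^n. (eigval r 1 + eigval r 2) * eigprod n r k)"
    unfolding sum_pow2_Suc by (simp add: algebra_simps)
  then show ?case using Suc by (simp add: sum_distrib_left[symmetric] eigval_def field_simps)
qed simp

text \<open>The product rule for \<open>tpow\<close> in the direction \<open>b\<close>. The
  direction may be non-Hermitian, which admits the complex combinations of derivatives in the lower
  bound.\<close>

fun dtpow :: "nat \<Rightarrow> complex^2^2 \<Rightarrow> complex^2^2 \<Rightarrow> cmat" where
  "dtpow 0 \<rho> b = (\<lambda>i j. 0)"
| "dtpow (Suc n) \<rho> b = (\<lambda>i j. tens b (tpow n \<rho>) i j + tens \<rho> (dtpow n \<rho> b) i j)"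

lemma has_vector_derivative_tpow:
  "((\<lambda>t. tpow n (\<rho> + t *\<^sub>R s) i j) has_vector_derivative dtpow n \<rho> s i j) (at 0)"
proof (induction n arbitrary: i j)
  case 0
  then show ?case by (simp add: tpow_0)
next
  case (Suc n)
  let ?a = "idx2 (i mod 2)" and ?b = "idx2 (j mod 2)"
  have "((\<lambda>t. \<rho>$?a$?b + t *\<^sub>R s$?a$?b) has_vector_derivative s$?a$?b) (at 0)"
    by (auto intro!: derivative_eq_intros)
  then have 1: "((\<lambda>t. (\<rho> + t *\<^sub>R s)$?a$?b) has_vector_derivative s$?a$?b) (at 0)"
    by simp
  from has_vector_derivative_mult[OF 1 Suc[of "i div 2" "j div 2"]]
  show ?case by (simp add: tpow_Suc tens_def add.commute)
qed

lemma dtpow_sum: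
  "dtpow n \<rho> (\<chi> a c. \<Sum>k\<in>I. v k * s k $ a $ c) i j = (\<Sum>k\<in>I. v k * dtpow n \<rho> (s k) i j)"
proof (induction n arbitrary: i j)
  case 0
  then show ?case by simp
next
  case (Suc n)
  then show ?case
    by (simp add: tens_def sum_distrib_left sum_distrib_right sum.distrib algebra_simps)
qed

lemma tr_dtpow:
  assumes "trace b = 0" "trace \<rho> = 1"
  shows "tr (2^n) (dtpow n \<rho> b) = 0"
proof (induction n)
  case 0
  then show ?case by (simp add: tr_def)
next
  case (Suc n)
  then show ?case by (simp only: dtpow.simps tr_add tr_tens) (simp add: assms)
qed

lemma tpow_herm:
  assumes "\<And>a b. \<rho>$b$a = cnj (\<rho>$a$b)"
  shows "tpow n \<rho> j i = cnj (tpow n \<rho> i j)"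
  unfolding tpow_def cnj_prod using assms by (intro prod.cong refl) blast

lemma dtpow_herm:
  assumes "\<And>a b. \<rho>$b$a = cnj (\<rho>$a$b)" "\<And>a b. s$b$a = cnj (s$a$b)"
  shows "dtpow n \<rho> s j i = cnj (dtpow n \<rho> s i j)"
proof (induction n arbitrary: i j)
  case 0
  then show ?case by simp
next
  case (Suc n)
  have e: "\<rho> $ idx2 (j mod 2) $ idx2 (i mod 2) = cnj (\<rho> $ idx2 (i mod 2) $ idx2 (j mod 2))"
    "s $ idx2 (j mod 2) $ idx2 (i mod 2) = cnj (s $ idx2 (i mod 2) $ idx2 (j mod 2))"
    "tpow n \<rho> (j div 2) (i div 2) = cnj (tpow n \<rho> (i div 2) (j div 2))"
    "dtpow n \<rho> s (j div 2) (i div 2) = cnj (dtpow n \<rho> s (i div 2) (j div 2))"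
    using assms tpow_herm[OF assms(1)] Suc by blast+
  show ?case
    unfolding dtpow.simps tens_def complex_cnj_add complex_cnj_mult e[symmetric] by (rule refl)
qed

lemma norm_add_sq: "(norm (x + y))^2 = (norm x)^2 + (norm y)^2 + 2 * Re (x * cnj y)" for x y :: complex
  unfolding cmod_power2 by (simp add: power2_eq_square algebra_simps)

text \<open>The number Tr b rho^-1 b^* at the diagonal state \<open>rho (thz r)\<close>: for a
  combination of the \<open>sig k\<close>, the quadratic form of the RLD Fisher matrix in its
  coefficients.\<close>

definition rld_info :: "real \<Rightarrow> complex^2^2 \<Rightarrow> real" where
  "rld_info r b = (\<Sum>a\<in>UNIV. \<Sum>c\<in>UNIV. (norm (b$a$c))^2 / eigval r c)"

text \<open>Split into blocks over the first copy. Off-diagonal blocks contain only \<open>b\<close>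
  times the state of the other copies, because \<open>rho (thz r)\<close> is diagonal. In the
  diagonal blocks the cross term carries the trace of \<open>dtpow\<close>, which is zero for
  traceless \<open>b\<close>.\<close>

lemma RLD_information_tensor:
  assumes r: "\<bar>r\<bar> < 1" and b: "trace b = 0"
  shows "(\<Sum>i<2^n. \<Sum>j<2^n. (norm (dtpow n (rho (thz r)) b j i))^2 / eigprod n r i) = real n * rld_info r b"
proof (induction n)
  case 0
  then show ?case by simp
next
  case (Suc n)
  let ?\<rho> = "rho (thz r)" and ?D = "dtpow n (rho (thz r)) b" and ?N = "2^n :: nat"
  let ?S = "\<Sum>i<?N. \<Sum>j<?N. (norm (?D j i))^2 / eigprod n r i"
  have trr: "trace ?\<rho> = 1" by (simp add: trace_def sum_2 rho_thz eigval_def field_simps)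
  define T where "T x y = (\<Sum>i<?N. \<Sum>j<?N. (norm (b$x$y * tpow n ?\<rho> j i + ?\<rho>$x$y * ?D j i))^2 / (eigval r y * eigprod n r i))" for x y
  have p: "eigval r a > 0" "eigprod n r i > 0" for a i using r eigval_pos eigprod_pos by auto
  have off: "T x y = (norm (b$x$y))^2 / eigval r y" if "x \<noteq> y" for x y
  proof -
    have "T x y = (\<Sum>i<?N. \<Sum>j<?N. if j = i then (norm (b$x$y))^2 / eigval r y * eigprod n r i else 0)"
      unfolding T_def
    proof (intro sum.cong refl)
      fix i j assume "i \<in> {..<?N}" "j \<in> {..<?N}"
      then show "(norm (b$x$y * tpow n ?\<rho> j i + ?\<rho>$x$y * ?D j i))^2 / (eigval r y * eigprod n r i) =
         (if j = i then (norm (b$x$y))^2 / eigval r y * eigprod n r i else 0)"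
        using that p(1)[of y] p(2)[of i] by (auto simp: rho_thz tpow_thz_diag norm_mult power_mult_distrib power2_eq_square field_simps)
    qed
    then have "T x y = (\<Sum>i<?N. (norm (b$x$y))^2 / eigval r y * eigprod n r i)" by simp
    then show ?thesis by (simp only: sum_distrib_left[symmetric] sum_eigprod mult_1_right)
  qed
  have diag: "T x x = (norm (b$x$x))^2 / eigval r x + eigval r x * ?S" for x
  proof -
    have "T x x = (\<Sum>i<?N. \<Sum>j<?N. (if j = i then (norm (b$x$x))^2 / eigval r x * eigprod n r i + 2 * Re (b$x$x * cnj (?D i i)) else 0)
       + eigval r x * ((norm (?D j i))^2 / eigprod n r i))"
      unfolding T_def
    proof (intro sum.cong refl)
      fix i j assume "i \<in> {..<?N}" "j \<in> {..<?N}"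
      then show "(norm (b$x$x * tpow n ?\<rho> j i + ?\<rho>$x$x * ?D j i))^2 / (eigval r x * eigprod n r i) =
         (if j = i then (norm (b$x$x))^2 / eigval r x * eigprod n r i + 2 * Re (b$x$x * cnj (?D i i)) else 0)
       + eigval r x * ((norm (?D j i))^2 / eigprod n r i)"
        using p(1)[of x] p(2)[of i] unfolding norm_add_sq
        by (auto simp: rho_thz tpow_thz_diag norm_mult power_mult_distrib power2_eq_square field_simps)
    qed
    also have "\<dots> = (\<Sum>i<?N. (norm (b$x$x))^2 / eigval r x * eigprod n r i) + (\<Sum>i<?N. 2 * Re (b$x$x * cnj (?D i i))) + eigval r x * ?S"
      by (simp add: sum.distrib sum_distrib_left)
    also have "(\<Sum>i<?N. 2 * Re (b$x$x * cnj (?D i i))) = 2 * Re (b$x$x * cnj (tr ?N ?D))"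
      unfolding tr_def cnj_sum sum_distrib_left Re_sum by simp
    finally show ?thesis by (simp only: tr_dtpow[OF b trr] sum_distrib_left[symmetric] sum_eigprod) simp
  qed
  have "(\<Sum>i<2^Suc n. \<Sum>j<2^Suc n. (norm (dtpow (Suc n) ?\<rho> b j i))^2 / eigprod (Suc n) r i) = T 1 1 + T 1 2 + T 2 1 + T 2 2"
    unfolding sum_pow2_Suc T_def by (simp add: tens_def sum.distrib)
  also have "\<dots> = rld_info r b + (eigval r 1 + eigval r 2) * ?S"
    using diag[of 1] diag[of 2] off[of 1 2] off[of 2 1] by (simp add: rld_info_def sum_2 algebra_simps)
  finally show ?case using Suc by (simp add: eigval_def field_simps)
qed

text \<open>Cholesky factorization, with \<open>d\<close> the Schur complement. It makes every state
  of the open Bloch ball positive, so the outcome measures are genuine also off the base point,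
  where the mean is differentiated.\<close>

lemma Theta_rho_factor:
  assumes "\<theta> \<in> Theta"
  obtains B where "rho \<theta> = B ** cadj B"
proof -
  have n: "(\<theta>$1)^2 + (\<theta>$2)^2 + (\<theta>$3)^2 < 1"
  proof -
    have "(norm \<theta>)^2 < 1" using assms by (simp add: Theta_def abs_square_less_1)
    then show ?thesis by (simp add: norm_vec_def L2_set_def sum_3 sum_nonneg)
  qed
  then have "(\<theta>$3)^2 < 1" using zero_le_power2[of "\<theta>$1"] zero_le_power2[of "\<theta>$2"] by linarith
  then have "\<bar>\<theta>$3\<bar> < 1" by (simp add: abs_square_less_1)
  define p where "p = (1 + \<theta>$3)/2"
  have p: "p > 0" using \<open>\<bar>\<theta>$3\<bar> < 1\<close> by (simp add: p_def)
  define q where "q = Complex (\<theta>$1/2) (\<theta>$2/2)"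
  define d where "d = (1 - \<theta>$3)/2 - (norm q)^2 / p"
  have qn: "(norm q)^2 = ((\<theta>$1)^2 + (\<theta>$2)^2)/4"
    by (simp add: q_def cmod_power2 power_divide add_divide_distrib)
  have "p * d = (1 - (\<theta>$3)^2)/4 - (norm q)^2"
    using p by (simp add: d_def field_simps) (simp add: p_def power2_eq_square field_simps)
  then have "0 \<le> p * d" using n unfolding qn by simp
  then have d: "0 \<le> d" using p by (simp add: zero_le_mult_iff)
  define B :: "complex^2^2" where "B = (\<chi> a b. if a = 1 \<and> b = 1 then of_real (sqrt p) else if a = 2 \<and> b = 1 then q / of_real (sqrt p)
     else if a = 2 \<and> b = 2 then of_real (sqrt d) else 0)"
  have sp: "complex_of_real (sqrt p) * of_real (sqrt p) = of_real p" "complex_of_real (sqrt d) * of_real (sqrt d) = of_real d"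
    using p d by (simp_all add: of_real_mult[symmetric] del: of_real_mult)
  have sp0: "complex_of_real (sqrt p) \<noteq> 0" using p by simp
  have qq: "q * cnj q / of_real p + of_real d = of_real ((1 - \<theta>$3)/2)"
    unfolding d_def using complex_norm_square[of q] by simp
  have B: "B$1$1 = of_real (sqrt p)" "B$1$2 = 0" "B$2$1 = q / of_real (sqrt p)" "B$2$2 = of_real (sqrt d)"
    by (simp_all add: B_def)
  have R: "rho \<theta> $ 1 $ 1 = of_real p" "rho \<theta> $ 1 $ 2 = cnj q" "rho \<theta> $ 2 $ 1 = q" "rho \<theta> $ 2 $ 2 = of_real ((1 - \<theta>$3)/2)"
    by (simp_all add: rho_def sum_3 sig_entries p_def q_def complex_eq_iff field_simps)
  have "rho \<theta> $ a $ b = (B ** cadj B) $ a $ b" for a b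
  proof -
    have "\<forall>a b. rho \<theta> $ a $ b = (B ** cadj B) $ a $ b"
      unfolding forall_2 R matrix_matrix_mult_def cadj_def sum_2 vec_lambda_beta B
      using qq sp sp0 by (simp add: field_simps)
    then show ?thesis by blast
  qed
  then have "rho \<theta> = B ** cadj B" by (simp add: vec_eq_iff)
  then show ?thesis by (rule that)
qed

lemma gram_tpow:
  assumes "\<theta> \<in> Theta" shows "gram (2^n) (tpow n (rho \<theta>))"
proof -
  obtain B where "rho \<theta> = B ** cadj B" using Theta_rho_factor[OF assms] .
  then have "tpow n (rho \<theta>) = mm (2^n) (tpow n B) (adj (tpow n B))"
    by (simp add: mm_tpow adj_tpow)
  then show ?thesis unfolding gram_def
    by (intro exI[of _ "2^n"] exI[of _ "\<lambda>l i. tpow n B i l"]) (simp add: mm_def adj_def)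
qed

lemma open_Theta: "open Theta"
proof -
  have "Theta = ball 0 1" by (auto simp: Theta_def)
  then show ?thesis using open_ball by metis
qed

lemma thz_Theta: "\<bar>r\<bar> < 1 \<Longrightarrow> thz r \<in> Theta"
proof -
  have "thz r = r *\<^sub>R axis 3 1" by (simp add: thz_def vec_eq_iff axis_def)
  then show "\<bar>r\<bar> < 1 \<Longrightarrow> thz r \<in> Theta" by (simp add: Theta_def)
qed


text \<open>The maximiser of the left-hand side of \<open>opt_dir_value\<close> below: in the coordinates
\<open>v 1 - \<i> v 2\<close>, \<open>v 1 + \<i> v 2\<close>, \<open>v 3\<close> the information term is diagonal.\<close>

definition opt_dir :: "real \<Rightarrow> (3 \<Rightarrow> complex) \<Rightarrow> 3 \<Rightarrow> complex" where
  "opt_dir r w k =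
     (let a = of_real (1 - r) * cnj (w 1 + \<i> * w 2); c = of_real (1 + r) * cnj (w 1 - \<i> * w 2) in
      if k = 1 then (a + c) / 2 else if k = 2 then \<i> * (a - c) / 2 else of_real (1 - r^2) * cnj (w 3))"

definition dir_mat :: "(3 \<Rightarrow> complex) \<Rightarrow> complex^2^2" where
  "dir_mat v = (\<chi> a c. \<Sum>k\<in>UNIV. v k * sig k $ a $ c)"

lemma dir_mat_entries:
  "dir_mat v $ 1 $ 1 = v 3 / 2" "dir_mat v $ 1 $ 2 = (v 1 - \<i> * v 2) / 2"
  "dir_mat v $ 2 $ 1 = (v 1 + \<i> * v 2) / 2" "dir_mat v $ 2 $ 2 = - v 3 / 2"
  by (simp_all add: dir_mat_def sum_3 sig_entries field_simps)

lemma trace_dir_mat: "trace (dir_mat v) = 0"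
  by (simp add: trace_def sum_2 dir_mat_entries)

text \<open>A linear term minus a positive quadratic form has the dual form as its maximum: the
  right-hand side is w^* W w with W the matrix in \<open>RLD_inv\<close>. For complex w the
  imaginary part of W contributes.\<close>

lemma opt_dir_value:
  assumes r: "0 \<le> r" "r < 1"
  shows "2 * Re (\<Sum>k\<in>UNIV. w k * opt_dir r w k) - rld_info r (dir_mat (opt_dir r w)) =
     (1 - r)/2 * (norm (w 1 + \<i> * w 2))^2 + (1 + r)/2 * (norm (w 1 - \<i> * w 2))^2 + (1 - r^2) * (norm (w 3))^2"
proof -
  define P where "P = w 1 + \<i> * w 2"
  define Q where "Q = w 1 - \<i> * w 2"
  let ?v = "opt_dir r w"
  have v: "?v 1 = (of_real (1 - r) * cnj P + of_real (1 + r) * cnj Q) / 2"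
    "?v 2 = \<i> * (of_real (1 - r) * cnj P - of_real (1 + r) * cnj Q) / 2"
    "?v 3 = of_real (1 - r^2) * cnj (w 3)"
    by (simp_all add: opt_dir_def P_def Q_def Let_def)
  have a: "?v 1 - \<i> * ?v 2 = of_real (1 - r) * cnj P" "?v 1 + \<i> * ?v 2 = of_real (1 + r) * cnj Q"
    by (simp_all only: v) (simp_all add: field_simps)
  have w: "w 1 = (P + Q) / 2" "w 2 = (P - Q) / (2 * \<i>)" by (simp_all add: P_def Q_def)
  have "(\<Sum>k\<in>UNIV. w k * ?v k) = (of_real (1 - r) * (P * cnj P) + of_real (1 + r) * (Q * cnj Q)) / 2 + of_real (1 - r^2) * (w 3 * cnj (w 3))"
    unfolding sum_3 v unfolding w by (simp add: field_simps)
  also have "\<dots> = of_real (((1 - r) * (norm P)^2 + (1 + r) * (norm Q)^2) / 2 + (1 - r^2) * (norm (w 3))^2)"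
    by (simp add: complex_norm_square[symmetric] del: of_real_power)
  finally have 1: "Re (\<Sum>k\<in>UNIV. w k * ?v k) = ((1 - r) * (norm P)^2 + (1 + r) * (norm Q)^2) / 2 + (1 - r^2) * (norm (w 3))^2"
    by (metis Re_complex_of_real)
  have p: "eigval r 1 = (1 + r)/2" "eigval r 2 = (1 - r)/2" by (simp_all add: eigval_def)
  have r2: "1 - r^2 = (1 - r) * (1 + r)" by (simp add: power2_eq_square algebra_simps)
  have n: "(norm (of_real c * z :: complex))^2 = c^2 * (norm z)^2" for c z
    by (simp add: norm_mult power_mult_distrib)
  have "rld_info r (dir_mat ?v) = (norm (?v 3))^2 / 4 * (1 / eigval r 1 + 1 / eigval r 2)
     + (norm (?v 1 - \<i> * ?v 2))^2 / 4 / eigval r 2 + (norm (?v 1 + \<i> * ?v 2))^2 / 4 / eigval r 1"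
    by (simp add: rld_info_def sum_2 dir_mat_entries norm_divide power_divide field_simps)
  also have "\<dots> = (1 - r)/2 * (norm P)^2 + (1 + r)/2 * (norm Q)^2 + (1 - r^2) * (norm (w 3))^2"
  proof -
    have c: "c^2 * A / 4 * (4 / c) = c * A" "c^2 * A / 4 / (c/2) = c/2 * A" if "c \<noteq> 0" for c A :: real
      using that by (simp_all add: power2_eq_square)
    have "(1 - r) * (1 + r) \<noteq> 0" "1 - r \<noteq> 0" "1 + r \<noteq> 0" using r by auto
    note t = c(1)[OF this(1)] c(2)[OF this(2)] c(2)[OF this(3)]
    have "1 / eigval r 1 + 1 / eigval r 2 = 4 / ((1 - r) * (1 + r))"
      unfolding p using r by (simp add: field_simps)
    then show ?thesis unfolding a v(3) n complex_mod_cnj r2 by (simp only: p t)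
  qed
  finally show ?thesis unfolding 1 P_def[symmetric] Q_def[symmetric] by (simp add: field_simps)
qed

context
  fixes n :: nat and M :: "(real^3) set \<Rightarrow> cmat" and r :: real
  assumes povm: "is_povm (2^n) M" and r: "0 \<le> r" "r < 1"
    and sq: "\<And>j. integrable (Pn n M (thz r)) (\<lambda>x. (x$j - thz r$j)^2)"
begin

lemma sq_tau: "integrable (tau (2^n) M) (\<lambda>x. (x$j - thz r$j)^2)"
  using r sq unfolding Pn_def
  by (intro integrable_tau_of_diag[OF povm, where Z="tpow n (rho (thz r))" and p="eigprod n r"] eigprod_pos tpow_thz_diag) auto

lemma lin_tau: "integrable (tau (2^n) M) (\<lambda>x. x$j - thz r$j)" "integrable (tau (2^n) M) (\<lambda>x. x$j)"
proof -
  interpret finite_measure "tau (2^n) M" by (rule finite_measure_outcome[OF povm gram_idmat])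
  have m: "(\<lambda>x::real^3. x$j - thz r$j) \<in> borel_measurable (tau (2^n) M)"
    by (simp add: measurable_cong_sets[OF sets_outcome refl])
  show 1: "integrable (tau (2^n) M) (\<lambda>x. x$j - thz r$j)"
  proof (rule Bochner_Integration.integrable_bound[OF _ m])
    show "integrable (tau (2^n) M) (\<lambda>x. 1 + (x$j - thz r$j)^2)" using sq_tau by simp
    have "\<bar>t\<bar> \<le> 1 + t^2" for t :: real
      using zero_le_power2[of "t - 1"] zero_le_power2[of "t + 1"] by (simp add: power2_eq_square algebra_simps abs_le_iff)
    then show "AE x in tau (2^n) M. norm (x$j - thz r$j) \<le> norm (1 + (x$j - thz r$j)^2)" by simp
  qed
  have "integrable (tau (2^n) M) (\<lambda>x. (x$j - thz r$j) + thz r$j)"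
    by (rule Bochner_Integration.integrable_add[OF 1]) simp
  then show "integrable (tau (2^n) M) (\<lambda>x. x$j)" by simp
qed

lemma prod_tau: "integrable (tau (2^n) M) (\<lambda>x. (x$j - thz r$j) * (x$k - thz r$k))"
proof (rule Bochner_Integration.integrable_bound)
  show "integrable (tau (2^n) M) (\<lambda>x. (x$j - thz r$j)^2 + (x$k - thz r$k)^2)" using sq_tau by simp
  show "(\<lambda>x. (x$j - thz r$j) * (x$k - thz r$k)) \<in> borel_measurable (tau (2^n) M)"
    by (simp add: measurable_cong_sets[OF sets_outcome refl])
  have "\<bar>s * t\<bar> \<le> s^2 + t^2" for s t :: real
  proof -
    have "2 * (\<bar>s\<bar> * \<bar>t\<bar>) \<le> s^2 + t^2"
      using zero_le_power2[of "\<bar>s\<bar> - \<bar>t\<bar>"] by (simp add: power2_diff)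
    moreover have "0 \<le> \<bar>s\<bar> * \<bar>t\<bar>" by simp
    ultimately show ?thesis unfolding abs_mult by linarith
  qed
  then show "AE x in tau (2^n) M. norm ((x$j - thz r$j) * (x$k - thz r$k)) \<le> norm ((x$j - thz r$j)^2 + (x$k - thz r$k)^2)"
    by simp
qed

lemma Emean_eq:
  assumes "\<theta> \<in> Theta"
  shows "Emean n M \<theta> $ j = Re (\<Sum>i<2^n. \<Sum>l<2^n. Xmat (2^n) M (\<lambda>x. x$j) i l * tpow n (rho \<theta>) l i)"
  using integral_outcome_Xmat[OF povm gram_tpow[OF assms] lin_tau(2)]
  by (simp add: Emean_def Pn_def mtr_def)

text \<open>Close to \<open>thz r\<close> the line stays in the open ball, where the mean is the
  trace of one fixed operator with \<open>tpow\<close>. Only \<open>tpow\<close> is differentiated,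
  never an integral.\<close>

lemma Amat_eq:
  "Amat n M (thz r) $ j $ k = Re (\<Sum>i<2^n. \<Sum>l<2^n. Xmat (2^n) M (\<lambda>x. x$j) i l * dtpow n (rho (thz r)) (sig k) l i)"
    (is "_ = ?R")
proof -
  let ?L = "\<lambda>t. thz r + t *\<^sub>R axis k 1"
  let ?E = "\<lambda>t. Re (\<Sum>i<2^n. \<Sum>l<2^n. Xmat (2^n) M (\<lambda>x. x$j) i l * tpow n (rho (thz r) + t *\<^sub>R sig k) l i)"
  have th: "thz r \<in> Theta" using r by (intro thz_Theta) auto
  have "continuous_on UNIV ?L" by (intro continuous_intros)
  then have "open (?L -` Theta)" using open_Theta by (rule open_vimage[rotated])
  moreover have "0 \<in> ?L -` Theta" using th by simp
  moreover have "?E t = Emean n M (?L t) $ j" if "t \<in> ?L -` Theta" for t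
    using that Emean_eq[of "?L t" j] by (simp add: rho_line)
  moreover have "(?E has_vector_derivative ?R) (at 0)"
    by (intro bounded_linear.has_vector_derivative[OF bounded_linear_Re] has_vector_derivative_sum
       bounded_linear.has_vector_derivative[OF bounded_linear_mult_right] has_vector_derivative_tpow)
  ultimately have "((\<lambda>t. Emean n M (?L t) $ j) has_vector_derivative ?R) (at 0)"
    by (rule has_vector_derivative_transform_within_open[rotated])
  then show ?thesis by (simp add: Amat_def vector_derivative_at)
qed

lemma rho_herm: "rho \<theta> $ b $ a = cnj (rho \<theta> $ a $ b)"
proof -
  have "\<forall>a b. rho \<theta> $ b $ a = cnj (rho \<theta> $ a $ b)"
    by (simp add: forall_2 rho_def sum_3 sig_entries complex_eq_iff)
  then show ?thesis by blast
qed

lemma sig_herm: "sig k $ b $ a = cnj (sig k $ a $ b)"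
proof -
  have "\<forall>k a b. sig k $ b $ a = cnj (sig k $ a $ b)"
    by (simp add: forall_2 forall_3 sig_entries)
  then show ?thesis by blast
qed

text \<open>The lower bound multiplies this trace by complex coefficients, so the real part in
  \<open>Amat_eq\<close> has to be removed: the trace of a product of two Hermitian matrices is
  real.\<close>

lemma Amat_eq_complex:
  "of_real (Amat n M (thz r) $ j $ k) = (\<Sum>i<2^n. \<Sum>l<2^n. Xmat (2^n) M (\<lambda>x. x$j) i l * dtpow n (rho (thz r)) (sig k) l i)"
    (is "_ = ?S")
proof -
  let ?X = "Xmat (2^n) M (\<lambda>x. x$j)" and ?D = "dtpow n (rho (thz r)) (sig k)"
  have "cnj ?S = (\<Sum>i<2^n. \<Sum>l<2^n. ?X l i * ?D i l)"
    unfolding cnj_sum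
  proof (intro sum.cong refl)
    fix i l assume "i \<in> {..<2^n::nat}" "l \<in> {..<2^n::nat}"
    then show "cnj (?X i l * ?D l i) = ?X l i * ?D i l"
      using Xmat_herm[OF povm lin_tau(2), of i l j] dtpow_herm[of "rho (thz r)" "sig k" n i l, OF rho_herm sig_herm] by simp
  qed
  also have "\<dots> = ?S" by (rule sum.swap)
  finally have "?S \<in> \<real>" by (simp only: Reals_cnj_iff)
  then show ?thesis unfolding Amat_eq by (rule of_real_Re)
qed

text \<open>The identity part of the centred error drops out because the derivative of the state is
  traceless; what remains of the linear term is the derivative matrix of the mean.\<close>

lemma functional_bound:
  assumes n: "n > 0"
  shows "real n * integral\<^sup>L (Pn n M (thz r)) (\<lambda>x. (norm (\<Sum>j\<in>UNIV. w j * of_real (x$j - thz r$j)))^2) \<ge>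
    2 * Re (\<Sum>j\<in>UNIV. \<Sum>k\<in>UNIV. w j * v k * of_real (Amat n M (thz r) $ j $ k)) - rld_info r (dir_mat v)"
proof -
  let ?d = "2^n :: nat" and ?\<rho> = "rho (thz r)"
  define g where "g x = (\<Sum>j\<in>UNIV. w j * of_real (x$j - thz r$j))" for x :: "real^3"
  let ?D = "dtpow n ?\<rho> (dir_mat v)"
  let ?X = "\<lambda>j. Xmat ?d M (\<lambda>x. x$j)" and ?C = "Xc ?d M g" and ?S = "\<lambda>k. dtpow n ?\<rho> (sig k)"
  \<comment> \<open>The information of n copies is n times \<open>rld_info\<close>. Dividing the
    direction by n makes both terms of order 1/n, matching the factor n on the left.\<close>
  let ?B = "\<lambda>i j. ?D i j / of_nat n"
  interpret T: finite_measure "tau ?d M" by (rule finite_measure_outcome[OF povm gram_idmat])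
  have g: "g \<in> borel_measurable borel" unfolding g_def by measurable
  have gsq: "(norm (g x))^2 = (\<Sum>j\<in>UNIV. \<Sum>k\<in>UNIV. Re (w j * cnj (w k)) * ((x$j - thz r$j) * (x$k - thz r$k)))" for x
  proof -
    have "of_real ((norm (g x))^2) = g x * cnj (g x)" by (rule complex_norm_square)
    also have "\<dots> = (\<Sum>j\<in>UNIV. \<Sum>k\<in>UNIV. (w j * cnj (w k)) * of_real ((x$j - thz r$j) * (x$k - thz r$k)))"
      unfolding g_def cnj_sum sum_product by (intro sum.cong refl) (simp add: mult_ac)
    finally have "Re (of_real ((norm (g x))^2)) = Re (\<Sum>j\<in>UNIV. \<Sum>k\<in>UNIV. (w j * cnj (w k)) * of_real ((x$j - thz r$j) * (x$k - thz r$k)))"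
      by (rule arg_cong)
    then show ?thesis unfolding Re_sum by simp
  qed
  have grm: "gram ?d (tpow n ?\<rho>)" using r by (intro gram_tpow thz_Theta) auto
  have g2: "integrable (outcome_dist ?d M (tpow n ?\<rho>)) (\<lambda>x. (norm (g x))^2)"
    unfolding gsq by (intro integrable_tau[OF povm grm] Bochner_Integration.integrable_sum integrable_mult_right prod_tau)
  have X: "?C i l = (\<Sum>j\<in>UNIV. w j * (?X j i l - of_real (thz r$j) * (if i = l then 1 else 0)))"
    if "i < ?d" "l < ?d" for i l
  proof -
    have 1: "Xmat ?d M (\<lambda>x. x$j - thz r$j) i l = ?X j i l - of_real (thz r$j) * (if i = l then 1 else 0)" for j
    proof -
      have "Xmat ?d M (\<lambda>x. x$j + (- thz r$j) * 1) i l = ?X j i l + of_real (- thz r$j) * Xmat ?d M (\<lambda>x. 1) i l"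
        using Xmat_add[OF povm lin_tau(2)[of j], of "\<lambda>x. (- thz r$j) * 1" i l] Xmat_scale[OF povm, of "\<lambda>x. 1" "- thz r$j" i l]
        by simp
      then show ?thesis using Xmat_one[OF povm that] by simp
    qed
    have 2: "Xmat ?d M (\<lambda>x. \<Sum>j\<in>UNIV. c j * (x$j - thz r$j)) i l = (\<Sum>j\<in>UNIV. of_real (c j) * Xmat ?d M (\<lambda>x. x$j - thz r$j) i l)" for c :: "3 \<Rightarrow> real"
      using Xmat_sum[OF povm, of "UNIV::3 set" "\<lambda>j x. c j * (x$j - thz r$j)" i l] Xmat_scale[OF povm lin_tau(1)] lin_tau(1)
      by simp
    have "?C i l = Xmat ?d M (\<lambda>x. \<Sum>j\<in>UNIV. Re (w j) * (x$j - thz r$j)) i l + \<i> * Xmat ?d M (\<lambda>x. \<Sum>j\<in>UNIV. Im (w j) * (x$j - thz r$j)) i l"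
      unfolding Xc_def[OF povm] g_def Re_sum Im_sum by simp
    also have "\<dots> = (\<Sum>j\<in>UNIV. (of_real (Re (w j)) + \<i> * of_real (Im (w j))) * Xmat ?d M (\<lambda>x. x$j - thz r$j) i l)"
      unfolding 2 by (simp add: sum.distrib sum_distrib_left algebra_simps)
    finally show ?thesis by (simp only: complex_eq[symmetric] 1)
  qed
  have trr: "trace ?\<rho> = 1" by (simp add: trace_def sum_2 rho_thz eigval_def field_simps)
  have "(\<Sum>i<?d. \<Sum>l<?d. ?C i l * ?D l i) =
     (\<Sum>i<?d. \<Sum>l<?d. \<Sum>j\<in>UNIV. w j * (?X j i l * ?D l i) - (if i = l then w j * of_real (thz r$j) * ?D i i else 0))"
  proof (intro sum.cong refl)
    fix i l assume "i \<in> {..<?d}" "l \<in> {..<?d}"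
    then have il: "i < ?d" "l < ?d" by simp_all
    show "?C i l * ?D l i = (\<Sum>j\<in>UNIV. w j * (?X j i l * ?D l i) - (if i = l then w j * of_real (thz r$j) * ?D i i else 0))"
      unfolding X[OF il] sum_distrib_right by (intro sum.cong refl) (auto simp: left_diff_distrib right_diff_distrib mult.assoc)
  qed
  also have "\<dots> = (\<Sum>j\<in>UNIV. \<Sum>i<?d. \<Sum>l<?d. w j * (?X j i l * ?D l i) - (if i = l then w j * of_real (thz r$j) * ?D i i else 0))"
    by (subst (2) sum.swap, subst sum.swap) (rule refl)
  also have "\<dots> = (\<Sum>j\<in>UNIV. w j * (\<Sum>i<?d. \<Sum>l<?d. ?X j i l * ?D l i) - w j * of_real (thz r$j) * tr ?d ?D)"
    by (intro sum.cong refl) (simp add: sum_subtractf sum_distrib_left tr_def)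
  also have "\<dots> = (\<Sum>j\<in>UNIV. w j * (\<Sum>i<?d. \<Sum>l<?d. \<Sum>k\<in>UNIV. v k * (?X j i l * ?S k l i)))"
    unfolding tr_dtpow[OF trace_dir_mat trr] unfolding dir_mat_def dtpow_sum by (simp add: sum_distrib_left mult_ac)
  also have "\<dots> = (\<Sum>j\<in>UNIV. w j * (\<Sum>k\<in>UNIV. \<Sum>i<?d. \<Sum>l<?d. v k * (?X j i l * ?S k l i)))"
    by (subst (2) sum.swap, subst sum.swap) (rule refl)
  also have "\<dots> = (\<Sum>j\<in>UNIV. \<Sum>k\<in>UNIV. w j * v k * of_real (Amat n M (thz r) $ j $ k))"
    unfolding Amat_eq_complex by (simp add: sum_distrib_left mult.assoc)
  finally have C: "(\<Sum>i<?d. \<Sum>l<?d. ?C i l * ?D l i) = (\<Sum>j\<in>UNIV. \<Sum>k\<in>UNIV. w j * v k * of_real (Amat n M (thz r) $ j $ k))" .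
  have "integral\<^sup>L (outcome_dist ?d M (tpow n ?\<rho>)) (\<lambda>x. (norm (g x))^2) \<ge>
     2 * Re (\<Sum>i<?d. \<Sum>j<?d. ?C i j * ?B j i) - (\<Sum>i<?d. \<Sum>j<?d. (norm (?B j i))^2 / eigprod n r i)"
    using r by (intro povm_second_moment_ge[OF povm g g2] eigprod_pos tpow_thz_diag) auto
  also have "(\<Sum>i<?d. \<Sum>j<?d. ?C i j * ?B j i) = (\<Sum>i<?d. \<Sum>l<?d. ?C i l * ?D l i) / of_nat n"
    by (simp add: sum_divide_distrib)
  also have "(\<Sum>i<?d. \<Sum>j<?d. (norm (?B j i))^2 / eigprod n r i) = (\<Sum>i<?d. \<Sum>j<?d. (norm (?D j i))^2 / eigprod n r i) / (real n)^2"
    by (simp add: sum_divide_distrib norm_divide power_divide mult.commute)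
  also have "(\<Sum>i<?d. \<Sum>j<?d. (norm (?D j i))^2 / eigprod n r i) = real n * rld_info r (dir_mat v)"
    using r by (intro RLD_information_tensor trace_dir_mat) auto
  finally have "real n * integral\<^sup>L (outcome_dist ?d M (tpow n ?\<rho>)) (\<lambda>x. (norm (g x))^2) \<ge>
      real n * (2 * Re ((\<Sum>i<?d. \<Sum>l<?d. ?C i l * ?D l i) / of_nat n) - real n * rld_info r (dir_mat v) / (real n)^2)"
    by (intro mult_left_mono) auto
  moreover have "Re (z / of_nat n) = Re z / real n" for z
    by (simp add: Re_divide_of_nat)
  ultimately show ?thesis unfolding C using n
    by (simp add: Pn_def g_def right_diff_distrib power2_eq_square)
qed

end

subsection \<open>The lower bound\<close>

text \<open>Cholesky factorization of G into three real linear forms. The first two are merged into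
  one complex form, whose phase gives the product of \<open>\<alpha>\<close> and
  \<open>\<gamma>\<close>; the third contributes the Schur complement \<open>s\<close>.\<close>

lemma posdef_complex_square:
  fixes G :: "real^3^3"
  assumes sym: "transpose G = G" and pos: "\<forall>x. x \<noteq> 0 \<longrightarrow> 0 < x \<bullet> (G *v x)"
  obtains \<alpha> \<beta> \<gamma> s :: real and \<delta> :: complex where
    "\<And>y::real^3. (\<Sum>j\<in>UNIV. \<Sum>k\<in>UNIV. G$j$k * (y$j * y$k)) =
       (norm (of_real \<alpha> * of_real (y$1) + Complex \<beta> \<gamma> * of_real (y$2) + \<delta> * of_real (y$3)))^2 + s * (y$3)^2"
    "0 \<le> s" "\<alpha>^2 = G$1$1" "\<beta>^2 + \<gamma>^2 = G$2$2" "(norm \<delta>)^2 + s = G$3$3"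
    "\<alpha> * \<gamma> = sqrt (G$1$1 * G$2$2 - (G$1$2)^2)"
proof -
  note g = posdef_minors[OF sym pos]
  let ?det = "G$1$1 * G$2$2 - (G$1$2)^2"
  define \<alpha> where "\<alpha> = sqrt (G$1$1)"
  define \<beta> where "\<beta> = G$1$2 / \<alpha>"
  define \<gamma> where "\<gamma> = sqrt ?det / \<alpha>"
  define d1 where "d1 = G$1$3 / \<alpha>"
  define d2 where "d2 = (G$2$3 - \<beta> * d1) / \<gamma>"
  define s where "s = G$3$3 - d1^2 - d2^2"
  have a: "\<alpha> > 0" "\<alpha>^2 = G$1$1" using g(1) by (simp_all add: \<alpha>_def)
  have c: "\<gamma> > 0" "\<alpha> * \<gamma> = sqrt ?det" using g(5) a by (simp_all add: \<gamma>_def)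
  have e12: "\<alpha> * \<beta> = G$1$2" and e13: "\<alpha> * d1 = G$1$3" and e23: "\<beta> * d1 + \<gamma> * d2 = G$2$3"
    using a c by (simp_all add: \<beta>_def d1_def d2_def)
  have "\<alpha>^2 * (\<beta>^2 + \<gamma>^2) = (\<alpha> * \<beta>)^2 + (\<alpha> * \<gamma>)^2" by (simp add: power_mult_distrib algebra_simps)
  also have "\<dots> = \<alpha>^2 * G$2$2" unfolding e12 c(2) using g(5) a(2) by simp
  finally have e22: "\<beta>^2 + \<gamma>^2 = G$2$2" using a g(1) by simp
  have id: "(\<Sum>j\<in>UNIV. \<Sum>k\<in>UNIV. G$j$k * (y$j * y$k)) =
       (norm (of_real \<alpha> * of_real (y$1) + Complex \<beta> \<gamma> * of_real (y$2) + Complex d1 d2 * of_real (y$3)))^2 + s * (y$3)^2" for y :: "real^3"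
  proof -
    have "(norm (of_real \<alpha> * of_real (y$1) + Complex \<beta> \<gamma> * of_real (y$2) + Complex d1 d2 * of_real (y$3)))^2
      = (\<alpha> * y$1 + \<beta> * y$2 + d1 * y$3)^2 + (\<gamma> * y$2 + d2 * y$3)^2"
      unfolding cmod_power2 by simp
    also have "\<dots> = \<alpha>^2 * (y$1)^2 + (\<beta>^2 + \<gamma>^2) * (y$2)^2 + (d1^2 + d2^2) * (y$3)^2
       + 2 * (\<alpha> * \<beta>) * (y$1 * y$2) + 2 * (\<alpha> * d1) * (y$1 * y$3) + 2 * (\<beta> * d1 + \<gamma> * d2) * (y$2 * y$3)"
      by (simp add: power2_eq_square algebra_simps)
    also have "\<dots> = (\<Sum>j\<in>UNIV. \<Sum>k\<in>UNIV. G$j$k * (y$j * y$k)) - s * (y$3)^2"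
      unfolding e12 e13 e23 e22 a(2) by (simp add: sum_3 g(2,3,4) s_def power2_eq_square algebra_simps)
    finally show ?thesis by simp
  qed
  have "0 \<le> s"
  proof -
    \<comment> \<open>The zero of the complex form with third coordinate 1, where the quadratic form
      of G equals \<open>s\<close>.\<close>
    define y :: "real^3" where "y = vector [- (\<beta> * (- d2 / \<gamma>) + d1) / \<alpha>, - d2 / \<gamma>, 1]"
    have y: "y$1 = - (\<beta> * (- d2 / \<gamma>) + d1) / \<alpha>" "y$2 = - d2 / \<gamma>" "y$3 = 1" by (simp_all add: y_def)
    have z: "of_real \<alpha> * of_real (y$1) + Complex \<beta> \<gamma> * of_real (y$2) + Complex d1 d2 * of_real (y$3) = 0"
      unfolding y using a c by (simp add: complex_eq_iff)
    have "y \<noteq> 0" using y(3) by auto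
    then have "0 < y \<bullet> (G *v y)" using pos by blast
    also have "y \<bullet> (G *v y) = (\<Sum>j\<in>UNIV. \<Sum>k\<in>UNIV. G$j$k * (y$j * y$k))"
      by (simp add: inner_vec_def matrix_vector_mult_def sum_distrib_left mult_ac)
    also have "\<dots> = s" unfolding id z by (simp add: y)
    finally show ?thesis by simp
  qed
  moreover have "(norm (Complex d1 d2))^2 + s = G$3$3" by (simp add: cmod_power2 s_def)
  ultimately show thesis using that[of \<alpha> \<beta> \<gamma> "Complex d1 d2" s] id a(2) e22 c(2) by blast
qed

theorem RLD_lower_bound:
  fixes G :: "real^3^3"
  assumes r: "0 \<le> r" "r < 1" and sym: "transpose G = G" and pos: "\<forall>x. x \<noteq> 0 \<longrightarrow> 0 < x \<bullet> (G *v x)"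
    and unb: "asym_unbiased (thz r) Ms"
  shows "ereal (RLD_value r G)
     \<le> liminf (\<lambda>n. nTrGV n G (Ms n) (thz r))"
proof -
  note g = posdef_minors[OF sym pos]
  obtain \<alpha> \<beta> \<gamma> s :: real and \<delta> :: complex where
    id: "\<And>y::real^3. (\<Sum>j\<in>UNIV. \<Sum>k\<in>UNIV. G$j$k * (y$j * y$k)) =
       (norm (of_real \<alpha> * of_real (y$1) + Complex \<beta> \<gamma> * of_real (y$2) + \<delta> * of_real (y$3)))^2 + s * (y$3)^2"
    and s: "0 \<le> s" and a: "\<alpha>^2 = G$1$1" and bc: "\<beta>^2 + \<gamma>^2 = G$2$2" and d: "(norm \<delta>)^2 + s = G$3$3"
    and ac: "\<alpha> * \<gamma> = sqrt (G$1$1 * G$2$2 - (G$1$2)^2)"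
    by (rule posdef_complex_square[OF sym pos]) blast
  define w1 :: "3 \<Rightarrow> complex" where "w1 = (\<lambda>k. if k = 1 then of_real \<alpha> else if k = 2 then Complex \<beta> \<gamma> else \<delta>)"
  define w2 :: "3 \<Rightarrow> complex" where "w2 = (\<lambda>k. if k = 3 then of_real (sqrt s) else 0)"
  \<comment> \<open>The direction is optimal for the limiting derivative matrix \<open>mat 1\<close>
    and does not depend on n, so \<open>F w\<close> converges to the optimal value.\<close>
  define F where "F w n = 2 * Re (\<Sum>j\<in>UNIV. \<Sum>k\<in>UNIV. w j * opt_dir r w k * of_real (Amat n (Ms n) (thz r) $ j $ k)) - rld_info r (dir_mat (opt_dir r w))" for w n
  let ?b = "RLD_value r G"
  have povm: "is_povm (2^n) (Ms n)" for n using unb by (simp add: asym_unbiased_def)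
  have A: "(\<lambda>n. Amat n (Ms n) (thz r)) \<longlonglongrightarrow> mat 1" using unb by (simp add: asym_unbiased_def)
  have Flim: "F w \<longlonglongrightarrow> 2 * Re (\<Sum>k\<in>UNIV. w k * opt_dir r w k) - rld_info r (dir_mat (opt_dir r w))" for w
  proof -
    have "(\<lambda>n. F w n) \<longlonglongrightarrow> 2 * Re (\<Sum>j\<in>UNIV. \<Sum>k\<in>UNIV. w j * opt_dir r w k * of_real (mat 1 $ j $ k)) - rld_info r (dir_mat (opt_dir r w))"
      unfolding F_def by (intro tendsto_intros tendsto_vec_nth A)
    moreover have "(\<Sum>j\<in>UNIV. \<Sum>k\<in>UNIV. w j * opt_dir r w k * of_real (mat 1 $ j $ k)) = (\<Sum>k\<in>UNIV. w k * opt_dir r w k)"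
      by (simp add: sum_3 mat_def)
    ultimately show ?thesis by simp
  qed
  have v1: "2 * Re (\<Sum>k\<in>UNIV. w1 k * opt_dir r w1 k) - rld_info r (dir_mat (opt_dir r w1)) =
     G$1$1 + G$2$2 + 2 * r * sqrt (G$1$1 * G$2$2 - (G$1$2)^2) + (1 - r^2) * (norm \<delta>)^2"
  proof -
    have w: "w1 1 + \<i> * w1 2 = Complex (\<alpha> - \<gamma>) \<beta>" "w1 1 - \<i> * w1 2 = Complex (\<alpha> + \<gamma>) (-\<beta>)" "w1 3 = \<delta>"
      by (simp_all add: w1_def complex_eq_iff)
    have n: "(norm (Complex (\<alpha> - \<gamma>) \<beta>))^2 = (\<alpha> - \<gamma>)^2 + \<beta>^2" "(norm (Complex (\<alpha> + \<gamma>) (-\<beta>)))^2 = (\<alpha> + \<gamma>)^2 + \<beta>^2"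
      by (simp_all add: cmod_power2)
    have "(1 - r)/2 * ((\<alpha> - \<gamma>)^2 + \<beta>^2) + (1 + r)/2 * ((\<alpha> + \<gamma>)^2 + \<beta>^2) = \<alpha>^2 + (\<beta>^2 + \<gamma>^2) + 2 * r * (\<alpha> * \<gamma>)"
      by (simp add: power2_eq_square field_simps)
    then show ?thesis unfolding opt_dir_value[OF r] w n a bc ac by simp
  qed
  have v2: "2 * Re (\<Sum>k\<in>UNIV. w2 k * opt_dir r w2 k) - rld_info r (dir_mat (opt_dir r w2)) = (1 - r^2) * s"
    unfolding opt_dir_value[OF r] using s by (simp add: w2_def)
  have "(\<lambda>n. F w1 n + F w2 n) \<longlonglongrightarrow> (G$1$1 + G$2$2 + 2 * r * sqrt (G$1$1 * G$2$2 - (G$1$2)^2) + (1 - r^2) * (norm \<delta>)^2) + (1 - r^2) * s"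
    unfolding v1[symmetric] v2[symmetric] by (intro tendsto_add Flim)
  also have "(G$1$1 + G$2$2 + 2 * r * sqrt (G$1$1 * G$2$2 - (G$1$2)^2) + (1 - r^2) * (norm \<delta>)^2) + (1 - r^2) * s = ?b"
    by (simp add: RLD_value_def trace_def sum_3 g(2) d[symmetric] power2_eq_square algebra_simps)
  finally have lim: "(\<lambda>n. ereal (F w1 n + F w2 n)) \<longlonglongrightarrow> ereal ?b" by simp
  have le: "ereal (F w1 n + F w2 n) \<le> nTrGV n G (Ms n) (thz r)" if n: "n > 0" for n
  proof (cases "\<forall>j. integrable (Pn n (Ms n) (thz r)) (\<lambda>x. (x$j - thz r$j)^2)")
    case True
    let ?P = "Pn n (Ms n) (thz r)" and ?y = "\<lambda>x. x - thz r"
    have sq: "\<And>j. integrable ?P (\<lambda>x. (x$j - thz r$j)^2)" using True by blast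
    have grm: "gram (2^n) (tpow n (rho (thz r)))" using r by (intro gram_tpow thz_Theta) auto
    have I: "integrable ?P (\<lambda>x. (x$j - thz r$j) * (x$k - thz r$k))" for j k
      using integrable_tau[OF povm grm prod_tau[OF povm r sq]] by (simp add: Pn_def)
    have nn: "(norm (\<Sum>j\<in>UNIV. w1 j * of_real (x$j - thz r$j)))^2 + (norm (\<Sum>j\<in>UNIV. w2 j * of_real (x$j - thz r$j)))^2
       = (\<Sum>j\<in>UNIV. \<Sum>k\<in>UNIV. G$j$k * ((x$j - thz r$j) * (x$k - thz r$k)))" for x
      using id[of "?y x"] s by (simp add: sum_3 w1_def w2_def norm_mult power_mult_distrib del: of_real_diff)
    have sqn: "integrable ?P (\<lambda>x. (norm (\<Sum>j\<in>UNIV. w j * of_real (x$j - thz r$j)))^2)" for w :: "3 \<Rightarrow> complex"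
    proof -
      have e: "(norm (\<Sum>j\<in>UNIV. w j * of_real (x$j - thz r$j)))^2 =
         (\<Sum>j\<in>UNIV. \<Sum>k\<in>UNIV. (Re (w j) * Re (w k) + Im (w j) * Im (w k)) * ((x$j - thz r$j) * (x$k - thz r$k)))" for x
      proof -
        have "(norm (\<Sum>j\<in>UNIV. w j * of_real (x$j - thz r$j)))^2 =
           (\<Sum>j\<in>UNIV. Re (w j) * (x$j - thz r$j))^2 + (\<Sum>j\<in>UNIV. Im (w j) * (x$j - thz r$j))^2"
          unfolding cmod_power2 Re_sum Im_sum by simp
        also have "\<dots> = (\<Sum>j\<in>UNIV. \<Sum>k\<in>UNIV. (Re (w j) * Re (w k) + Im (w j) * Im (w k)) * ((x$j - thz r$j) * (x$k - thz r$k)))"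
          unfolding power2_eq_square sum_product sum.distrib[symmetric] by (intro sum.cong refl) (simp add: algebra_simps)
        finally show ?thesis .
      qed
      show ?thesis unfolding e by (intro Bochner_Integration.integrable_sum integrable_mult_right I)
    qed
    have "trace (G ** Vmat n (Ms n) (thz r)) = (\<Sum>j\<in>UNIV. \<Sum>k\<in>UNIV. G$j$k * integral\<^sup>L ?P (\<lambda>x. (x$j - thz r$j) * (x$k - thz r$k)))"
      by (simp add: trace_def matrix_matrix_mult_def Vmat_def mult.commute)
    also have "\<dots> = integral\<^sup>L ?P (\<lambda>x. \<Sum>j\<in>UNIV. \<Sum>k\<in>UNIV. G$j$k * ((x$j - thz r$j) * (x$k - thz r$k)))"
      using I by (simp add: Bochner_Integration.integral_sum)
    also have "\<dots> = integral\<^sup>L ?P (\<lambda>x. (norm (\<Sum>j\<in>UNIV. w1 j * of_real (x$j - thz r$j)))^2)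
       + integral\<^sup>L ?P (\<lambda>x. (norm (\<Sum>j\<in>UNIV. w2 j * of_real (x$j - thz r$j)))^2)"
      unfolding nn[symmetric] by (intro Bochner_Integration.integral_add sqn)
    finally have "real n * trace (G ** Vmat n (Ms n) (thz r)) \<ge> F w1 n + F w2 n"
      using functional_bound[OF povm r sq n, of w1 "opt_dir r w1"] functional_bound[OF povm r sq n, of w2 "opt_dir r w2"]
      by (simp only: F_def distrib_left)
    then show ?thesis using True by (simp add: nTrGV_def)
  next
    \<comment> \<open>Some second moment fails to be finite, and \<open>nTrGV\<close> is infinite by
      definition.\<close>
    case False
    then show ?thesis unfolding nTrGV_def by (subst if_not_P) auto
  qed
  have "ereal ?b = liminf (\<lambda>n. ereal (F w1 n + F w2 n))"
    using lim_imp_Liminf[OF _ lim] by simp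
  also have "\<dots> \<le> liminf (\<lambda>n. nTrGV n G (Ms n) (thz r))"
    by (intro Liminf_mono eventually_sequentiallyI[of 1] le) simp
  finally show ?thesis .
qed

subsection \<open>A weak measurement of two spin components\<close>

definition fin_povm :: "'w set \<Rightarrow> ('w \<Rightarrow> real^3) \<Rightarrow> ('w \<Rightarrow> nat \<Rightarrow> complex) \<Rightarrow> (real^3) set \<Rightarrow> cmat" where
  "fin_povm \<Omega> pt \<psi> A i j = (\<Sum>\<omega>\<in>\<Omega>. if pt \<omega> \<in> A then \<psi> \<omega> i * cnj (\<psi> \<omega> j) else 0)"

lemma quad_rank_ones:
  "quad d (\<lambda>i j. \<Sum>\<omega>\<in>\<Omega>. \<psi> \<omega> i * cnj (\<psi> \<omega> j)) v = of_real (\<Sum>\<omega>\<in>\<Omega>. (norm (\<Sum>i<d. cnj (v i) * \<psi> \<omega> i))^2)"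
proof -
  have "quad d (\<lambda>i j. \<Sum>\<omega>\<in>\<Omega>. \<psi> \<omega> i * cnj (\<psi> \<omega> j)) v = (\<Sum>i<d. \<Sum>j<d. \<Sum>\<omega>\<in>\<Omega>. (cnj (v i) * \<psi> \<omega> i) * (v j * cnj (\<psi> \<omega> j)))"
    unfolding quad_def sum_distrib_left sum_distrib_right by (intro sum.cong refl) (simp add: mult_ac)
  also have "\<dots> = (\<Sum>i<d. \<Sum>\<omega>\<in>\<Omega>. \<Sum>j<d. (cnj (v i) * \<psi> \<omega> i) * (v j * cnj (\<psi> \<omega> j)))"
    by (intro sum.cong refl sum.swap)
  also have "\<dots> = (\<Sum>\<omega>\<in>\<Omega>. \<Sum>i<d. \<Sum>j<d. (cnj (v i) * \<psi> \<omega> i) * (v j * cnj (\<psi> \<omega> j)))"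
    by (rule sum.swap)
  also have "\<dots> = (\<Sum>\<omega>\<in>\<Omega>. of_real ((norm (\<Sum>i<d. cnj (v i) * \<psi> \<omega> i))^2))"
    unfolding complex_norm_square cnj_sum sum_product by simp
  finally show ?thesis by simp
qed

lemma fin_povm_is_povm:
  assumes fin: "finite \<Omega>" and one: "\<And>i j. i < d \<Longrightarrow> j < d \<Longrightarrow> (\<Sum>\<omega>\<in>\<Omega>. \<psi> \<omega> i * cnj (\<psi> \<omega> j)) = (if i = j then 1 else 0)"
  shows "is_povm d (fin_povm \<Omega> pt \<psi>)"
  unfolding is_povm_def
proof (intro conjI allI ballI impI)
  fix A :: "(real^3) set" and v :: "nat \<Rightarrow> complex"
  have "fin_povm \<Omega> pt \<psi> A = (\<lambda>i j. \<Sum>\<omega>\<in>\<Omega> \<inter> pt -` A. \<psi> \<omega> i * cnj (\<psi> \<omega> j))"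
    using fin by (simp add: fin_povm_def fun_eq_iff sum.inter_restrict)
  then have e: "(\<Sum>i<d. \<Sum>j<d. cnj (v i) * fin_povm \<Omega> pt \<psi> A i j * v j) = of_real (\<Sum>\<omega>\<in>\<Omega> \<inter> pt -` A. (norm (\<Sum>i<d. cnj (v i) * \<psi> \<omega> i))^2)"
    using quad_rank_ones[where d=d and \<Omega>="\<Omega> \<inter> pt -` A" and \<psi>=\<psi> and v=v] by (simp add: quad_def)
  show "(\<Sum>i<d. \<Sum>j<d. cnj (v i) * fin_povm \<Omega> pt \<psi> A i j * v j) \<in> \<real>"
    unfolding e by (rule Reals_of_real)
  show "0 \<le> Re (\<Sum>i<d. \<Sum>j<d. cnj (v i) * fin_povm \<Omega> pt \<psi> A i j * v j)"
    unfolding e Re_complex_of_real by (intro sum_nonneg) auto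
next
  fix i j assume "i < d" "j < d"
  then show "fin_povm \<Omega> pt \<psi> UNIV i j = (if i = j then 1 else 0)" by (simp add: fin_povm_def one)
next
  fix A :: "nat \<Rightarrow> (real^3) set" and i j
  assume A: "disjoint_family A"
  have "(\<lambda>k. if p \<in> A k then c else 0) sums (if p \<in> (\<Union>k. A k) then c else 0)" for p and c :: complex
  proof (cases "p \<in> (\<Union>k. A k)")
    case True
    then obtain k0 where k0: "p \<in> A k0" by blast
    have "p \<in> A k \<longleftrightarrow> k = k0" for k using A k0 by (auto simp: disjoint_family_on_def)
    then show ?thesis using True sums_single[of k0 "\<lambda>_. c"] by simp
  qed auto
  then show "(\<lambda>k. fin_povm \<Omega> pt \<psi> (A k) i j) sums fin_povm \<Omega> pt \<psi> (\<Union>k. A k) i j"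
    unfolding fin_povm_def by (intro sums_sum)
qed

definition qprob :: "nat \<Rightarrow> (nat \<Rightarrow> complex) \<Rightarrow> cmat \<Rightarrow> real" where
  "qprob d v Z = Re (\<Sum>i<d. \<Sum>j<d. v i * cnj (v j) * Z j i)"

lemma qprob_nonneg:
  assumes "gram d Z" shows "0 \<le> qprob d v Z"
proof -
  obtain K u where u: "\<And>i j. i < d \<Longrightarrow> j < d \<Longrightarrow> Z i j = (\<Sum>l<(K::nat). u l i * cnj (u l j))"
    using assms unfolding gram_def by blast
  have "0 \<le> Re (quad d (\<lambda>i j. v i * cnj (v j)) w)" for w
    using quad_rank_ones[where d=d and \<Omega>="{()}" and \<psi>="\<lambda>_. v" and v=w] by simp
  then show ?thesis
    using mtr_gram[OF u, where M="\<lambda>_ i j. v i * cnj (v j)" and A="{}"] by (simp add: mtr_def qprob_def sum_nonneg)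
qed

lemma outcome_dist_fin_povm:
  assumes povm: "is_povm d (fin_povm \<Omega> pt \<psi>)" and fin: "finite \<Omega>" and Z: "gram d Z"
  shows "outcome_dist d (fin_povm \<Omega> pt \<psi>) Z = distr (point_measure \<Omega> (\<lambda>\<omega>. ennreal (qprob d (\<psi> \<omega>) Z))) borel pt"
    (is "?D = distr ?P _ _")
proof (rule measure_eqI)
  show "sets (?D) = sets (distr ?P borel pt)"
    by simp
  fix A assume "A \<in> sets (?D)"
  then have A: "A \<in> sets borel" by simp
  have "mtr d (fin_povm \<Omega> pt \<psi>) Z A = Re (\<Sum>i<d. \<Sum>j<d. \<Sum>\<omega>\<in>\<Omega>. if pt \<omega> \<in> A then \<psi> \<omega> i * cnj (\<psi> \<omega> j) * Z j i else 0)"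
    unfolding mtr_def fin_povm_def sum_distrib_right by (intro arg_cong[where f=Re] sum.cong refl) auto
  also have "\<dots> = Re (\<Sum>i<d. \<Sum>\<omega>\<in>\<Omega>. \<Sum>j<d. if pt \<omega> \<in> A then \<psi> \<omega> i * cnj (\<psi> \<omega> j) * Z j i else 0)"
    by (intro arg_cong[where f=Re] sum.cong refl sum.swap)
  also have "\<dots> = Re (\<Sum>\<omega>\<in>\<Omega>. \<Sum>i<d. \<Sum>j<d. if pt \<omega> \<in> A then \<psi> \<omega> i * cnj (\<psi> \<omega> j) * Z j i else 0)"
    by (subst sum.swap) (rule refl)
  also have "\<dots> = (\<Sum>\<omega>\<in>\<Omega>. if pt \<omega> \<in> A then qprob d (\<psi> \<omega>) Z else 0)"
    unfolding Re_sum[of _ \<Omega>] qprob_def by (intro sum.cong refl) auto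
  also have "\<dots> = (\<Sum>\<omega>\<in>pt -` A \<inter> \<Omega>. qprob d (\<psi> \<omega>) Z)"
    using fin by (simp add: sum.If_cases Int_def vimage_def conj_commute)
  finally have "emeasure (?D) A = ennreal (\<Sum>\<omega>\<in>pt -` A \<inter> \<Omega>. qprob d (\<psi> \<omega>) Z)"
    by (simp add: emeasure_outcome[OF povm Z A])
  also have "\<dots> = (\<Sum>\<omega>\<in>pt -` A \<inter> \<Omega>. ennreal (qprob d (\<psi> \<omega>) Z))"
    by (rule sum_ennreal[symmetric]) (rule qprob_nonneg[OF Z])
  also have "\<dots> = emeasure (distr ?P borel pt) A"
    using fin A by (simp add: emeasure_distr measurable_point_measure_eq1 space_point_measure emeasure_point_measure_finite)
  finally show "emeasure (?D) A = emeasure (distr ?P borel pt) A" .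
qed

lemma integral_fin_povm:
  fixes \<phi> :: "real^3 \<Rightarrow> real"
  assumes "is_povm d (fin_povm \<Omega> pt \<psi>)" "finite \<Omega>" "gram d Z" "\<phi> \<in> borel_measurable borel"
  shows "integrable (outcome_dist d (fin_povm \<Omega> pt \<psi>) Z) \<phi>"
    "integral\<^sup>L (outcome_dist d (fin_povm \<Omega> pt \<psi>) Z) \<phi> = (\<Sum>\<omega>\<in>\<Omega>. \<phi> (pt \<omega>) * qprob d (\<psi> \<omega>) Z)"
proof -
  have m: "pt \<in> measurable (point_measure \<Omega> (\<lambda>\<omega>. ennreal (qprob d (\<psi> \<omega>) Z))) borel"
    by (simp add: measurable_point_measure_eq1)
  show "integrable (outcome_dist d (fin_povm \<Omega> pt \<psi>) Z) \<phi>"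
    unfolding outcome_dist_fin_povm[OF assms(1-3)] using assms(2,4)
    by (subst integrable_distr_eq[OF m]) (auto intro!: integrable_point_measure_finite qprob_nonneg[OF assms(3)])
  show "integral\<^sup>L (outcome_dist d (fin_povm \<Omega> pt \<psi>) Z) \<phi> = (\<Sum>\<omega>\<in>\<Omega>. \<phi> (pt \<omega>) * qprob d (\<psi> \<omega>) Z)"
    unfolding outcome_dist_fin_povm[OF assms(1-3)] using assms(2,4)
    by (simp add: integral_distr[OF m] lebesgue_integral_point_measure_finite qprob_nonneg[OF assms(3)] mult.commute)
qed

section \<open>Rotations between the spin axes\<close>

definition Umat :: "real \<Rightarrow> complex^2^2" where
  "Umat \<phi> = (\<chi> a b. (if a = 1 then 1 else if b = 1 then cis \<phi> else - cis \<phi>) / of_real (sqrt 2))"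

definition sigA :: "real \<Rightarrow> complex^2^2" where
  "sigA \<phi> = (\<chi> a b. of_real (cos \<phi>) * sig 1 $ a $ b + of_real (sin \<phi>) * sig 2 $ a $ b)"

text \<open>The equatorial component orthogonal to \<open>sigA\<close>, with the sign that
  conjugation by \<open>Umat\<close> produces from \<open>sig 2\<close>.\<close>

definition sigE :: "real \<Rightarrow> complex^2^2" where
  "sigE \<phi> = (\<chi> a b. of_real (sin \<phi>) * sig 1 $ a $ b - of_real (cos \<phi>) * sig 2 $ a $ b)"

lemma mat2_eqI:
  fixes A B :: "complex^2^2"
  assumes "A$1$1 = B$1$1" "A$1$2 = B$1$2" "A$2$1 = B$2$1" "A$2$2 = B$2$2"
  shows "A = B"
  using assms by (simp add: vec_eq_iff forall_2)

text \<open>Conjugation by a Hadamard matrix followed by the phase u. The factor 1 / sqrt 2 occurs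
  in pairs, which leaves the rational factor 1/2.\<close>

definition hconj :: "complex \<Rightarrow> complex^2^2 \<Rightarrow> complex^2^2" where
  "hconj u s = (\<chi> a b.
     (if a = 1 \<and> b = 1 then s$1$1 + s$1$2 + s$2$1 + s$2$2
      else if a = 1 then (s$1$1 - s$1$2 + s$2$1 - s$2$2) * cnj u
      else if b = 1 then (s$1$1 + s$1$2 - s$2$1 - s$2$2) * u
      else s$1$1 - s$1$2 - s$2$1 + s$2$2) / 2)"

lemma hadamard_conj:
  fixes U s :: "complex^2^2" and h u :: complex
  assumes U: "U$1$1 = h" "U$1$2 = h" "U$2$1 = h * u" "U$2$2 = - (h * u)"
    and h: "h * h = 1/2" "cnj h = h" and u: "u * cnj u = 1"
  shows "U ** s ** cadj U = hconj u s" (is "_ = ?R")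
proof (rule mat2_eqI)
  let ?L = "U ** s ** cadj U"
  have e: "?L $ a $ b = U$a$1 * s$1$1 * cnj (U$b$1) + U$a$2 * s$2$1 * cnj (U$b$1) + U$a$1 * s$1$2 * cnj (U$b$2) + U$a$2 * s$2$2 * cnj (U$b$2)" for a b
    by (simp add: matrix_matrix_mult_def sum_2 cadj_def algebra_simps)
  have "?L $ 1 $ 1 = (h * h) * (s$1$1 + s$1$2 + s$2$1 + s$2$2)"
    unfolding e U h(2) by (simp add: algebra_simps)
  moreover have "?L $ 1 $ 2 = (h * h) * ((s$1$1 - s$1$2 + s$2$1 - s$2$2) * cnj u)"
    unfolding e U complex_cnj_mult complex_cnj_minus h(2) by (simp add: algebra_simps)
  moreover have "?L $ 2 $ 1 = (h * h) * ((s$1$1 + s$1$2 - s$2$1 - s$2$2) * u)"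
    unfolding e U complex_cnj_mult complex_cnj_minus h(2) by (simp add: algebra_simps)
  moreover have "?L $ 2 $ 2 = (h * h) * ((s$1$1 - s$1$2 - s$2$1 + s$2$2) * (u * cnj u))"
    unfolding e U complex_cnj_mult complex_cnj_minus h(2) by (simp add: algebra_simps)
  ultimately show "?L $ 1 $ 1 = ?R $ 1 $ 1" "?L $ 1 $ 2 = ?R $ 1 $ 2" "?L $ 2 $ 1 = ?R $ 2 $ 1" "?L $ 2 $ 2 = ?R $ 2 $ 2"
    unfolding h(1) u hconj_def by simp_all
qed

lemma Umat_conj:
  "Umat \<phi> ** s ** cadj (Umat \<phi>) = hconj (cis \<phi>) s"
proof (rule hadamard_conj)
  let ?h = "of_real (1 / sqrt 2) :: complex"
  have "1 / sqrt 2 * (1 / sqrt 2) = (1/2::real)" by simp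
  then show "?h * ?h = 1/2" unfolding of_real_mult[symmetric] by (simp only:) simp
  show "cnj ?h = ?h" by (rule complex_cnj_complex_of_real)
  show "cis \<phi> * cnj (cis \<phi>) = 1" by (simp add: cis_cnj cis_mult)
qed (simp_all add: Umat_def)

lemma cis_parts: "cis \<phi> = of_real (cos \<phi>) + \<i> * of_real (sin \<phi>)" "cnj (cis \<phi>) = of_real (cos \<phi>) - \<i> * of_real (sin \<phi>)"
  by (simp_all add: complex_eq_iff)

lemma Umat_unitary: "Umat \<phi> ** cadj (Umat \<phi>) = mat 1" "cadj (Umat \<phi>) ** Umat \<phi> = mat 1"
proof -
  show 1: "Umat \<phi> ** cadj (Umat \<phi>) = mat 1"
    using Umat_conj[of \<phi> "mat 1"] by (simp only: matrix_mul_rid hconj_def) (rule mat2_eqI; simp add: mat_def)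
  then show "cadj (Umat \<phi>) ** Umat \<phi> = mat 1" by (simp add: matrix_left_right_inverse)
qed

lemma Umat_sig3: "Umat \<phi> ** sig 3 ** cadj (Umat \<phi>) = sigA \<phi>"
  unfolding Umat_conj hconj_def cis_parts by (rule mat2_eqI) (simp_all add: sigA_def sig_entries field_simps)

lemma Umat_sig2: "Umat \<phi> ** sig 2 ** cadj (Umat \<phi>) = sigE \<phi>"
  unfolding Umat_conj hconj_def cis_parts by (rule mat2_eqI) (simp_all add: sigE_def sig_entries field_simps)

lemma Umat_sig1: "Umat \<phi> ** sig 1 ** cadj (Umat \<phi>) = sig 3"
  unfolding Umat_conj hconj_def by (rule mat2_eqI) (simp_all add: sig_entries)

lemma sigA_pi_half: "sigA (pi/2) = sig 2"
  by (rule mat2_eqI) (simp_all add: sigA_def sig_entries)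

lemma Spin_sigA: "Spin n (sigA \<phi>) i j = of_real (cos \<phi>) * Spin n (sig 1) i j + of_real (sin \<phi>) * Spin n (sig 2) i j"
proof -
  have "sigA \<phi> = (\<chi> a b. of_real (cos \<phi>) * sig 1 $ a $ b) + (\<chi> a b. of_real (sin \<phi>) * sig 2 $ a $ b)"
    by (simp add: sigA_def vec_eq_iff)
  then show ?thesis by (simp only: Spin_add Spin_scale)
qed

lemma Spin_sigE: "Spin n (sigE \<phi>) i j = of_real (sin \<phi>) * Spin n (sig 1) i j + of_real (- cos \<phi>) * Spin n (sig 2) i j"
proof -
  have "sigE \<phi> = (\<chi> a b. of_real (sin \<phi>) * sig 1 $ a $ b) + (\<chi> a b. of_real (- cos \<phi>) * sig 2 $ a $ b)"
    by (simp add: sigE_def vec_eq_iff)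
  then show ?thesis by (simp only: Spin_add Spin_scale)
qed

lemma corr_Spin_sigA: "corr n m const1 i j * Spin n (sigA \<phi>) i j = of_real (overlap1 m) * Spin n (sigA \<phi>) i j"
  unfolding Spin_sigA by (rule mult_comb2[OF corr_Spin_sig1 corr_Spin_sig2])

lemma corr_Spin_sigE: "corr n m const1 i j * Spin n (sigE \<phi>) i j = of_real (overlap1 m) * Spin n (sigE \<phi>) i j"
  unfolding Spin_sigE by (rule mult_comb2[OF corr_Spin_sig1 corr_Spin_sig2])

lemma Spin_offdiag_zero: "Spin n (sig 1) i i = 0" "Spin n (sig 2) i i = 0"
proof -
  have "Spin n E12 i i = 0" "Spin n E21 i i = 0"
    using Spin_E12_wt[of n i i] Spin_E21_wt[of n i i] by fastforce+
  then show "Spin n (sig 1) i i = 0" "Spin n (sig 2) i i = 0" by (simp_all add: Spin_sig1 Spin_sig2)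
qed

text \<open>The operator with eigenvalues \<open>f b\<close> on the rotated standard basis, an
  eigenbasis of J_2; it represents the final projective measurement.\<close>

definition ymat :: "nat \<Rightarrow> (nat \<Rightarrow> real) \<Rightarrow> cmat" where
  "ymat n f k l = (\<Sum>b<2^n. tpow n (Umat (pi/2)) k b * of_real (f b) * cnj (tpow n (Umat (pi/2)) l b))"

abbreviation TU :: "nat \<Rightarrow> real \<Rightarrow> cmat" where "TU n \<phi> \<equiv> tpow n (Umat \<phi>)"
abbreviation TU' :: "nat \<Rightarrow> real \<Rightarrow> cmat" where "TU' n \<phi> \<equiv> tpow n (cadj (Umat \<phi>))"

text \<open>Read from the index i inwards: pointer on J_3 with reading z, rotation to the axis a,
  pointer on J_a with reading x, rotation to the last axis, basis vector b. The effect of the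
  outcome is the rank-one matrix of this vector.\<close>

definition effvec :: "nat \<Rightarrow> nat \<Rightarrow> nat \<Rightarrow> real \<Rightarrow> nat \<times> nat \<times> nat \<Rightarrow> nat \<Rightarrow> complex" where
  "effvec n m m' \<phi> = (\<lambda>(b, x, z) i. of_real (amp m' z (wt n i)) *
     (\<Sum>k<2^n. TU n \<phi> i k * of_real (amp m x (wt n k)) * TU n (pi/2) k b))"

text \<open>The Heisenberg operator of the moment f(b) g(x) h(z): starting from the last
  measurement, each earlier stage acts by a rotation or by an entrywise \<open>corr\<close>.\<close>

definition effect :: "nat \<Rightarrow> nat \<Rightarrow> nat \<Rightarrow> real \<Rightarrow> (nat \<Rightarrow> real) \<Rightarrow> (nat \<Rightarrow> real) \<Rightarrow> (nat \<Rightarrow> real) \<Rightarrow> cmat" where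
  "effect n m m' \<phi> f g h i j = corr n m' h i j * mm (2^n) (TU n \<phi>) (mm (2^n) (\<lambda>k l. corr n m g k l * ymat n f k l) (TU' n \<phi>)) i j"

definition outcomes :: "nat \<Rightarrow> nat \<Rightarrow> nat \<Rightarrow> (nat \<times> nat \<times> nat) set" where
  "outcomes n m m' = {..<2^n} \<times> {..n+m} \<times> {..n+m'}"

lemma effvec_moment:
  "(\<Sum>(b,x,z)\<in>outcomes n m m'. of_real (f b * g x * h z) * (effvec n m m' \<phi> (b,x,z) i * cnj (effvec n m m' \<phi> (b,x,z) j))) = effect n m m' \<phi> f g h i j"
proof -
  let ?d = "2^n :: nat"
  let ?F = "\<lambda>b x k l. (TU n \<phi> i k * cnj (TU n \<phi> j l)) *
    (of_real (g x * (amp m x (wt n k) * amp m x (wt n l))) * (TU n (pi/2) k b * of_real (f b) * cnj (TU n (pi/2) l b)))"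
  define c where "c b x i = (\<Sum>k<?d. TU n \<phi> i k * of_real (amp m x (wt n k)) * TU n (pi/2) k b)" for b x i
  have "(\<Sum>(b,x,z)\<in>outcomes n m m'. of_real (f b * g x * h z) * (effvec n m m' \<phi> (b,x,z) i * cnj (effvec n m m' \<phi> (b,x,z) j)))
     = (\<Sum>b<?d. \<Sum>x\<le>n+m. \<Sum>z\<le>n+m'. (of_real (f b * g x) * (c b x i * cnj (c b x j))) * of_real (h z * (amp m' z (wt n i) * amp m' z (wt n j))))"
    unfolding outcomes_def sum.cartesian_product[symmetric] effvec_def c_def by (intro sum.cong refl) (simp add: mult_ac)
  also have "\<dots> = (\<Sum>b<?d. \<Sum>x\<le>n+m. (of_real (f b * g x) * (c b x i * cnj (c b x j))) * corr n m' h i j)"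
    by (simp only: sum_distrib_left[symmetric] corr_def of_real_sum)
  also have "\<dots> = corr n m' h i j * (\<Sum>b<?d. \<Sum>x\<le>n+m. of_real (f b * g x) * (c b x i * cnj (c b x j)))"
    by (simp only: sum_distrib_left mult.commute)
  also have "(\<Sum>b<?d. \<Sum>x\<le>n+m. of_real (f b * g x) * (c b x i * cnj (c b x j))) =
     (\<Sum>b<?d. \<Sum>x\<le>n+m. \<Sum>k<?d. \<Sum>l<?d. ?F b x k l)"
    unfolding c_def cnj_sum sum_product unfolding sum_distrib_left by (intro sum.cong refl) (simp add: mult_ac)
  also have "\<dots> = (\<Sum>k<?d. \<Sum>l<?d. \<Sum>b<?d. \<Sum>x\<le>n+m. ?F b x k l)"
  proof -
    have "(\<Sum>b<?d. \<Sum>x\<le>n+m. \<Sum>k<?d. \<Sum>l<?d. ?F b x k l) = (\<Sum>b<?d. \<Sum>k<?d. \<Sum>x\<le>n+m. \<Sum>l<?d. ?F b x k l)"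
      by (intro sum.cong refl sum.swap)
    also have "\<dots> = (\<Sum>k<?d. \<Sum>b<?d. \<Sum>x\<le>n+m. \<Sum>l<?d. ?F b x k l)" by (rule sum.swap)
    also have "\<dots> = (\<Sum>k<?d. \<Sum>b<?d. \<Sum>l<?d. \<Sum>x\<le>n+m. ?F b x k l)" by (intro sum.cong refl sum.swap)
    also have "\<dots> = (\<Sum>k<?d. \<Sum>l<?d. \<Sum>b<?d. \<Sum>x\<le>n+m. ?F b x k l)" by (intro sum.cong refl sum.swap)
    finally show ?thesis .
  qed
  also have "\<dots> = (\<Sum>k<?d. \<Sum>l<?d. (TU n \<phi> i k * cnj (TU n \<phi> j l)) * (corr n m g k l * ymat n f k l))"
  proof (intro sum.cong refl)
    fix k l
    have "(\<Sum>b<?d. \<Sum>x\<le>n+m. of_real (g x * (amp m x (wt n k) * amp m x (wt n l))) * (TU n (pi/2) k b * of_real (f b) * cnj (TU n (pi/2) l b))) = corr n m g k l * ymat n f k l"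
      unfolding corr_def ymat_def of_real_sum sum_product by (rule sum.swap)
    then show "(\<Sum>b<?d. \<Sum>x\<le>n+m. ?F b x k l) =
       (TU n \<phi> i k * cnj (TU n \<phi> j l)) * (corr n m g k l * ymat n f k l)"
      by (simp only: sum_distrib_left[symmetric])
  qed
  also have "\<dots> = mm ?d (TU n \<phi>) (mm ?d (\<lambda>k l. corr n m g k l * ymat n f k l) (TU' n \<phi>)) i j"
    unfolding mm_def adj_tpow[symmetric] adj_def sum_distrib_left by (intro sum.cong refl) (simp add: mult_ac)
  finally show ?thesis by (simp add: effect_def)
qed

lemma ymat_const: "ymat n (\<lambda>_. 1) = one_n n"
proof -
  have "ymat n (\<lambda>_. 1) = mm (2^n) (TU n (pi/2)) (TU' n (pi/2))"
    by (simp add: ymat_def mm_def adj_tpow[symmetric] adj_def fun_eq_iff)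
  then show ?thesis by (simp add: mm_tpow Umat_unitary one_n_def)
qed

definition spin_val :: "nat \<Rightarrow> nat \<Rightarrow> real" where "spin_val n b = real n / 2 - real (wt n b)"

lemma ymat_diagonal:
  assumes D: "\<And>b c. D b c = of_real (f b) * one_n n b c"
  shows "ymat n f = mm (2^n) (TU n (pi/2)) (mm (2^n) D (TU' n (pi/2)))"
proof (intro ext)
  fix k l
  have "mm (2^n) D (TU' n (pi/2)) b l = of_real (f b) * TU' n (pi/2) b l" if "b < 2^n" for b
  proof -
    have "mm (2^n) D (TU' n (pi/2)) b l = (\<Sum>c<2^n. if c = b then of_real (f b) * TU' n (pi/2) b l else 0)"
      unfolding mm_def using that by (intro sum.cong refl) (auto simp: D one_n_less)
    then show ?thesis using that by simp
  qed
  then show "ymat n f k l = mm (2^n) (TU n (pi/2)) (mm (2^n) D (TU' n (pi/2))) k l"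
    unfolding ymat_def mm_def[of _ "TU n (pi/2)"] by (intro sum.cong refl) (simp add: adj_tpow[symmetric] adj_def mult.assoc)
qed

lemma ymat_spin_val: "ymat n (spin_val n) = Spin n (sig 2)"
  by (subst ymat_diagonal[of "Spin n (sig 3)"])
     (simp_all add: Spin_diag spin_val_def Spin_conj Umat_unitary Umat_sig3 sigA_pi_half)

lemma Spin2_conj:
  assumes "U ** U' = mat 1" "U' ** U = mat 1"
  shows "mm (2^n) (tpow n U) (mm (2^n) (Spin2 n s s) (tpow n U')) = Spin2 n (U ** s ** U') (U ** s ** U')"
proof -
  have u: "mm (2^n) (tpow n U') (mm (2^n) (tpow n U) X) = mm (2^n) (one_n n) X" for X
    by (simp add: mm_assoc[symmetric] mm_tpow assms one_n_def)
  show ?thesis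
    unfolding Spin2_def Spin_conj[OF assms(1), symmetric]
    by (simp add: mm_assoc u) (simp add: mm_assoc[symmetric])
qed

lemma ymat_yv2: "ymat n (\<lambda>b. (spin_val n b)^2) = Spin2 n (sig 2) (sig 2)"
  by (subst ymat_diagonal[of "Spin2 n (sig 3) (sig 3)"])
     (simp_all add: Spin2_sig3 spin_val_def Spin2_conj Umat_unitary Umat_sig3 sigA_pi_half)

lemma TU_one: "mm (2^n) (TU n \<phi>) (mm (2^n) (one_n n) (TU' n \<phi>)) = one_n n"
  by (simp add: mm_tpow Umat_unitary) (simp add: one_n_def)

lemma effect_one: "effect n m m' \<phi> const1 const1 const1 = one_n n"
  unfolding effect_def ymat_const corr_one TU_one by (simp add: fun_eq_iff corr_one)

lemma effect_x: "effect n m m' \<phi> const1 (ptr_val n m) const1 = (\<lambda>i j. of_real (overlap1 m') * Spin n (sigA \<phi>) i j)"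
  unfolding effect_def ymat_const corr_ptr_val_one Spin_conj[OF Umat_unitary(1)] Umat_sig3 by (simp add: fun_eq_iff corr_Spin_sigA)

lemma effect_y: "effect n m m' \<phi> (spin_val n) const1 const1 = (\<lambda>i j. of_real (overlap1 m * overlap1 m') * Spin n (sigE \<phi>) i j)"
  unfolding effect_def ymat_spin_val corr_Spin_sig2 mm_scale_left mm_scale_right Spin_conj[OF Umat_unitary(1)] Umat_sig2
  by (simp add: fun_eq_iff mult.left_commute corr_Spin_sigE)

lemma effect_z: "effect n m m' \<phi> const1 const1 (ptr_val n m') = Spin n (sig 3)"
  unfolding effect_def ymat_const corr_one TU_one by (simp add: fun_eq_iff corr_ptr_val_one)

lemma effect_zz: "effect n m m' \<phi> const1 const1 (\<lambda>z. (ptr_val n m' z)^2) = (\<lambda>i j. Spin2 n (sig 3) (sig 3) i j + of_real (ptr_var m') * one_n n i j)"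
  unfolding effect_def ymat_const corr_one TU_one by (simp add: fun_eq_iff corr_xi2_one)

lemma effect_xx: "effect n m m' \<phi> const1 (\<lambda>x. (ptr_val n m x)^2) const1 =
   (\<lambda>i j. corr n m' const1 i j * (Spin2 n (sigA \<phi>) (sigA \<phi>) i j + of_real (ptr_var m) * one_n n i j))"
  unfolding effect_def ymat_const corr_xi2_one mm_add_left mm_add_right mm_scale_left mm_scale_right TU_one
    Spin2_conj[OF Umat_unitary] Umat_sig3 by (rule refl)

text \<open>This is the back action of the pointer on J_a. The rotation by \<open>Umat\<close>
  carries J_2 to J_e and J_1 to J_3 in \<open>corr_Spin2_sig2\<close>, so J_3^2 enters the second
  moment of the final reading.\<close>

lemma effect_yy: "effect n m m' \<phi> (\<lambda>b. (spin_val n b)^2) const1 const1 =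
   (\<lambda>i j. corr n m' const1 i j * (of_real ((1 + overlap2 m)/2) * Spin2 n (sigE \<phi>) (sigE \<phi>) i j + of_real ((1 - overlap2 m)/2) * Spin2 n (sig 3) (sig 3) i j))"
  unfolding effect_def ymat_yv2 corr_Spin2_sig2 mm_add_left mm_add_right mm_scale_left mm_scale_right
    Spin2_conj[OF Umat_unitary] Umat_sig2 Umat_sig1 by (rule refl)

text \<open>Transverse spins have zero diagonal in the eigenbasis of J_3, and an entrywise
  multiplier keeps it zero. The state at \<open>thz r\<close> is diagonal, so mixed moments with z
  vanish there.\<close>

lemma effect_xz: "effect n m m' \<phi> const1 (ptr_val n m) h i i = 0"
  unfolding effect_def ymat_const corr_ptr_val_one Spin_conj[OF Umat_unitary(1)] Umat_sig3 by (simp add: Spin_sigA Spin_offdiag_zero)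

lemma effect_yz: "effect n m m' \<phi> (spin_val n) const1 h i i = 0"
  unfolding effect_def ymat_spin_val corr_Spin_sig2 mm_scale_left mm_scale_right Spin_conj[OF Umat_unitary(1)] Umat_sig2
  by (simp add: Spin_sigE Spin_offdiag_zero)

subsection \<open>Moments of the estimator\<close>

definition expect :: "nat \<Rightarrow> nat \<Rightarrow> nat \<Rightarrow> real \<Rightarrow> real^3 \<Rightarrow> (nat \<times> nat \<times> nat \<Rightarrow> real) \<Rightarrow> real" where
  "expect n m m' \<phi> \<theta> F = (\<Sum>\<omega>\<in>outcomes n m m'. F \<omega> * qprob (2^n) (effvec n m m' \<phi> \<omega>) (tpow n (rho \<theta>)))"

lemma expect_add: "expect n m m' \<phi> \<theta> (\<lambda>\<omega>. F \<omega> + H \<omega>) = expect n m m' \<phi> \<theta> F + expect n m m' \<phi> \<theta> H"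
  by (simp add: expect_def algebra_simps sum.distrib)

lemma expect_scale: "expect n m m' \<phi> \<theta> (\<lambda>\<omega>. c * F \<omega>) = c * expect n m m' \<phi> \<theta> F"
  by (simp add: expect_def sum_distrib_left mult.assoc)

lemma expect_product:
  "expect n m m' \<phi> \<theta> (\<lambda>(b,x,z). f b * g x * h z) = Re (tr (2^n) (mm (2^n) (effect n m m' \<phi> f g h) (tpow n (rho \<theta>))))"
proof -
  let ?d = "2^n :: nat" and ?Z = "tpow n (rho \<theta>)" and ?p = "effvec n m m' \<phi>"
  let ?F = "\<lambda>(b,x,z). f b * g x * h z"
  have "expect n m m' \<phi> \<theta> ?F = Re (\<Sum>\<omega>\<in>outcomes n m m'. of_real (?F \<omega>) * (\<Sum>i<?d. \<Sum>j<?d. ?p \<omega> i * cnj (?p \<omega> j) * ?Z j i))"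
    unfolding expect_def qprob_def Re_sum by (intro sum.cong refl) simp
  also have "(\<Sum>\<omega>\<in>outcomes n m m'. of_real (?F \<omega>) * (\<Sum>i<?d. \<Sum>j<?d. ?p \<omega> i * cnj (?p \<omega> j) * ?Z j i)) =
     (\<Sum>\<omega>\<in>outcomes n m m'. \<Sum>i<?d. \<Sum>j<?d. (of_real (?F \<omega>) * (?p \<omega> i * cnj (?p \<omega> j))) * ?Z j i)"
    unfolding sum_distrib_left by (simp only: mult.assoc)
  also have "\<dots> = (\<Sum>i<?d. \<Sum>\<omega>\<in>outcomes n m m'. \<Sum>j<?d. (of_real (?F \<omega>) * (?p \<omega> i * cnj (?p \<omega> j))) * ?Z j i)"
    by (rule sum.swap)
  also have "\<dots> = (\<Sum>i<?d. \<Sum>j<?d. \<Sum>\<omega>\<in>outcomes n m m'. (of_real (?F \<omega>) * (?p \<omega> i * cnj (?p \<omega> j))) * ?Z j i)"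
    by (intro sum.cong refl sum.swap)
  also have "\<dots> = (\<Sum>i<?d. \<Sum>j<?d. effect n m m' \<phi> f g h i j * ?Z j i)"
  proof (intro sum.cong refl)
    fix i j
    have "(\<Sum>\<omega>\<in>outcomes n m m'. of_real (?F \<omega>) * (?p \<omega> i * cnj (?p \<omega> j))) = effect n m m' \<phi> f g h i j"
      unfolding effvec_moment[symmetric] by (intro sum.cong refl) auto
    then show "(\<Sum>\<omega>\<in>outcomes n m m'. (of_real (?F \<omega>) * (?p \<omega> i * cnj (?p \<omega> j))) * ?Z j i) = effect n m m' \<phi> f g h i j * ?Z j i"
      by (simp only: sum_distrib_right[symmetric])
  qed
  finally show ?thesis by (simp add: tr_def mm_def)
qed

lemma trace_rho: "trace (rho \<theta>) = 1"
  by (simp add: trace_def sum_2 rho_def sum_3 sig_entries)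

lemma trace_sig_rho:
  "trace (sigA \<phi> ** rho \<theta>) = of_real ((cos \<phi> * \<theta>$1 + sin \<phi> * \<theta>$2)/2)"
  "trace (sigE \<phi> ** rho \<theta>) = of_real ((sin \<phi> * \<theta>$1 - cos \<phi> * \<theta>$2)/2)"
  "trace (sig 3 ** rho \<theta>) = of_real (\<theta>$3/2)"
  by (simp_all add: trace_def sum_2 matrix_matrix_mult_def rho_def sum_3 sig_entries sigA_def sigE_def complex_eq_iff field_simps)

lemma sig_squares:
  "sigA \<phi> ** sigA \<phi> = (\<chi> a b. if a = b then 1/4 else 0)"
  "sigE \<phi> ** sigE \<phi> = (\<chi> a b. if a = b then 1/4 else 0)"
  "sig 3 ** sig 3 = (\<chi> a b. if a = b then 1/4 else 0)"
proof -
  have c: "(sin \<phi>)^2 + (cos \<phi>)^2 = 1" by simp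
  then have c': "sin \<phi> * sin \<phi> = 1 - cos \<phi> * cos \<phi>" by (simp add: power2_eq_square)
  show "sigA \<phi> ** sigA \<phi> = (\<chi> a b. if a = b then 1/4 else 0)"
    "sigE \<phi> ** sigE \<phi> = (\<chi> a b. if a = b then 1/4 else 0)"
    "sig 3 ** sig 3 = (\<chi> a b. if a = b then 1/4 else 0)"
    by (rule mat2_eqI; simp add: matrix_matrix_mult_def sum_2 sig_entries sigA_def sigE_def complex_eq_iff field_simps c')+
qed

lemma trace_quarter_rho: "trace ((\<chi> a b. if a = b then 1/4 else 0) ** rho \<theta>) = 1/4"
proof -
  have "trace ((\<chi> a b. if a = b then 1/4 else 0) ** rho \<theta>) = 1/4 * trace (rho \<theta>)"
    by (simp add: trace_def sum_2 matrix_matrix_mult_def)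
  then show ?thesis by (simp add: trace_rho)
qed

text \<open>The factors 1 keep every integrand in the product form of
  \<open>expect_product\<close>.\<close>

lemma expect_first_moments:
  "expect n m m' \<phi> \<theta> (\<lambda>(b,x,z). 1 * 1 * 1) = 1"
  "expect n m m' \<phi> \<theta> (\<lambda>(b,x,z). 1 * ptr_val n m x * 1) = overlap1 m' * (real n * (cos \<phi> * \<theta>$1 + sin \<phi> * \<theta>$2)/2)"
  "expect n m m' \<phi> \<theta> (\<lambda>(b,x,z). spin_val n b * 1 * 1) = overlap1 m * overlap1 m' * (real n * (sin \<phi> * \<theta>$1 - cos \<phi> * \<theta>$2)/2)"
  "expect n m m' \<phi> \<theta> (\<lambda>(b,x,z). 1 * 1 * ptr_val n m' z) = real n * \<theta>$3/2"
  unfolding expect_product effect_one effect_x effect_y effect_z mm_scale_left tr_scale tr_Spin_tpow[OF trace_rho] trace_sig_rho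
  by (simp_all add: tr_tpow trace_rho)

lemma tr_thz: "tr (2^n) (mm (2^n) A (tpow n (rho (thz r)))) = (\<Sum>i<2^n. A i i * of_real (eigprod n r i))"
proof -
  have "mm (2^n) A (tpow n (rho (thz r))) i i = A i i * of_real (eigprod n r i)" if "i < 2^n" for i
  proof -
    have "mm (2^n) A (tpow n (rho (thz r))) i i = (\<Sum>k<2^n. if k = i then A i i * of_real (eigprod n r i) else 0)"
      unfolding mm_def using that by (intro sum.cong refl) (auto simp: tpow_thz_diag)
    then show ?thesis using that by simp
  qed
  then show ?thesis by (simp add: tr_def)
qed

text \<open>The state is diagonal and \<open>corr\<close> is 1 on the diagonal: at
  \<open>thz r\<close> the pointer on J_3 disturbs no later expectation.\<close>

lemma tr_corr_thz: "tr (2^n) (mm (2^n) (\<lambda>i j. corr n m const1 i j * A i j) (tpow n (rho (thz r)))) = tr (2^n) (mm (2^n) A (tpow n (rho (thz r))))"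
  by (simp add: tr_thz corr_diag)

lemma tr_Spin2_thz: "tr (2^n) (mm (2^n) (Spin2 n s s) (tpow n (rho \<theta>))) =
   of_nat n * trace (s ** s ** rho \<theta>) + of_nat n * (of_nat n - 1) * (trace (s ** rho \<theta>))^2"
  unfolding Spin2_def by (rule tr_Spin_Spin_tpow[OF trace_rho])

lemma expect_second_moments:
  "expect n m m' \<phi> (thz r) (\<lambda>(b,x,z). 1 * (ptr_val n m x)^2 * 1) = real n / 4 + ptr_var m"
  "expect n m m' \<phi> (thz r) (\<lambda>(b,x,z). (spin_val n b)^2 * 1 * 1) =
      (1 + overlap2 m)/2 * (real n / 4) + (1 - overlap2 m)/2 * (real n / 4 + real n * (real n - 1) * r^2 / 4)"
  "expect n m m' \<phi> (thz r) (\<lambda>(b,x,z). 1 * 1 * (ptr_val n m' z)^2) = real n / 4 + real n * (real n - 1) * r^2 / 4 + ptr_var m'"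
  "expect n m m' \<phi> (thz r) (\<lambda>(b,x,z). 1 * ptr_val n m x * ptr_val n m' z) = 0"
  "expect n m m' \<phi> (thz r) (\<lambda>(b,x,z). spin_val n b * 1 * ptr_val n m' z) = 0"
proof -
  have t: "thz r $ 1 = 0" "thz r $ 2 = 0" "thz r $ 3 = r" by (simp_all add: thz_def)
  note simps = expect_product tr_corr_thz mm_add_left mm_scale_left tr_add tr_scale tr_Spin2_thz sig_squares trace_quarter_rho trace_sig_rho t mm_one_n tr_tpow trace_rho
  show "expect n m m' \<phi> (thz r) (\<lambda>(b,x,z). 1 * (ptr_val n m x)^2 * 1) = real n / 4 + ptr_var m"
    unfolding expect_product effect_xx simps by simp
  show "expect n m m' \<phi> (thz r) (\<lambda>(b,x,z). (spin_val n b)^2 * 1 * 1) =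
      (1 + overlap2 m)/2 * (real n / 4) + (1 - overlap2 m)/2 * (real n / 4 + real n * (real n - 1) * r^2 / 4)"
  proof -
    have "tr (2^n) (mm (2^n) (effect n m m' \<phi> (\<lambda>b. (spin_val n b)^2) const1 const1) (tpow n (rho (thz r)))) =
      of_real ((1 + overlap2 m)/2 * (real n / 4) + (1 - overlap2 m)/2 * (real n / 4 + real n * (real n - 1) * r^2 / 4))"
      unfolding effect_yy simps by (simp add: power_divide)
    then show ?thesis unfolding expect_product by (simp only: Re_complex_of_real)
  qed
  show "expect n m m' \<phi> (thz r) (\<lambda>(b,x,z). 1 * 1 * (ptr_val n m' z)^2) = real n / 4 + real n * (real n - 1) * r^2 / 4 + ptr_var m'"
  proof -
    have "tr (2^n) (mm (2^n) (effect n m m' \<phi> const1 const1 (\<lambda>z. (ptr_val n m' z)^2)) (tpow n (rho (thz r)))) =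
      of_real (real n / 4 + real n * (real n - 1) * r^2 / 4 + ptr_var m')"
      unfolding effect_zz simps by (simp add: power_divide)
    then show ?thesis unfolding expect_product by (simp only: Re_complex_of_real)
  qed
  show "expect n m m' \<phi> (thz r) (\<lambda>(b,x,z). 1 * ptr_val n m x * ptr_val n m' z) = 0"
    unfolding expect_product tr_thz by (simp add: effect_xz)
  show "expect n m m' \<phi> (thz r) (\<lambda>(b,x,z). spin_val n b * 1 * ptr_val n m' z) = 0"
    unfolding expect_product tr_thz by (simp add: effect_yz)
qed

text \<open>Each copy contributes half a parameter to the mean spin, whence 2 / n. The readings x
  and b are coordinates along a and e, turned back to the first two axes.\<close>

definition estim :: "nat \<Rightarrow> nat \<Rightarrow> nat \<Rightarrow> real \<Rightarrow> nat \<times> nat \<times> nat \<Rightarrow> real^3" where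
  "estim n m m' \<phi> = (\<lambda>(b,x,z). (2 / real n) *\<^sub>R
     vector [cos \<phi> * ptr_val n m x + sin \<phi> * spin_val n b, sin \<phi> * ptr_val n m x - cos \<phi> * spin_val n b, ptr_val n m' z])"

definition estimator :: "nat \<Rightarrow> nat \<Rightarrow> nat \<Rightarrow> real \<Rightarrow> (real^3) set \<Rightarrow> cmat" where
  "estimator n m m' \<phi> = fin_povm (outcomes n m m') (estim n m m' \<phi>) (effvec n m m' \<phi>)"

lemma estim_entries:
  "estim n m m' \<phi> (b,x,z) $ 1 = (2 / real n) * (cos \<phi> * ptr_val n m x + sin \<phi> * spin_val n b)"
  "estim n m m' \<phi> (b,x,z) $ 2 = (2 / real n) * (sin \<phi> * ptr_val n m x - cos \<phi> * spin_val n b)"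
  "estim n m m' \<phi> (b,x,z) $ 3 = (2 / real n) * ptr_val n m' z"
  by (simp_all add: estim_def)

lemma finite_outcomes: "finite (outcomes n m m')" by (simp add: outcomes_def)

lemma povm_estimator: "is_povm (2^n) (estimator n m m' \<phi>)"
  unfolding estimator_def
proof (rule fin_povm_is_povm[OF finite_outcomes])
  fix i j :: nat assume ij: "i < 2^n" "j < 2^n"
  have "(\<Sum>\<omega>\<in>outcomes n m m'. effvec n m m' \<phi> \<omega> i * cnj (effvec n m m' \<phi> \<omega> j)) = effect n m m' \<phi> const1 const1 const1 i j"
    unfolding effvec_moment[symmetric] by (intro sum.cong refl) auto
  then show "(\<Sum>\<omega>\<in>outcomes n m m'. effvec n m m' \<phi> \<omega> i * cnj (effvec n m m' \<phi> \<omega> j)) = (if i = j then 1 else 0)"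
    using ij by (simp add: effect_one one_n_less)
qed

lemma integral_estimator:
  assumes "\<theta> \<in> Theta" "f \<in> borel_measurable borel"
  shows "integrable (Pn n (estimator n m m' \<phi>) \<theta>) f"
    "integral\<^sup>L (Pn n (estimator n m m' \<phi>) \<theta>) f = expect n m m' \<phi> \<theta> (\<lambda>\<omega>. f (estim n m m' \<phi> \<omega>))"
  using integral_fin_povm[OF povm_estimator[unfolded estimator_def] finite_outcomes gram_tpow[OF assms(1)] assms(2)]
  by (simp_all add: Pn_def estimator_def expect_def)

text \<open>With a and e the two equatorial unit vectors this is c' a a^T + c e e^T + e_3 e_3^T: the
  mean along a is reduced by the first pointer, the mean along e by both, and the third component is
  unbiased.\<close>

definition mean_mat :: "real \<Rightarrow> real \<Rightarrow> real \<Rightarrow> real^3^3" where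
  "mean_mat \<phi> c c' = (\<chi> j k. c' * (vector [cos \<phi>, sin \<phi>, 0] :: real^3) $ j * (vector [cos \<phi>, sin \<phi>, 0] :: real^3) $ k
     + c * (vector [sin \<phi>, - cos \<phi>, 0] :: real^3) $ j * (vector [sin \<phi>, - cos \<phi>, 0] :: real^3) $ k
     + (if j = 3 \<and> k = 3 then 1 else 0))"

lemma Emean_estimator:
  assumes "\<theta> \<in> Theta" "n > 0"
  shows "Emean n (estimator n m m' \<phi>) \<theta> $ j = (\<Sum>k\<in>UNIV. mean_mat \<phi> (overlap1 m * overlap1 m') (overlap1 m') $ j $ k * \<theta> $ k)"
proof -
  have m: "(\<lambda>x::real^3. x $ j) \<in> borel_measurable borel" for j by simp
  have E: "Emean n (estimator n m m' \<phi>) \<theta> $ j = expect n m m' \<phi> \<theta> (\<lambda>\<omega>. estim n m m' \<phi> \<omega> $ j)" for j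
    by (simp add: Emean_def integral_estimator[OF assms(1) m])
  have 1: "(\<lambda>\<omega>. estim n m m' \<phi> \<omega> $ 1) = (\<lambda>\<omega>. (2 / real n * cos \<phi>) * (\<lambda>(b,x,z). 1 * ptr_val n m x * 1) \<omega> + (2 / real n * sin \<phi>) * (\<lambda>(b,x,z). spin_val n b * 1 * 1) \<omega>)"
    by (auto simp: estim_entries algebra_simps)
  have 2: "(\<lambda>\<omega>. estim n m m' \<phi> \<omega> $ 2) = (\<lambda>\<omega>. (2 / real n * sin \<phi>) * (\<lambda>(b,x,z). 1 * ptr_val n m x * 1) \<omega> + (- (2 / real n * cos \<phi>)) * (\<lambda>(b,x,z). spin_val n b * 1 * 1) \<omega>)"
    by (auto simp: estim_entries algebra_simps)
  have 3: "(\<lambda>\<omega>. estim n m m' \<phi> \<omega> $ 3) = (\<lambda>\<omega>. (2 / real n) * (\<lambda>(b,x,z). 1 * 1 * ptr_val n m' z) \<omega>)"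
    by (auto simp: estim_entries)
  have "\<forall>j. Emean n (estimator n m m' \<phi>) \<theta> $ j = (\<Sum>k\<in>UNIV. mean_mat \<phi> (overlap1 m * overlap1 m') (overlap1 m') $ j $ k * \<theta> $ k)"
    unfolding forall_3 E 1 2 3 expect_add expect_scale expect_first_moments using assms(2)
    by (simp add: sum_3 mean_mat_def field_simps)
  then show ?thesis by blast
qed

lemma derivative_Emean_estimator:
  assumes r: "\<bar>r\<bar> < 1" and n: "n > 0"
  shows "((\<lambda>t. Emean n (estimator n m m' \<phi>) (thz r + t *\<^sub>R axis k 1) $ j) has_vector_derivative
     mean_mat \<phi> (overlap1 m * overlap1 m') (overlap1 m') $ j $ k) (at 0)"
proof -
  let ?l = "mean_mat \<phi> (overlap1 m * overlap1 m') (overlap1 m')" and ?L = "\<lambda>t. thz r + t *\<^sub>R axis k 1"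
  let ?E = "\<lambda>t. (\<Sum>i\<in>UNIV. ?l $ j $ i * thz r $ i) + t * ?l $ j $ k"
  have "continuous_on UNIV ?L" by (intro continuous_intros)
  then have "open (?L -` Theta)" using open_Theta by (rule open_vimage[rotated])
  moreover have "0 \<in> ?L -` Theta" using thz_Theta[OF r] by simp
  moreover have "?E t = Emean n (estimator n m m' \<phi>) (?L t) $ j" if "t \<in> ?L -` Theta" for t
  proof -
    have "(\<Sum>i\<in>UNIV. ?l $ j $ i * (?L t) $ i) = (\<Sum>i\<in>UNIV. ?l $ j $ i * thz r $ i + (if i = k then t * ?l $ j $ k else 0))"
      by (intro sum.cong refl) (auto simp: axis_def algebra_simps)
    then show ?thesis using that Emean_estimator[of "?L t" n m m' \<phi> j] n by (simp add: sum.distrib)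
  qed
  moreover have "(?E has_vector_derivative ?l $ j $ k) (at 0)"
    by (auto intro!: derivative_eq_intros)
  ultimately show ?thesis
    by (rule has_vector_derivative_transform_within_open[rotated])
qed

text \<open>The joint moment of x and b never has to be evaluated: by \<open>ae\<close> the vectors
  a and e diagonalize the upper block of G, so its coefficient is zero.\<close>

lemma nTrGV_estimator:
  fixes G :: "real^3^3"
  assumes r: "\<bar>r\<bar> < 1" and n: "n > 0"
    and g: "G$2$1 = G$1$2" "G$3$1 = G$1$3" "G$3$2 = G$2$3"
    and ae: "cos \<phi> * sin \<phi> * (G$1$1 - G$2$2) = ((cos \<phi>)^2 - (sin \<phi>)^2) * G$1$2"
  shows "nTrGV n G (estimator n m m' \<phi>) (thz r) = ereal (
      ((cos \<phi>)^2 * G$1$1 + 2 * cos \<phi> * sin \<phi> * G$1$2 + (sin \<phi>)^2 * G$2$2) * (1 + 4 * ptr_var m / real n)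
    + ((sin \<phi>)^2 * G$1$1 - 2 * cos \<phi> * sin \<phi> * G$1$2 + (cos \<phi>)^2 * G$2$2) * (1 + (1 - overlap2 m)/2 * (real n - 1) * r^2)
    + G$3$3 * (1 - r^2 + 4 * ptr_var m' / real n))"
proof -
  let ?M = "estimator n m m' \<phi>" and ?E = "expect n m m' \<phi> (thz r)"
  let ?P = "Pn n ?M (thz r)" and ?c = "cos \<phi>" and ?s = "sin \<phi>" and ?h = "2 / real n"
  define gaa where "gaa = ?c^2 * G$1$1 + 2 * ?c * ?s * G$1$2 + ?s^2 * G$2$2"
  define gee where "gee = ?s^2 * G$1$1 - 2 * ?c * ?s * G$1$2 + ?c^2 * G$2$2"
  define ga3 where "ga3 = ?c * G$1$3 + ?s * G$2$3"
  define ge3 where "ge3 = ?s * G$1$3 - ?c * G$2$3"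
  have th: "thz r \<in> Theta" by (rule thz_Theta[OF r])
  have t: "thz r $ 1 = 0" "thz r $ 2 = 0" "thz r $ 3 = r" by (simp_all add: thz_def)
  have int: "integrable ?P (\<lambda>x. (x$j - thz r$j)^2)" for j
    by (rule integral_estimator[OF th]) simp
  have V: "Vmat n ?M (thz r) $ k $ j = ?E (\<lambda>\<omega>. (estim n m m' \<phi> \<omega> $ k - thz r $ k) * (estim n m m' \<phi> \<omega> $ j - thz r $ j))" for j k
  proof -
    have m: "(\<lambda>x::real^3. (x$k - thz r$k) * (x$j - thz r$j)) \<in> borel_measurable borel" by simp
    show ?thesis unfolding Vmat_def using integral_estimator(2)[OF th m] by simp
  qed
  have "trace (G ** Vmat n ?M (thz r)) = ?E (\<lambda>\<omega>. \<Sum>j\<in>UNIV. \<Sum>k\<in>UNIV. G$j$k * ((estim n m m' \<phi> \<omega> $ k - thz r $ k) * (estim n m m' \<phi> \<omega> $ j - thz r $ j)))"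
    unfolding sum_3 expect_add expect_scale V[symmetric] by (simp add: trace_def matrix_matrix_mult_def sum_3)
  also have "(\<lambda>\<omega>. \<Sum>j\<in>UNIV. \<Sum>k\<in>UNIV. G$j$k * ((estim n m m' \<phi> \<omega> $ k - thz r $ k) * (estim n m m' \<phi> \<omega> $ j - thz r $ j)))
     = (\<lambda>\<omega>. (?h^2 * gaa) * (\<lambda>(b,x,z). 1 * (ptr_val n m x)^2 * 1) \<omega>
         + (?h^2 * gee) * (\<lambda>(b,x,z). (spin_val n b)^2 * 1 * 1) \<omega>
         + (2 * ?h^2 * ga3) * (\<lambda>(b,x,z). 1 * ptr_val n m x * ptr_val n m' z) \<omega>
         + (2 * ?h^2 * ge3) * (\<lambda>(b,x,z). spin_val n b * 1 * ptr_val n m' z) \<omega>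
         + (- 2 * ?h * r * ga3) * (\<lambda>(b,x,z). 1 * ptr_val n m x * 1) \<omega>
         + (- 2 * ?h * r * ge3) * (\<lambda>(b,x,z). spin_val n b * 1 * 1) \<omega>
         + (?h^2 * G$3$3) * (\<lambda>(b,x,z). 1 * 1 * (ptr_val n m' z)^2) \<omega>
         + (- 2 * ?h * r * G$3$3) * (\<lambda>(b,x,z). 1 * 1 * ptr_val n m' z) \<omega>
         + (r^2 * G$3$3) * (\<lambda>(b,x,z). 1 * 1 * 1) \<omega>)" (is "?l = ?r")
  proof
    fix \<omega> :: "nat \<times> nat \<times> nat"
    obtain b x z where w: "\<omega> = (b,x,z)" by (cases \<omega>)
    have *: "(\<Sum>j\<in>UNIV. \<Sum>k\<in>UNIV. G$j$k * ((estim n m m' \<phi> (b,x,z) $ k - thz r $ k) * (estim n m m' \<phi> (b,x,z) $ j - thz r $ j)))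
      = h^2 * gaa * X^2 + h^2 * gee * Y^2 + 2 * h^2 * ga3 * (X * Z) + 2 * h^2 * ge3 * (Y * Z)
        - 2 * h * r * ga3 * X - 2 * h * r * ge3 * Y + h^2 * G$3$3 * Z^2 - 2 * h * r * G$3$3 * Z + r^2 * G$3$3
        + 2 * h^2 * X * Y * (?c * ?s * (G$1$1 - G$2$2) - (?c^2 - ?s^2) * G$1$2)"
      if "X = ptr_val n m x" "Y = spin_val n b" "Z = ptr_val n m' z" "h = ?h" for X Y Z h
      unfolding sum_3 estim_entries t g that[symmetric] gaa_def gee_def ga3_def ge3_def
      by (simp add: power2_eq_square algebra_simps)
    show "?l \<omega> = ?r \<omega>"
      unfolding w *[OF refl refl refl refl] ae by simp
  qed
  also have "?E \<dots> = ?h^2 * gaa * (real n / 4 + ptr_var m)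
      + ?h^2 * gee * ((1 + overlap2 m)/2 * (real n / 4) + (1 - overlap2 m)/2 * (real n / 4 + real n * (real n - 1) * r^2 / 4))
      + ?h^2 * G$3$3 * (real n / 4 + real n * (real n - 1) * r^2 / 4 + ptr_var m')
      - 2 * ?h * r * G$3$3 * (real n * r / 2) + r^2 * G$3$3"
    unfolding expect_add expect_scale expect_first_moments expect_second_moments t by simp
  finally have T: "trace (G ** Vmat n ?M (thz r)) = \<dots>" .
  have "real n * trace (G ** Vmat n ?M (thz r)) =
      gaa * (1 + 4 * ptr_var m / real n) + gee * (1 + (1 - overlap2 m)/2 * (real n - 1) * r^2) + G$3$3 * (1 - r^2 + 4 * ptr_var m' / real n)"
  proof -
    have 1: "real n * (?h^2 * A * (real n / 4 + S)) = A * (1 + 4 * S / real n)" for A S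
      using n by (simp add: power2_eq_square field_simps)
    have 2: "real n * (?h^2 * A * ((1 + q)/2 * (real n / 4) + (1 - q)/2 * (real n / 4 + real n * (real n - 1) * r^2 / 4)))
      = A * (1 + (1 - q)/2 * (real n - 1) * r^2)" for A q
      using n by (simp add: power2_eq_square field_simps)
    have 3: "real n * (?h^2 * A * (real n / 4 + real n * (real n - 1) * r^2 / 4 + S) - 2 * ?h * r * A * (real n * r / 2) + r^2 * A)
      = A * (1 - r^2 + 4 * S / real n)" for A S
      using n by (simp add: power2_eq_square field_simps)
    show ?thesis
      unfolding T 1[symmetric] 2[symmetric] 3[symmetric] by (simp add: algebra_simps)
  qed
  then show ?thesis using int by (simp add: nTrGV_def gaa_def gee_def)
qed

subsection \<open>Asymptotics\<close>

lemma overlap1_lim: "filterlim m at_top sequentially \<Longrightarrow> (\<lambda>n. overlap1 (m n)) \<longlonglongrightarrow> 1"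
proof -
  assume m: "filterlim m at_top sequentially"
  have "(\<lambda>k::nat. real k / (real k + 1)) \<longlonglongrightarrow> 1" by real_asymp
  from filterlim_compose[OF this m] show ?thesis by (simp add: overlap1_def)
qed

lemma ptr_var_lim:
  assumes m: "filterlim m at_top sequentially" and q: "(\<lambda>n. real (m n) / real n) \<longlonglongrightarrow> q"
  shows "(\<lambda>n. 4 * ptr_var (m n) / real n) \<longlonglongrightarrow> q / 2"
proof -
  have "(\<lambda>k::nat. real k / (2 * real k - 1)) \<longlonglongrightarrow> 1/2" by real_asymp
  then have lim: "(\<lambda>n. real (m n) / real n * (real (m n) / (2 * real (m n) - 1))) \<longlonglongrightarrow> q * (1/2)"
    by (intro tendsto_mult q filterlim_compose[OF _ m])
  have e: "4 * (x^2 / (4 * D)) / y = x / y * (x / D)" for x y D :: real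
    by (simp add: power2_eq_square)
  show ?thesis unfolding ptr_var_def e using lim by simp
qed

text \<open>The leaked fraction (1 - overlap2)/2 is about 2/m with m about q n, and the n - 1 comes
  from the pairs of distinct copies in the second moment of J_3.\<close>

lemma back_action_lim:
  assumes m: "filterlim m at_top sequentially" and q: "(\<lambda>n. real (m n) / real n) \<longlonglongrightarrow> q" "q > 0"
  shows "(\<lambda>n. (1 - overlap2 (m n))/2 * (real n - 1)) \<longlonglongrightarrow> 2 / q"
proof -
  have "(\<lambda>k::nat. (1 - overlap2 k)/2 * real k) \<longlonglongrightarrow> 2"
    unfolding overlap2_def by real_asymp
  then have 1: "(\<lambda>n. (1 - overlap2 (m n))/2 * real (m n)) \<longlonglongrightarrow> 2"
    using m by (rule filterlim_compose)
  have 2: "(\<lambda>n. (real n - 1) / real n) \<longlonglongrightarrow> 1" by real_asymp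
  have "(\<lambda>n. ((1 - overlap2 (m n))/2 * real (m n)) * (((real n - 1) / real n) / (real (m n) / real n))) \<longlonglongrightarrow> 2 * (1 / q)"
    using q by (intro tendsto_intros 1 2) auto
  moreover have "\<forall>\<^sub>F n in sequentially. ((1 - overlap2 (m n))/2 * real (m n)) * (((real n - 1) / real n) / (real (m n) / real n)) = (1 - overlap2 (m n))/2 * (real n - 1)"
  proof -
    have "\<forall>\<^sub>F n in sequentially. m n \<ge> 1" using m by (simp add: filterlim_at_top)
    then show ?thesis
      using eventually_gt_at_top[of 0] by eventually_elim (auto simp: field_simps)
  qed
  ultimately have "(\<lambda>n. (1 - overlap2 (m n))/2 * (real n - 1)) \<longlonglongrightarrow> 2 * (1 / q)"
    by (rule Lim_transform_eventually)
  then show ?thesis by simp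
qed

lemma floor_sqrt_lim: "filterlim (\<lambda>n. nat \<lfloor>sqrt (real n)\<rfloor>) at_top sequentially"
  "(\<lambda>n. real (nat \<lfloor>sqrt (real n)\<rfloor>) / real n) \<longlonglongrightarrow> 0"
  by real_asymp+

lemma pointer_size_lim:
  assumes "q \<ge> 0"
  shows "(\<lambda>n. real (nat \<lfloor>q * real n\<rfloor> + nat \<lfloor>sqrt (real n)\<rfloor>) / real n) \<longlonglongrightarrow> q"
proof -
  have "(\<lambda>n. real (nat \<lfloor>q * real n\<rfloor>) / real n) \<longlonglongrightarrow> q"
  proof (rule tendsto_sandwich)
    have f: "real (nat \<lfloor>q * real n\<rfloor>) = of_int \<lfloor>q * real n\<rfloor>" for n using assms by simp
    show "\<forall>\<^sub>F n in sequentially. q - 1 / real n \<le> real (nat \<lfloor>q * real n\<rfloor>) / real n"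
      using eventually_gt_at_top[of 0]
    proof eventually_elim
      case (elim n)
      have "q * real n - 1 \<le> of_int \<lfloor>q * real n\<rfloor>" by linarith
      then have "(q * real n - 1) / real n \<le> of_int \<lfloor>q * real n\<rfloor> / real n"
        by (rule divide_right_mono) simp
      then show ?case unfolding f using elim by (simp add: diff_divide_distrib)
    qed
    show "\<forall>\<^sub>F n in sequentially. real (nat \<lfloor>q * real n\<rfloor>) / real n \<le> q"
      using eventually_gt_at_top[of 0]
    proof eventually_elim
      case (elim n)
      have "of_int \<lfloor>q * real n\<rfloor> \<le> q * real n" by linarith
      then show ?case unfolding f using elim by (simp add: field_simps)
    qed
    show "(\<lambda>n. q - 1 / real n) \<longlonglongrightarrow> q" by real_asymp
  qed simp
  from tendsto_add[OF this floor_sqrt_lim(2)] show ?thesis by (simp add: add_divide_distrib)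
qed

text \<open>The principal axis lies at half the argument of (a - b) + 2 i c; the rest is the
  double-angle formulas.\<close>

lemma diagonalizing_angle: "\<exists>\<phi>. cos \<phi> * sin \<phi> * (a - b) = ((cos \<phi>)^2 - (sin \<phi>)^2) * (c::real)"
proof -
  define z where "z = Complex (a - b) (2 * c)"
  define \<phi> where "\<phi> = Arg z / 2"
  have "rcis (cmod z) (2 * \<phi>) = z" by (simp add: \<phi>_def rcis_cmod_Arg)
  then have "cmod z * cos (2 * \<phi>) = a - b" "cmod z * sin (2 * \<phi>) = 2 * c"
    by (simp_all add: z_def complex_eq_iff rcis_def)
  then have "sin (2 * \<phi>) * (a - b) = cos (2 * \<phi>) * (2 * c)" by (metis mult.left_commute mult.commute)
  then have "cos \<phi> * sin \<phi> * (a - b) = ((cos \<phi>)^2 - (sin \<phi>)^2) * c"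
    unfolding sin_double cos_double by algebra
  then show ?thesis by blast
qed

lemma mean_mat_limit:
  assumes "c \<longlonglongrightarrow> 1" "c' \<longlonglongrightarrow> 1"
  shows "(\<lambda>n. mean_mat \<phi> (c n) (c' n)) \<longlonglongrightarrow> mat 1"
proof -
  have cs: "cos \<phi> * cos \<phi> + sin \<phi> * sin \<phi> = 1" "sin \<phi> * sin \<phi> + cos \<phi> * cos \<phi> = 1"
    using sin_cos_squared_add[of \<phi>] by (simp_all add: power2_eq_square add.commute)
  have "mean_mat \<phi> 1 1 = mat 1"
    by (simp add: vec_eq_iff forall_3 mean_mat_def mat_def cs)
  moreover have "(\<lambda>n. mean_mat \<phi> (c n) (c' n)) \<longlonglongrightarrow> mean_mat \<phi> 1 1"
    unfolding mean_mat_def by (intro tendsto_intros assms tendsto_vec_lambda)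
  ultimately show ?thesis by simp
qed

theorem RLD_bound_achieved:
  fixes G :: "real^3^3"
  assumes r: "0 \<le> r" "r < 1" and sym: "transpose G = G" and pos: "\<forall>x. x \<noteq> 0 \<longrightarrow> 0 < x \<bullet> (G *v x)"
  shows "\<exists>Ms. asym_unbiased (thz r) Ms \<and>
    (\<lambda>n. nTrGV n G (Ms n) (thz r)) \<longlonglongrightarrow>
       ereal (RLD_value r G)"
proof -
  note g = posdef_minors[OF sym pos]
  have r': "\<bar>r\<bar> < 1" using r by simp
  obtain \<phi> where ae: "cos \<phi> * sin \<phi> * (G$1$1 - G$2$2) = ((cos \<phi>)^2 - (sin \<phi>)^2) * G$1$2"
    using diagonalizing_angle by blast
  let ?c = "cos \<phi>" and ?s = "sin \<phi>"
  define A where "A = ?c^2 * G$1$1 + 2 * ?c * ?s * G$1$2 + ?s^2 * G$2$2"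
  define E where "E = ?s^2 * G$1$1 - 2 * ?c * ?s * G$1$2 + ?c^2 * G$2$2"
  have cs: "?c^2 + ?s^2 = 1" by simp
  have A: "A > 0"
  proof -
    let ?x = "vector [?c, ?s, 0] :: real^3"
    have "?x \<noteq> 0"
    proof
      assume "?x = 0"
      then have "?x $ 1 = 0" "?x $ 2 = 0" by (simp_all only: zero_index)
      then have "?c^2 = 0" "?s^2 = 0" by simp_all
      then show False using cs by linarith
    qed
    then have "0 < ?x \<bullet> (G *v ?x)" using pos by blast
    also have "?x \<bullet> (G *v ?x) = A"
      by (simp add: A_def inner_vec_def matrix_vector_mult_def sum_3 g(2) power2_eq_square algebra_simps)
    finally show ?thesis .
  qed
  have sumAE: "A + E = G$1$1 + G$2$2"
  proof -
    have "A + E = (?c^2 + ?s^2) * (G$1$1 + G$2$2)" unfolding A_def E_def by algebra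
    then show ?thesis by (simp only: cs mult_1)
  qed
  have AE: "A * E = G$1$1 * G$2$2 - (G$1$2)^2"
  proof -
    \<comment> \<open>Rotation invariance of the determinant; the last square is the off-diagonal
      entry in the rotated frame, zero by \<open>ae\<close>.\<close>
    have "A * E = (?c^2 + ?s^2)^2 * (G$1$1 * G$2$2 - (G$1$2)^2) + (?c * ?s * (G$1$1 - G$2$2) - (?c^2 - ?s^2) * G$1$2)^2"
      unfolding A_def E_def by algebra
    then show ?thesis by (simp add: cs ae)
  qed
  have E: "E > 0" using AE g(5) A by (metis zero_less_mult_pos)
  \<comment> \<open>At pointer size 2 r t n the noise term r A t and the back-action term r E / t
    coincide, which minimizes their sum.\<close>
  define t where "t = sqrt (E / A)"
  have t: "t > 0" using A E by (simp add: t_def)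
  have At: "A * t = sqrt (A * E)" and Et: "E / t = sqrt (A * E)"
  proof -
    have "A * t = sqrt (A^2 * (E / A))" unfolding t_def real_sqrt_mult using A by simp
    also have "A^2 * (E / A) = A * E" using A by (simp add: power2_eq_square)
    finally show At: "A * t = sqrt (A * E)" .
    have "t * t = E / A" using A E by (simp add: t_def)
    then have "E / t = A * t" using A t by (simp add: field_simps)
    then show "E / t = sqrt (A * E)" using At by simp
  qed
  \<comment> \<open>The term \<open>2 r t n\<close> balances pointer noise against back action; the term \<open>sqrt n\<close> keeps the
    back action negligible when \<open>r = 0\<close>.\<close>
  define m where "m n = nat \<lfloor>(2 * r * t) * real n\<rfloor> + nat \<lfloor>sqrt (real n)\<rfloor>" for n
  define m' where "m' n = nat \<lfloor>sqrt (real n)\<rfloor>" for n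
  have m': "filterlim m' at_top sequentially" "(\<lambda>n. real (m' n) / real n) \<longlonglongrightarrow> 0"
    unfolding m'_def by (rule floor_sqrt_lim)+
  have m: "filterlim m at_top sequentially"
    by (rule filterlim_at_top_mono[OF m'(1)]) (simp add: m_def m'_def)
  have mq: "(\<lambda>n. real (m n) / real n) \<longlonglongrightarrow> 2 * r * t"
    unfolding m_def using r t by (intro pointer_size_lim) simp
  have cc: "(\<lambda>n. overlap1 (m n) * overlap1 (m' n)) \<longlonglongrightarrow> 1" "(\<lambda>n. overlap1 (m' n)) \<longlonglongrightarrow> 1"
    using tendsto_mult[OF overlap1_lim[OF m] overlap1_lim[OF m'(1)]] overlap1_lim[OF m'(1)] by simp_all
  define Ms where "Ms n = estimator n (m n) (m' n) \<phi>" for n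
  define l where "l n = mean_mat \<phi> (overlap1 (m n) * overlap1 (m' n)) (overlap1 (m' n))" for n
  have llim: "l \<longlonglongrightarrow> mat 1" unfolding l_def by (rule mean_mat_limit[OF cc])
  have ev: "\<forall>\<^sub>F n in sequentially. n > (0::nat)" by (rule eventually_gt_at_top)
  have th: "thz r \<in> Theta" by (rule thz_Theta[OF r'])
  have "asym_unbiased (thz r) Ms"
    unfolding asym_unbiased_def
  proof (intro conjI allI)
    show "is_povm (2^n) (Ms n)" for n unfolding Ms_def by (rule povm_estimator)
    show "\<forall>\<^sub>F n in sequentially. (\<exists>U. open U \<and> thz r \<in> U \<and> U \<subseteq> Theta \<and>
             (\<forall>\<theta>'\<in>U. \<forall>j. integrable (Pn n (Ms n) \<theta>') (\<lambda>x. x$j))) \<and>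
        (\<forall>j k. (\<lambda>t::real. Emean n (Ms n) (thz r + t *\<^sub>R axis k 1) $ j) differentiable (at 0))"
      using ev
    proof eventually_elim
      case (elim n)
      have "\<forall>\<theta>'\<in>Theta. \<forall>j. integrable (Pn n (Ms n) \<theta>') (\<lambda>x. x$j)"
        unfolding Ms_def by (intro ballI allI integral_estimator(1)) simp_all
      moreover have "(\<lambda>t::real. Emean n (Ms n) (thz r + t *\<^sub>R axis k 1) $ j) differentiable (at 0)" for j k
        unfolding Ms_def using derivative_Emean_estimator[OF r' elim] by (rule differentiableI_vector)
      ultimately show ?case
        using open_Theta th by (meson order_refl)
    qed
    have e1: "Emean n (Ms n) (thz r) = l n *v thz r" if "n > 0" for n
      using Emean_estimator[OF th that] by (simp add: vec_eq_iff matrix_vector_mult_def Ms_def l_def)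
    have "(\<lambda>n. l n *v thz r) \<longlonglongrightarrow> mat 1 *v thz r"
      unfolding matrix_vector_mult_def by (intro tendsto_vec_lambda tendsto_intros tendsto_vec_nth llim)
    then show "(\<lambda>n. Emean n (Ms n) (thz r)) \<longlonglongrightarrow> thz r"
      using filterlim_cong[OF refl refl eventually_mono[OF ev e1]] by simp
    have e2: "Amat n (Ms n) (thz r) = l n" if "n > 0" for n
      using vector_derivative_at[OF derivative_Emean_estimator[OF r' that]]
      by (simp add: vec_eq_iff Amat_def Ms_def l_def)
    show "(\<lambda>n. Amat n (Ms n) (thz r)) \<longlonglongrightarrow> mat 1"
      using llim filterlim_cong[OF refl refl eventually_mono[OF ev e2]] by simp
  qed
  moreover have "(\<lambda>n. nTrGV n G (Ms n) (thz r)) \<longlonglongrightarrow>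
       ereal (RLD_value r G)"
  proof -
    define N where "N n = A * (1 + 4 * ptr_var (m n) / real n) + E * (1 + (1 - overlap2 (m n))/2 * (real n - 1) * r^2)
        + G$3$3 * (1 - r^2 + 4 * ptr_var (m' n) / real n)" for n
    have eN: "nTrGV n G (Ms n) (thz r) = ereal (N n)" if "n > 0" for n
      unfolding Ms_def N_def A_def E_def by (rule nTrGV_estimator[OF r' that g(2-4) ae])
    have "(\<lambda>n. (1 - overlap2 (m n))/2 * (real n - 1) * r^2) \<longlonglongrightarrow> r / t"
    \<comment> \<open>\<open>back_action_lim\<close> asks for a positive limiting ratio; for r = 0
      the factor r^2 removes the term.\<close>
    proof (cases "r = 0")
      case False
      then have "2 * r * t > 0" using r t by simp
      from tendsto_mult_right[OF back_action_lim[OF m mq this], of "r^2"]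
      show ?thesis using False by (simp add: power2_eq_square)
    qed simp
    then have "N \<longlonglongrightarrow> A * (1 + (2 * r * t) / 2) + E * (1 + r / t) + G$3$3 * (1 - r^2 + 0 / 2)"
      unfolding N_def by (intro tendsto_intros ptr_var_lim m mq m')
    also have "A * (1 + (2 * r * t) / 2) + E * (1 + r / t) + G$3$3 * (1 - r^2 + 0 / 2) =
       (A + E) + r * (A * t) + r * (E / t) + G$3$3 * (1 - r^2)"
      by (simp add: algebra_simps)
    also have "\<dots> = RLD_value r G"
      unfolding At Et sumAE AE by (simp add: RLD_value_def trace_def sum_3 g(2) power2_eq_square algebra_simps)
    finally have "(\<lambda>n. ereal (N n)) \<longlonglongrightarrow> ereal (RLD_value r G)"
      by simp
    then show ?thesis
      using filterlim_cong[OF refl refl eventually_mono[OF ev eN]] by simp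
  qed
  ultimately show ?thesis by blast
qed

theorem mainTheorem8:
  fixes r :: real and G :: "real^3^3"
  assumes "0 \<le> r" and "r < 1"
    and "transpose G = G"
    and "\<forall>x. x \<noteq> 0 \<longrightarrow> 0 < x \<bullet> (G *v x)"
  shows "let \<theta>0 = (\<chi> i. if i = 3 then r else 0) :: real^3;
             b = trace G - r^2 * G$3$3 + 2 * r * sqrt (G$1$1 * G$2$2 - G$1$2 * G$2$1)
         in QCR_bound \<theta>0 G = ereal b \<and> RLD_bound \<theta>0 G = b \<and>
            (\<forall>Ms. asym_unbiased \<theta>0 Ms \<longrightarrow> ereal b \<le> liminf (\<lambda>n. nTrGV n G (Ms n) \<theta>0)) \<and>
            (\<exists>Ms. asym_unbiased \<theta>0 Ms \<and> (\<lambda>n. nTrGV n G (Ms n) \<theta>0) \<longlonglongrightarrow> ereal b)"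
proof -
  let ?b = "RLD_value r G"
  have lower: "ereal ?b \<le> liminf (\<lambda>n. nTrGV n G (Ms n) (thz r))" if "asym_unbiased (thz r) Ms" for Ms
    using RLD_lower_bound[OF assms that] .
  obtain Ms where Ms: "asym_unbiased (thz r) Ms" "(\<lambda>n. nTrGV n G (Ms n) (thz r)) \<longlonglongrightarrow> ereal ?b"
    using RLD_bound_achieved[OF assms] by blast
  have "QCR_bound (thz r) G = ereal ?b"
  proof (rule antisym)
    have "QCR_bound (thz r) G \<le> liminf (\<lambda>n. nTrGV n G (Ms n) (thz r))"
      unfolding QCR_bound_def using Ms(1) by (intro INF_lower) simp
    then show "QCR_bound (thz r) G \<le> ereal ?b"
      using lim_imp_Liminf[OF _ Ms(2)] by simp
    show "ereal ?b \<le> QCR_bound (thz r) G"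
      unfolding QCR_bound_def using lower by (intro INF_greatest) simp
  qed
  then show ?thesis
    unfolding Let_def thz_def[symmetric] RLD_value_def[symmetric] using RLD_bound_thz[OF assms] lower Ms by blast
qed

end
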